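(* Let $q\ge1$, $d=2^q$. The space $\mathcal M_d^{\otimes2}$ is the direct sum of the following subspaces, each of which carries an irreducible subrepresentation of the two-copy representation $\varphi^{\otimes2}$ of the Clifford group $\mathcal C_q$: for $q=1$: $V_{\mathrm{id}}\oplus V_{\mathrm r}\oplus V_{\mathrm l}\oplus V_0\oplus V_1\oplus V_{\{\mathrm S\}}\oplus V_{\{\mathrm A\}}$; for $q=2$: $V_{\mathrm{id}}\oplus V_{\mathrm r}\oplus V_{\mathrm l}\oplus V_0\oplus V_1\oplus V_2\oplus V_{[\mathrm{adj}]}\oplus V_{[1]}\oplus V_{\{\mathrm{adj}\}}\oplus V_{\{1\}}\oplus V_{\{2\}}\oplus V_{[\mathrm A]}\oplus V^\perp_{\{\mathrm{adj}\}}$; for $q\ge3$: $V_{\mathrm{id}}\oplus V_{\mathrm r}\oplus V_{\mathrm l}\oplus V_0\oplus V_1\oplus V_2\oplus V_{[\mathrm{adj}]}\oplus V_{[1]}\oplus V_{[2]}\oplus V_{\{\mathrm{adj}\}}\oplus V_{\{1\}}\oplus V_{\{2\}}\oplus V_{[\mathrm A]}\oplus V^\perp_{\{\mathrm{adj}\}}$.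
   Context: $\mathcal{M}_d$ is the space of complex $d\times d$ matrices with inner product $\langle A,B\rangle=\mathrm{tr}(A^\dagger B)$. $X,Y,Z$ are the single-qubit Pauli matrices; $\hat{\mathcal{P}}_q$ is the set of $q$-fold tensor products of elements of $\{\mathbb{1},X,Y,Z\}$. Set $\sigma_0=\mathbb 1/\sqrt d$, $\boldsymbol{\sigma}_q=\{P/\sqrt d:P\in\hat{\mathcal P}_q\setminus\{\mathbb 1\}\}$. Normalized product: $\sigma\cdot\tau=\sqrt d\,\sigma\tau$ (for commuting $\sigma\ne\tau$ in $\boldsymbol\sigma_q$ it is $\pm$ an element of $\boldsymbol\sigma_q$; for anticommuting ones $i\sigma\cdot\tau$ is). For $\tau\in\boldsymbol{\sigma}_q$: $\boldsymbol{N}_\tau=\{\sigma\in\boldsymbol{\sigma}_q:\sigma\tau+\tau\sigma=0\}$, $\boldsymbol{C}_\tau=\{\sigma\in\boldsymbol{\sigma}_q\setminus\{\tau\}:\sigma\tau=\tau\sigma\}$. $S_{\sigma,\rho}=\frac1{\sqrt2}(\sigma\otimes\rho+\rho\otimes\sigma)$, $A_{\sigma,\rho}=\frac1{\sqrt2}(\sigma\otimes\rho-\rho\otimes\sigma)$, bilinear in $(\sigma,\rho)$. Spaces: $V_{\mathrm{id}}=\mathrm{span}\{\sigma_0\otimes\sigma_0\}$; $V_{\mathrm r}=\mathrm{span}\{\sigma_0\otimes\tau:\tau\in\boldsymbol\sigma_q\}$; $V_{\mathrm l}=\mathrm{span}\{\tau\otimes\sigma_0:\tau\in\boldsymbol\sigma_q\}$;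 $V_{[\mathrm A]}=\mathrm{span}\{A_{\sigma,\tau}:\tau\in\boldsymbol\sigma_q,\sigma\in\boldsymbol C_\tau\}$; $V_{\{\mathrm A\}}=\mathrm{span}\{A_{\sigma,\tau}:\sigma\in\boldsymbol N_\tau\}$; $V_{\{\mathrm S\}}=\mathrm{span}\{S_{\sigma,\tau}:\sigma\in\boldsymbol N_\tau\}$; $V_0=\mathrm{span}\{\sum_{\sigma\in\boldsymbol\sigma_q}\sigma\otimes\sigma\}$; $V_1$ (resp. $V_2$) $=\{\sum_{\sigma\in\boldsymbol\sigma_q}\lambda_\sigma\sigma\otimes\sigma:\sum_\sigma\lambda_\sigma=0,\ \sum_{\sigma\in\boldsymbol N_\tau}\lambda_\sigma=-\frac d2\lambda_\tau$ (resp. $+\frac d2\lambda_\tau$) $\forall\tau\}$; $V_{[\mathrm{adj}]}=\mathrm{span}\{\sum_{\sigma\in\boldsymbol C_\tau}S_{\sigma,\sigma\cdot\tau}:\tau\in\boldsymbol\sigma_q\}$; $V_{\{\mathrm{adj}\}}=\mathrm{span}\{\sum_{\sigma\in\boldsymbol N_\tau}A_{\sigma,i\sigma\cdot\tau}:\tau\in\boldsymbol\sigma_q\}$; $V^\perp_{\{\mathrm{adj}\}}$ is the orthogonal complement of $V_{\{\mathrm{adj}\}}$ in $V_{\{\mathrm A\}}$. For $\tau\in\boldsymbol\sigma_q$: $V^\tau_{[\mathrm S]}=\mathrm{span}\{S_{\sigma,\sigma\cdot\tau}:\sigma\in\boldsymbol C_\tau\}$ with the well-defined linear map $T_\tau(S_{\sigma,\sigma\cdot\tau})=\frac12\sum_{\rho\in\boldsymbol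 C_\tau\cap\boldsymbol N_\sigma}S_{\rho,\rho\cdot\tau}$, and $V_{[1]}=\bigoplus_\tau\ker(T_\tau+\frac d4)$, $V_{[2]}=\bigoplus_\tau\ker(T_\tau-\frac d4)$; $V^\tau_{\{\mathrm S\}}=\mathrm{span}\{S_{\sigma,i\sigma\cdot\tau}:\sigma\in\boldsymbol N_\tau\}$ with the well-defined linear map $\mathcal A_\tau(S_{\sigma,i\sigma\cdot\tau})=\sum_{\rho\in\boldsymbol N_\tau,\rho\sigma=\sigma\rho}S_{\rho,i\rho\cdot\tau}-\sum_{\rho\in\boldsymbol N_\tau\cap\boldsymbol N_\sigma}S_{\rho,i\rho\cdot\tau}$ (first sum includes $\rho=\sigma$), and $V_{\{1\}}=\bigoplus_\tau\ker(\mathcal A_\tau-d)$, $V_{\{2\}}=\bigoplus_\tau\ker(\mathcal A_\tau+d)$. The Pauli group $\mathcal{P}_q\subset U(2^q)$ consists of all $q$-fold tensor products of elements of the group generated by $X,Z,i\mathbb 1_2$; the Clifford group is $\mathcal{C}_q=\{U\in U(2^q):U\mathcal{P}_qU^\dagger\subseteq\mathcal{P}_q\}/U(1)$. The two-copy representation on $\mathcal{M}_d^{\otimes2}$ is $\varphi^{\otimes2}(C)(A\otimes B)=(CAC^\dagger)\otimes(CBC^\dagger)$, extended linearly. *)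

theory Defs
  imports Complex_Main "HOL-Library.Function_Algebras"
begin

text \<open>Matrices in M_d (d = 2^q) are functions nat => nat => complex, zero outside
  the index range {0..<d}.  Elements of M_d (x) M_d are 4-index tensors
  T i j k l (coefficient of E_ij (x) E_kl), zero outside {0..<d}^4.\<close>

type_synonym cmat = "nat \<Rightarrow> nat \<Rightarrow> complex"
type_synonym ctens = "nat \<Rightarrow> nat \<Rightarrow> nat \<Rightarrow> nat \<Rightarrow> complex"

definition bitof :: "nat \<Rightarrow> nat \<Rightarrow> nat" where
  "bitof t i = (i div 2 ^ t) mod 2"

definition pauli1 :: "nat \<Rightarrow> nat \<Rightarrow> nat \<Rightarrow> complex" where
  "pauli1 k a b =
    (if k = 0 then (if a = b then 1 else 0)
     else if k = 1 then (if a \<noteq> b then 1 else 0)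
     else if k = 2 then (if a = 0 \<and> b = 1 then - \<i> else if a = 1 \<and> b = 0 then \<i> else 0)
     else if k = 3 then (if a = b then (if a = 0 then 1 else -1) else 0)
     else 0)"

definition pstrings :: "nat \<Rightarrow> (nat \<Rightarrow> nat) set" where
  "pstrings q = {s. (\<forall>t<q. s t < 4) \<and> (\<forall>t\<ge>q. s t = 0)}"

definition pmat :: "nat \<Rightarrow> (nat \<Rightarrow> nat) \<Rightarrow> cmat" where
  "pmat q s = (\<lambda>i j. if i < 2 ^ q \<and> j < 2 ^ q
      then (\<Prod>t<q. pauli1 (s t) (bitof t i) (bitof t j)) else 0)"

definition hatP :: "nat \<Rightarrow> cmat set" where
  "hatP q = pmat q ` pstrings q"

definition idm :: "nat \<Rightarrow> cmat" where
  "idm q = pmat q (\<lambda>_. 0)"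

definition msc :: "complex \<Rightarrow> cmat \<Rightarrow> cmat" where
  "msc c A = (\<lambda>i j. c * A i j)"

definition mmult :: "nat \<Rightarrow> cmat \<Rightarrow> cmat \<Rightarrow> cmat" where
  "mmult q A B = (\<lambda>i j. \<Sum>k<2 ^ q. A i k * B k j)"

definition madj :: "cmat \<Rightarrow> cmat" where
  "madj A = (\<lambda>i j. cnj (A j i))"

definition sigma0 :: "nat \<Rightarrow> cmat" where
  "sigma0 q = msc (of_real (1 / sqrt (2 ^ q))) (idm q)"

definition sig :: "nat \<Rightarrow> cmat set" where
  "sig q = msc (of_real (1 / sqrt (2 ^ q))) ` (hatP q - {idm q})"

definition Nset :: "nat \<Rightarrow> cmat \<Rightarrow> cmat set" where
  "Nset q \<tau> = {\<sigma> \<in> sig q. \<forall>i j. mmult q \<sigma> \<tau> i j + mmult q \<tau> \<sigma> i j = 0}"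

definition Cset :: "nat \<Rightarrow> cmat \<Rightarrow> cmat set" where
  "Cset q \<tau> = {\<sigma> \<in> sig q - {\<tau>}. mmult q \<sigma> \<tau> = mmult q \<tau> \<sigma>}"

definition nprod :: "nat \<Rightarrow> cmat \<Rightarrow> cmat \<Rightarrow> cmat" where
  "nprod q \<sigma> \<tau> = msc (of_real (sqrt (2 ^ q))) (mmult q \<sigma> \<tau>)"

definition tens :: "cmat \<Rightarrow> cmat \<Rightarrow> ctens" where
  "tens A B = (\<lambda>i j k l. A i j * B k l)"

definition tsc :: "complex \<Rightarrow> ctens \<Rightarrow> ctens" where
  "tsc c T = (\<lambda>i j k l. c * T i j k l)"

definition Ssym :: "cmat \<Rightarrow> cmat \<Rightarrow> ctens" where
  "Ssym \<sigma> \<rho> = tsc (of_real (1 / sqrt 2)) (tens \<sigma> \<rho> + tens \<rho> \<sigma>)"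

definition Aasym :: "cmat \<Rightarrow> cmat \<Rightarrow> ctens" where
  "Aasym \<sigma> \<rho> = tsc (of_real (1 / sqrt 2)) (tens \<sigma> \<rho> - tens \<rho> \<sigma>)"

definition cspan :: "ctens set \<Rightarrow> ctens set" where
  "cspan S = {x. \<exists>F c. finite F \<and> F \<subseteq> S \<and> x = (\<Sum>v\<in>F. tsc (c v) v)}"

definition csubspace :: "ctens set \<Rightarrow> bool" where
  "csubspace W \<longleftrightarrow> 0 \<in> W \<and> (\<forall>x\<in>W. \<forall>y\<in>W. x + y \<in> W) \<and> (\<forall>c. \<forall>x\<in>W. tsc c x \<in> W)"

definition tinner :: "nat \<Rightarrow> ctens \<Rightarrow> ctens \<Rightarrow> complex" where
  "tinner q T U = (\<Sum>i<2^q. \<Sum>j<2^q. \<Sum>k<2^q. \<Sum>l<2^q. cnj (T i j k l) * U i j k l)"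

definition Tspace :: "nat \<Rightarrow> ctens set" where
  "Tspace q = {T. \<forall>i j k l. (2 ^ q \<le> i \<or> 2 ^ q \<le> j \<or> 2 ^ q \<le> k \<or> 2 ^ q \<le> l) \<longrightarrow> T i j k l = 0}"

definition V_id :: "nat \<Rightarrow> ctens set" where
  "V_id q = cspan {tens (sigma0 q) (sigma0 q)}"

definition V_r :: "nat \<Rightarrow> ctens set" where
  "V_r q = cspan ((\<lambda>\<tau>. tens (sigma0 q) \<tau>) ` sig q)"

definition V_l :: "nat \<Rightarrow> ctens set" where
  "V_l q = cspan ((\<lambda>\<tau>. tens \<tau> (sigma0 q)) ` sig q)"

definition V_A_br :: "nat \<Rightarrow> ctens set" where
  "V_A_br q = cspan {Aasym \<sigma> \<tau> | \<sigma> \<tau>. \<tau> \<in> sig q \<and> \<sigma> \<in> Cset q \<tau>}"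

definition V_A_cu :: "nat \<Rightarrow> ctens set" where
  "V_A_cu q = cspan {Aasym \<sigma> \<tau> | \<sigma> \<tau>. \<tau> \<in> sig q \<and> \<sigma> \<in> Nset q \<tau>}"

definition V_S_cu :: "nat \<Rightarrow> ctens set" where
  "V_S_cu q = cspan {Ssym \<sigma> \<tau> | \<sigma> \<tau>. \<tau> \<in> sig q \<and> \<sigma> \<in> Nset q \<tau>}"

definition V_0 :: "nat \<Rightarrow> ctens set" where
  "V_0 q = cspan {\<Sum>\<sigma>\<in>sig q. tens \<sigma> \<sigma>}"

definition V_lam :: "nat \<Rightarrow> complex \<Rightarrow> ctens set" where
  "V_lam q sg = {\<Sum>\<sigma>\<in>sig q. tsc (lam \<sigma>) (tens \<sigma> \<sigma>) | lam.
      (\<Sum>\<sigma>\<in>sig q. lam \<sigma>) = 0 \<and>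
      (\<forall>\<tau>\<in>sig q. (\<Sum>\<sigma>\<in>Nset q \<tau>. lam \<sigma>) = sg * (of_nat (2 ^ q) / 2) * lam \<tau>)}"

definition V_1 :: "nat \<Rightarrow> ctens set" where
  "V_1 q = V_lam q (-1)"

definition V_2 :: "nat \<Rightarrow> ctens set" where
  "V_2 q = V_lam q 1"

definition V_adj_br :: "nat \<Rightarrow> ctens set" where
  "V_adj_br q = cspan ((\<lambda>\<tau>. \<Sum>\<sigma>\<in>Cset q \<tau>. Ssym \<sigma> (nprod q \<sigma> \<tau>)) ` sig q)"

definition V_adj_cu :: "nat \<Rightarrow> ctens set" where
  "V_adj_cu q = cspan ((\<lambda>\<tau>. \<Sum>\<sigma>\<in>Nset q \<tau>. Aasym \<sigma> (msc \<i> (nprod q \<sigma> \<tau>))) ` sig q)"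

definition V_adj_perp :: "nat \<Rightarrow> ctens set" where
  "V_adj_perp q = {T \<in> V_A_cu q. \<forall>U\<in>V_adj_cu q. tinner q U T = 0}"

text \<open>T_tau on the generator S_{sigma, sigma.tau}.\<close>
definition Tgen :: "nat \<Rightarrow> cmat \<Rightarrow> cmat \<Rightarrow> ctens" where
  "Tgen q \<tau> \<sigma> = tsc (1/2) (\<Sum>\<rho>\<in>Cset q \<tau> \<inter> Nset q \<sigma>. Ssym \<rho> (nprod q \<rho> \<tau>))"

text \<open>ker(T_tau - mu) inside V^tau_[S]: elements sum_sigma c_sigma S_{sigma,sigma.tau}
  with sum_sigma c_sigma T_tau(S_{sigma,sigma.tau}) = mu * (that element).\<close>
definition K_br :: "nat \<Rightarrow> cmat \<Rightarrow> complex \<Rightarrow> ctens set" where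
  "K_br q \<tau> \<mu> = {\<Sum>\<sigma>\<in>Cset q \<tau>. tsc (c \<sigma>) (Ssym \<sigma> (nprod q \<sigma> \<tau>)) | c.
      (\<Sum>\<sigma>\<in>Cset q \<tau>. tsc (c \<sigma>) (Tgen q \<tau> \<sigma>))
        = tsc \<mu> (\<Sum>\<sigma>\<in>Cset q \<tau>. tsc (c \<sigma>) (Ssym \<sigma> (nprod q \<sigma> \<tau>)))}"

text \<open>A_tau on the generator S_{sigma, i sigma.tau}.\<close>
definition Agen :: "nat \<Rightarrow> cmat \<Rightarrow> cmat \<Rightarrow> ctens" where
  "Agen q \<tau> \<sigma> =
     (\<Sum>\<rho>\<in>{\<rho> \<in> Nset q \<tau>. mmult q \<rho> \<sigma> = mmult q \<sigma> \<rho>}. Ssym \<rho> (msc \<i> (nprod q \<rho> \<tau>)))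
   - (\<Sum>\<rho>\<in>Nset q \<tau> \<inter> Nset q \<sigma>. Ssym \<rho> (msc \<i> (nprod q \<rho> \<tau>)))"

definition K_cu :: "nat \<Rightarrow> cmat \<Rightarrow> complex \<Rightarrow> ctens set" where
  "K_cu q \<tau> \<mu> = {\<Sum>\<sigma>\<in>Nset q \<tau>. tsc (c \<sigma>) (Ssym \<sigma> (msc \<i> (nprod q \<sigma> \<tau>))) | c.
      (\<Sum>\<sigma>\<in>Nset q \<tau>. tsc (c \<sigma>) (Agen q \<tau> \<sigma>))
        = tsc \<mu> (\<Sum>\<sigma>\<in>Nset q \<tau>. tsc (c \<sigma>) (Ssym \<sigma> (msc \<i> (nprod q \<sigma> \<tau>))))}"

definition sum_tau :: "nat \<Rightarrow> (cmat \<Rightarrow> ctens set) \<Rightarrow> ctens set" where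
  "sum_tau q K = {\<Sum>\<tau>\<in>sig q. x \<tau> | x. \<forall>\<tau>\<in>sig q. x \<tau> \<in> K \<tau>}"

definition V_br1 :: "nat \<Rightarrow> ctens set" where
  "V_br1 q = sum_tau q (\<lambda>\<tau>. K_br q \<tau> (- of_nat (2 ^ q) / 4))"

definition V_br2 :: "nat \<Rightarrow> ctens set" where
  "V_br2 q = sum_tau q (\<lambda>\<tau>. K_br q \<tau> (of_nat (2 ^ q) / 4))"

definition V_cu1 :: "nat \<Rightarrow> ctens set" where
  "V_cu1 q = sum_tau q (\<lambda>\<tau>. K_cu q \<tau> (of_nat (2 ^ q)))"

definition V_cu2 :: "nat \<Rightarrow> ctens set" where
  "V_cu2 q = sum_tau q (\<lambda>\<tau>. K_cu q \<tau> (- of_nat (2 ^ q)))"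

definition pauli_grp :: "nat \<Rightarrow> cmat set" where
  "pauli_grp q = {M. \<exists>k s. s \<in> pstrings q \<and>
      M = (\<lambda>i j. if i < 2 ^ q \<and> j < 2 ^ q
             then (\<Prod>t<q. \<i> ^ (k t) * pauli1 (s t) (bitof t i) (bitof t j)) else 0)}"

definition unitary_mat :: "nat \<Rightarrow> cmat \<Rightarrow> bool" where
  "unitary_mat q U \<longleftrightarrow> (\<forall>i j. (2 ^ q \<le> i \<or> 2 ^ q \<le> j) \<longrightarrow> U i j = 0)
      \<and> mmult q U (madj U) = idm q \<and> mmult q (madj U) U = idm q"

text \<open>Representatives of Clifford group elements (phase quotient irrelevant for
  the two-copy action).\<close>
definition clifford :: "nat \<Rightarrow> cmat set" where
  "clifford q = {U. unitary_mat q U \<and>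
      (\<forall>P\<in>pauli_grp q. mmult q (mmult q U P) (madj U) \<in> pauli_grp q)}"

text \<open>Two-copy action: A (x) B |-> (U A U^dag) (x) (U B U^dag), extended linearly.\<close>
definition phi2 :: "nat \<Rightarrow> cmat \<Rightarrow> ctens \<Rightarrow> ctens" where
  "phi2 q U T = (\<lambda>i j k l. \<Sum>a<2^q. \<Sum>b<2^q. \<Sum>c<2^q. \<Sum>e<2^q.
      U i a * cnj (U j b) * U k c * cnj (U l e) * T a b c e)"

definition invariant :: "nat \<Rightarrow> ctens set \<Rightarrow> bool" where
  "invariant q W \<longleftrightarrow> (\<forall>U\<in>clifford q. \<forall>T\<in>W. phi2 q U T \<in> W)"

definition irrep_sub :: "nat \<Rightarrow> ctens set \<Rightarrow> bool" where
  "irrep_sub q W \<longleftrightarrow> csubspace W \<and> W \<subseteq> Tspace q \<and> W \<noteq> {0} \<and> invariant q W \<and>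
     (\<forall>W'. csubspace W' \<and> W' \<subseteq> W \<and> invariant q W' \<longrightarrow> W' = {0} \<or> W' = W)"

definition direct_sum :: "nat \<Rightarrow> ctens set list \<Rightarrow> bool" where
  "direct_sum q Vs \<longleftrightarrow> (\<forall>V\<in>set Vs. V \<subseteq> Tspace q) \<and>
     (\<forall>T\<in>Tspace q. \<exists>!x. (\<forall>i<length Vs. x i \<in> Vs ! i) \<and> (\<forall>i\<ge>length Vs. x i = 0)
        \<and> T = (\<Sum>i<length Vs. x i))"

definition irrep_decomposition :: "nat \<Rightarrow> ctens set list \<Rightarrow> bool" where
  "irrep_decomposition q Vs \<longleftrightarrow> direct_sum q Vs \<and> (\<forall>V\<in>set Vs. irrep_sub q V)"

end

theory Submission
  imports Defs "HOL-Library.FuncSet"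
begin

text \<open>Label Pauli strings by a finite symplectic \<open>F_2\<close>-space \<open>V\<close> and let \<open>eps a b = \<plusminus>1\<close> be the sign
  with which \<open>P_a\<close> and \<open>P_b\<close> commute.  Conjugation by Pauli matrices splits the two-copy space into
  weight spaces: the one of weight \<open>\<tau>\<close> has the basis \<open>\<sigma>_a \<otimes> (\<sigma>_a \<cdot> \<sigma>_\<tau>)\<close>, so its elements are functions
  \<open>f\<close> on \<open>V\<close>.  In this basis a Clifford unitary acts without signs depending on \<open>a\<close>, hence as
  a symplectic map on \<open>\<tau>\<close> and on the argument of \<open>f\<close>, up to a scalar.  Every subspace of the theorem
  is cut out by conditions on the functions \<open>f\<close> that are natural in \<open>\<tau>\<close>: a support, a (skew-)periodicity
  under translation by \<open>\<tau>\<close>, being constant, having sum zero, or being an eigenvector for \<open>\<plusminus>d\<close> of the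
  symplectic Fourier transform \<open>(F f)(a) = \<Sum>_b eps a b f(b)\<close>, for which \<open>F^2 = d^2\<close>; the eigenvalue conditions
  of the maps \<open>T_tau\<close> and \<open>A_tau\<close> and those defining \<open>V_1\<close> and \<open>V_2\<close> all become \<open>F f = \<plusminus>d f\<close>.

  Irreducibility only needs the Clifford unitaries \<open>(1 + i P_v) / sqrt 2\<close>, which act as the transvections of \<open>V\<close>
  and whose squares are Pauli matrices.  An invariant subspace contains a nonzero weight vector
  \<open>f\<close>.  Averaging \<open>f\<close> over the group generated by the transvections fixing \<open>\<tau>\<close> and a point \<open>a\<close> gives a function
  that is constant on the orbits of this group, which is unique up to scalars in each
  of the subspaces; up to a scalar it is a reproducing kernel at \<open>a\<close>, and the kernels span the weight space.\<close>

section \<open>Signed symplectic spaces and transvections\<close>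

text \<open>The signs disappear because of a cocycle identity. If a Clifford unitary sends
  \<open>P_a\<close> to \<open>s a * P_(g a)\<close>, comparing the images of \<open>P_a P_b\<close>
  gives \<open>phase a b * s (a + b) = s a * s b * phase (g a) (g b)\<close>. A basis of weight
  \<tau> with the phase built in is therefore multiplied by \<open>s \<tau>\<close> alone. In this
  basis the exchange of the tensor factors sends \<open>f\<close> to the function
  \<open>eps x \<tau> * f (x + \<tau>)\<close> of \<open>x\<close>, so symmetric tensors are
  periodic on the points commuting with \<tau> and skew-periodic on the anticommuting ones. Sums
  over anticommuting points have the kernel \<open>(1 - eps) / 2\<close>; its minus sign turns the
  eigenvalues \<open>- d / 2\<close> and \<open>- d / 4\<close> of the definitions into
  \<open>+ d\<close> for the transform. The dependence on \<open>q\<close> comes from counting: if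
  only the span of \<open>a\<close> and \<tau> commutes with both, the eigenvalue \<open>- d\<close>
  cannot occur on the commuting points, which removes \<open>V_2\<close> for \<open>q = 1\<close>
  and \<open>V_[2]\<close> for \<open>q = 2\<close>. The commuting set leaves out zero and \<tau>,
  where a transform need not vanish. Hence the mean must be removed before splitting by eigenvalues,
  and the kernels there carry a correction.\<close>

locale sign_form =
  fixes V :: "'v set" and add :: "'v \<Rightarrow> 'v \<Rightarrow> 'v" (infixl "\<oplus>" 65)
    and zero :: 'v ("\<zero>") and eps :: "'v \<Rightarrow> 'v \<Rightarrow> complex" and D :: nat
  assumes finite_V: "finite V" and zero_V [simp]: "\<zero> \<in> V"
    and add_V [simp]: "a \<in> V \<Longrightarrow> b \<in> V \<Longrightarrow> a \<oplus> b \<in> V"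
    and add_assoc: "a \<oplus> b \<oplus> c = a \<oplus> (b \<oplus> c)"
    and add_comm: "a \<oplus> b = b \<oplus> a"
    and add_self [simp]: "a \<oplus> a = \<zero>" and add_zero [simp]: "\<zero> \<oplus> a = a"
    and eps_sym: "eps a b = eps b a"
    and eps_add: "eps a (b \<oplus> c) = eps a b * eps a c"
    and eps_self [simp]: "eps a a = 1"
    and eps_cases: "eps a b = 1 \<or> eps a b = -1"
    \<comment> \<open>Nondegeneracy as orthogonality of characters: a nonzero \<open>b\<close>
      anticommutes with exactly half of \<open>V\<close>. The case \<open>b = \<zero>\<close> gives
      \<open>card V = D^2\<close>, so \<open>D\<close> becomes \<open>2^q\<close> for Pauli
      strings.\<close>
    and sum_eps: "b \<in> V \<Longrightarrow> (\<Sum>a\<in>V. eps a b) = (if b = \<zero> then of_nat D ^ 2 else 0)"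
    and D_ge: "D \<ge> 2"
begin

lemma add_left_comm: "a \<oplus> (b \<oplus> c) = b \<oplus> (a \<oplus> c)"
  by (metis add_assoc add_comm)

lemmas add_ac = add_assoc add_comm add_left_comm

lemma add_zero2 [simp]: "a \<oplus> \<zero> = a" by (simp add: add_comm[of a])

lemma add_self_left [simp]: "a \<oplus> (a \<oplus> b) = b" by (simp flip: add_assoc)

lemma add_self_right [simp]: "b \<oplus> a \<oplus> a = b" by (simp add: add_assoc)

lemma add_eq_zero [simp]: "a \<oplus> b = \<zero> \<longleftrightarrow> a = b"
  by (metis add_self add_self_left add_zero2)

lemma zero_eq_add [simp]: "\<zero> = a \<oplus> b \<longleftrightarrow> a = b"
  by (metis add_eq_zero)

lemma add_eq_self [simp]: "a \<oplus> b = a \<longleftrightarrow> b = \<zero>" "b \<oplus> a = a \<longleftrightarrow> b = \<zero>"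
  by (metis add_self_left add_self add_zero2 add_comm)+

lemma self_eq_add [simp]: "a = a \<oplus> b \<longleftrightarrow> b = \<zero>" "a = b \<oplus> a \<longleftrightarrow> b = \<zero>"
  by (metis add_eq_self)+

lemma add_cancel [simp]: "a \<oplus> c = b \<oplus> c \<longleftrightarrow> a = b" "c \<oplus> a = c \<oplus> b \<longleftrightarrow> a = b"
  by (metis add_self_right add_comm)+

lemma add_move: "a \<oplus> c = b \<longleftrightarrow> a = b \<oplus> c" by auto

lemma eps_add2: "eps (b \<oplus> c) a = eps b a * eps c a"
  by (simp add: eps_sym[of _ a] eps_add)

lemma eps_zero [simp]: "eps \<zero> a = 1" "eps a \<zero> = 1"
  using eps_cases[of "\<zero>" a] eps_add2[of "\<zero>" "\<zero>" a] by (auto simp: eps_sym[of a])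

lemma eps_sq [simp]: "eps a b * eps a b = 1" "eps a b * (eps a b * x) = x"
  using eps_cases[of a b] by auto

lemma eps_sym1: "eps a b = 1 \<Longrightarrow> eps b a = 1" by (simp add: eps_sym)

lemma eps_neq [simp]: "eps a b \<noteq> 1 \<longleftrightarrow> eps a b = -1" "eps a b \<noteq> -1 \<longleftrightarrow> eps a b = 1"
  using eps_cases[of a b] by auto

lemma D_pos [simp]: "(of_nat D :: complex) \<noteq> 0" "D \<noteq> 0" using D_ge by auto

lemma sum_shift: "b \<in> V \<Longrightarrow> (\<Sum>a\<in>V. f (a \<oplus> b)) = sum f V"
  by (rule sum.reindex_bij_witness[of _ "\<lambda>a. a \<oplus> b" "\<lambda>a. a \<oplus> b"]) auto

lemma card_V: "of_nat (card V) = (of_nat D ^ 2 :: complex)"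
  using sum_eps[of "\<zero>"] by simp

lemma sum_eps2: "b \<in> V \<Longrightarrow> (\<Sum>a\<in>V. eps b a) = (if b = \<zero> then of_nat D ^ 2 else 0)"
  using sum_eps[of b] by (simp add: eps_sym[of b])

text \<open>The symplectic transvection along \<open>v\<close>, with the pairing read off from the
  sign.\<close>

definition transv :: "'v \<Rightarrow> 'v \<Rightarrow> 'v" where
  "transv v a = (if eps v a = 1 then a else a \<oplus> v)"

text \<open>Everything is required on \<open>V\<close> only: the type may be larger, and the maps
  coming from Clifford unitaries are chosen pointwise on \<open>V\<close>.\<close>

definition form_aut :: "('v \<Rightarrow> 'v) \<Rightarrow> bool" where
  "form_aut g \<longleftrightarrow> bij_betw g V V \<and> (\<forall>a\<in>V. \<forall>b\<in>V. g (a \<oplus> b) = g a \<oplus> g b \<and> eps (g a) (g b) = eps a b)"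

lemma transv_V [simp]: "v \<in> V \<Longrightarrow> a \<in> V \<Longrightarrow> transv v a \<in> V"
  by (simp add: transv_def)

lemma transv_fix: "eps v a = 1 \<Longrightarrow> transv v a = a" by (simp add: transv_def)

lemma transv_invol [simp]: "transv v (transv v a) = a"
  by (auto simp: transv_def eps_add)

lemma transv_add: "transv v (a \<oplus> b) = transv v a \<oplus> transv v b"
  using eps_cases[of v a] eps_cases[of v b] by (auto simp: transv_def eps_add add_ac)

lemma eps_transv: "eps (transv v a) (transv v b) = eps a b"
  using eps_cases[of v a] eps_cases[of v b]
  by (auto simp: transv_def eps_add eps_add2 eps_sym[of _ v])

lemma form_aut_transv: "v \<in> V \<Longrightarrow> form_aut (transv v)"
  unfolding form_aut_def using transv_add eps_transv
  by (auto intro!: bij_betw_byWitness[where f' = "transv v"])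

lemma form_aut_id: "form_aut (\<lambda>x. x)" unfolding form_aut_def by (auto simp: bij_betw_def)

lemma form_aut_zero: "form_aut g \<Longrightarrow> g \<zero> = \<zero>"
  unfolding form_aut_def by (metis add_self zero_V)

lemma form_autD:
  assumes "form_aut g"
  shows "bij_betw g V V" "a \<in> V \<Longrightarrow> g a \<in> V" "a \<in> V \<Longrightarrow> b \<in> V \<Longrightarrow> g (a \<oplus> b) = g a \<oplus> g b"
    "a \<in> V \<Longrightarrow> b \<in> V \<Longrightarrow> eps (g a) (g b) = eps a b"
    "a \<in> V \<Longrightarrow> b \<in> V \<Longrightarrow> g a = g b \<longleftrightarrow> a = b"
    "a \<in> V \<Longrightarrow> g a = \<zero> \<longleftrightarrow> a = \<zero>"
  using assms form_aut_zero[OF assms] unfolding form_aut_def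
  by (auto simp: bij_betw_def inj_on_def) (metis zero_V)

text \<open>With three characters the count of solutions expands into eight sums of characters, of which
  those involving \<open>c\<close> vanish.\<close>

lemma exists_separating:
  assumes "a \<in> V" "b \<in> V" "c \<in> V" "c \<noteq> \<zero>" "c \<noteq> a" "c \<noteq> b" "c \<noteq> a \<oplus> b"
  shows "\<exists>v\<in>V. eps v a = 1 \<and> eps v b = 1 \<and> eps v c = -1"
proof (rule ccontr)
  assume neg: "\<not> ?thesis"
  have "(\<Sum>v\<in>V. (1 + eps v a) * (1 + eps v b) * (1 - eps v c)) = 0"
  proof (rule sum.neutral, rule ballI)
    fix v assume "v \<in> V"
    then show "(1 + eps v a) * (1 + eps v b) * (1 - eps v c) = 0"
      using neg eps_cases[of v a] eps_cases[of v b] eps_cases[of v c] by auto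
  qed
  also have "(\<Sum>v\<in>V. (1 + eps v a) * (1 + eps v b) * (1 - eps v c)) =
     (\<Sum>v\<in>V. eps v \<zero> + eps v a + eps v b + eps v (a \<oplus> b)
        - eps v c - eps v (a \<oplus> c) - eps v (b \<oplus> c) - eps v (a \<oplus> b \<oplus> c))"
    by (rule sum.cong) (auto simp: eps_add algebra_simps)
  also have "\<dots> = of_nat D ^ 2 * of_nat (Suc (of_bool (a = \<zero>) + of_bool (b = \<zero>) + of_bool (a = b)))"
  proof -
    have "a \<oplus> c \<noteq> \<zero>" "b \<oplus> c \<noteq> \<zero>" "a \<oplus> b \<oplus> c \<noteq> \<zero>" using assms by auto
    then show ?thesis
      using assms(1-4) by (simp only: sum.distrib sum_subtractf sum_eps add_V zero_V if_True if_False add_eq_zero)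
        (simp add: of_bool_def algebra_simps)
  qed
  finally show False by (simp del: of_nat_Suc of_nat_add)
qed

text \<open>A form of Witt's theorem: outside the span of \<open>a\<close> and \<open>b\<close>, the
  signs against \<open>a\<close> and \<open>b\<close> are the only invariants. If \<open>c\<close>
  and \<open>c'\<close> anticommute, one transvection along \<open>c \<oplus> c'\<close> suffices,
  and equality of the signs makes it fix \<open>a\<close> and \<open>b\<close>; otherwise an
  intermediate point is used.\<close>

lemma transv_orbit:
  assumes V: "a \<in> V" "b \<in> V" "c \<in> V" "c' \<in> V"
    and ea: "eps c a = eps c' a" and eb: "eps c b = eps c' b"
    and c: "c \<noteq> \<zero>" "c \<noteq> a" "c \<noteq> b" "c \<noteq> a \<oplus> b"
    and c': "c' \<noteq> \<zero>" "c' \<noteq> a" "c' \<noteq> b" "c' \<noteq> a \<oplus> b"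
  shows "\<exists>v\<in>V. \<exists>w\<in>V. eps v a = 1 \<and> eps v b = 1 \<and> eps w a = 1 \<and> eps w b = 1 \<and>
           transv v (transv w c) = c'"
proof (cases "eps c c' = 1")
  case False
  then have "transv (c \<oplus> c') (transv \<zero> c) = c'"
    using eps_cases[of c c'] by (simp add: transv_def eps_add2 eps_sym[of c'])
  then show ?thesis using V ea eb
    by (intro bexI[of _ "c \<oplus> c'"] bexI[of _ "\<zero>"]) (auto simp: eps_add2)
next
  case True
  obtain v1 where v1: "v1 \<in> V" "eps v1 a = 1" "eps v1 b = 1" "eps v1 c = -1"
    using exists_separating[of a b c] V c by auto
  obtain v2 where v2: "v2 \<in> V" "eps v2 a = 1" "eps v2 b = 1" "eps v2 c' = -1"
    using exists_separating[of a b c'] V c' by auto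
  \<comment> \<open>If each separating vector anticommutes only with its own point, their sum
    anticommutes with both.\<close>
  have "\<exists>v\<in>V. eps v a = 1 \<and> eps v b = 1 \<and> eps v c = -1 \<and> eps v c' = -1"
  proof (cases "eps v1 c' = -1 \<or> eps v2 c = -1")
    case True then show ?thesis using v1 v2 by blast
  next
    case False
    then show ?thesis using v1 v2 by (intro bexI[of _ "v1 \<oplus> v2"]) (auto simp: eps_add2)
  qed
  then obtain v where v: "v \<in> V" "eps v a = 1" "eps v b = 1" "eps v c = -1" "eps v c' = -1" by auto
  \<comment> \<open>The intermediate point is \<open>c \<oplus> v\<close>; it anticommutes with
    \<open>c'\<close> because \<open>c\<close> commutes with \<open>c'\<close> and \<open>v\<close>
    does not.\<close>
  have "transv (c \<oplus> c' \<oplus> v) (transv v c) = c'"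
    using v True by (simp add: transv_def eps_add eps_add2 eps_sym[of _ v] eps_sym[of c' c] add_ac)
  then show ?thesis using v V ea eb
    by (intro bexI[of _ "c \<oplus> c' \<oplus> v"] bexI[of _ v]) (auto simp: eps_add2)
qed


section \<open>The symplectic Fourier transform and natural families of functions\<close>

definition fourier :: "('v \<Rightarrow> complex) \<Rightarrow> 'v \<Rightarrow> complex" where
  "fourier f a = (\<Sum>b\<in>V. eps a b * f b)"

text \<open>Leaving out both \<open>\<zero>\<close> and \<tau> matches \<open>Cset\<close>, which
  never contains the identity. For \<open>\<tau> = \<zero>\<close> all nonzero points remain, so the
  diagonal tensors are the weight zero case of the same families.\<close>

definition comm_set :: "'v \<Rightarrow> 'v set" where
  "comm_set \<tau> = {a \<in> V. eps a \<tau> = 1 \<and> a \<noteq> \<zero> \<and> a \<noteq> \<tau>}"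

definition anti_set :: "'v \<Rightarrow> 'v set" where
  "anti_set \<tau> = {a \<in> V. eps a \<tau> = -1}"

lemma fourier_cong: "(\<And>b. b \<in> V \<Longrightarrow> f b = g b) \<Longrightarrow> fourier f a = fourier g a"
  by (simp add: fourier_def)

lemma fourier_add: "fourier (\<lambda>x. f x + g x) a = fourier f a + fourier g a"
  by (simp add: fourier_def sum.distrib algebra_simps)

lemma fourier_diff: "fourier (\<lambda>x. f x - g x) a = fourier f a - fourier g a"
  by (simp add: fourier_def sum_subtractf algebra_simps)

lemma fourier_scale: "fourier (\<lambda>x. k * f x) a = k * fourier f a"
  by (simp add: fourier_def sum_distrib_left algebra_simps)

lemma fourier_zero: "fourier f \<zero> = sum f V"
  by (simp add: fourier_def)

text \<open>Every point is its own inverse, so the two kernels combine to the character of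
  \<open>a \<oplus> c\<close>, whose sum vanishes unless \<open>c = a\<close>.\<close>

lemma fourier_fourier:
  assumes "a \<in> V"
  shows "fourier (fourier f) a = of_nat D ^ 2 * f a"
proof -
  have "fourier (fourier f) a = (\<Sum>b\<in>V. \<Sum>c\<in>V. eps b (a \<oplus> c) * f c)"
    unfolding fourier_def sum_distrib_left
    by (intro sum.cong refl) (simp add: eps_add eps_sym[of a] algebra_simps)
  also have "\<dots> = (\<Sum>c\<in>V. (\<Sum>b\<in>V. eps b (a \<oplus> c)) * f c)"
    by (subst sum.swap) (simp add: sum_distrib_right)
  also have "\<dots> = (\<Sum>c\<in>V. if a = c then of_nat D ^ 2 * f c else 0)"
    using assms by (intro sum.cong refl) (simp add: sum_eps)
  also have "\<dots> = of_nat D ^ 2 * f a"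
    using assms by (simp add: finite_V)
  finally show ?thesis .
qed

text \<open>Isometries preserve the kernel \<open>eps\<close> and permute the summation range; the
  scalar \<open>k\<close> makes room for the sign in the Clifford action.\<close>

lemma fourier_aut:
  assumes "form_aut g" "\<forall>a\<in>V. f' (g a) = k * f a" "a \<in> V"
  shows "fourier f' (g a) = k * fourier f a"
proof -
  have "fourier f' (g a) = (\<Sum>b\<in>V. eps (g a) (g b) * f' (g b))"
    unfolding fourier_def
    by (rule sum.reindex_bij_betw[OF form_autD(1)[OF assms(1)], of "\<lambda>b. eps (g a) b * f' b", symmetric])
  also have "\<dots> = k * fourier f a"
    unfolding fourier_def sum_distrib_left using assms form_autD(4)[OF assms(1)]
    by (intro sum.cong) (auto simp: algebra_simps)
  finally show ?thesis .
qed

text \<open>The last clause describes what a Clifford unitary does to a weight vector. With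
  \<open>h\<close> the identity it also gives closure under scalars and independence of the values
  outside \<open>V\<close>.\<close>

definition admissible :: "('v \<Rightarrow> ('v \<Rightarrow> complex) \<Rightarrow> bool) \<Rightarrow> bool" where
  "admissible \<Phi> \<longleftrightarrow> (\<forall>\<tau>\<in>V. \<Phi> \<tau> (\<lambda>_. 0)) \<and>
     (\<forall>\<tau>\<in>V. \<forall>f g. \<Phi> \<tau> f \<longrightarrow> \<Phi> \<tau> g \<longrightarrow> \<Phi> \<tau> (\<lambda>x. f x + g x)) \<and>
     (\<forall>h. \<forall>\<tau>\<in>V. \<forall>k f f'. form_aut h \<longrightarrow> \<Phi> \<tau> f \<longrightarrow> (\<forall>a\<in>V. f' (h a) = k * f a) \<longrightarrow> \<Phi> (h \<tau>) f')"

lemma admissibleD: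
  assumes "admissible \<Phi>" "\<tau> \<in> V"
  shows "\<Phi> \<tau> (\<lambda>_. 0)" "\<Phi> \<tau> f \<Longrightarrow> \<Phi> \<tau> g \<Longrightarrow> \<Phi> \<tau> (\<lambda>x. f x + g x)"
    "\<Phi> \<tau> f \<Longrightarrow> \<Phi> \<tau> (\<lambda>x. k * f x)"
    "\<Phi> \<tau> f \<Longrightarrow> (\<And>a. a \<in> V \<Longrightarrow> f a = g a) \<Longrightarrow> \<Phi> \<tau> g"
    "form_aut h \<Longrightarrow> \<Phi> \<tau> f \<Longrightarrow> \<forall>a\<in>V. f' (h a) = k * f a \<Longrightarrow> \<Phi> (h \<tau>) f'"
proof -
  show cov: "\<Phi> (h \<tau>) f'" if "form_aut h" "\<Phi> \<tau> f" "\<forall>a\<in>V. f' (h a) = k * f a" for h f f' k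
    using assms that unfolding admissible_def by blast
  show "\<Phi> \<tau> (\<lambda>_. 0)" "\<Phi> \<tau> f \<Longrightarrow> \<Phi> \<tau> g \<Longrightarrow> \<Phi> \<tau> (\<lambda>x. f x + g x)"
    using assms unfolding admissible_def by blast+
  show "\<Phi> \<tau> f \<Longrightarrow> \<Phi> \<tau> (\<lambda>x. k * f x)"
    using cov[OF form_aut_id, of f "\<lambda>x. k * f x" k] by simp
  show "\<Phi> \<tau> f \<Longrightarrow> (\<And>a. a \<in> V \<Longrightarrow> f a = g a) \<Longrightarrow> \<Phi> \<tau> g"
    using cov[OF form_aut_id, of f g 1] by simp
qed

lemma admissible_conj:
  assumes "admissible \<Phi>" "admissible \<Psi>"
  shows "admissible (\<lambda>\<tau> f. \<Phi> \<tau> f \<and> \<Psi> \<tau> f)"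
  unfolding admissible_def
proof (intro conjI ballI allI impI; (elim conjE)?)
  fix h \<tau> k f f'
  assume *: "\<tau> \<in> V" "form_aut h" "\<Phi> \<tau> f" "\<Psi> \<tau> f" "\<forall>a\<in>V. f' (h a) = k * f a"
  show "\<Phi> (h \<tau>) f'" using admissibleD(5)[OF assms(1) *(1,2,3,5)] .
  show "\<Psi> (h \<tau>) f'" using admissibleD(5)[OF assms(2) *(1,2,4,5)] .
qed (use assms in \<open>simp_all add: admissibleD\<close>)

text \<open>The weights form two orbits, zero and nonzero, and an irreducible space lives on one of
  them. The implication lets the zero function pass at every weight, which keeps the condition
  linear.\<close>

definition orbit_type :: "bool \<Rightarrow> 'v \<Rightarrow> ('v \<Rightarrow> complex) \<Rightarrow> bool" where
  "orbit_type z \<tau> f \<longleftrightarrow> (\<exists>a\<in>V. f a \<noteq> 0) \<longrightarrow> (\<tau> = \<zero>) = z"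

definition supp_in :: "('v \<Rightarrow> 'v set) \<Rightarrow> 'v \<Rightarrow> ('v \<Rightarrow> complex) \<Rightarrow> bool" where
  "supp_in R \<tau> f \<longleftrightarrow> (\<forall>a\<in>V. f a \<noteq> 0 \<longrightarrow> a \<in> R \<tau>)"

definition periodic :: "complex \<Rightarrow> 'v \<Rightarrow> ('v \<Rightarrow> complex) \<Rightarrow> bool" where
  "periodic \<eta> \<tau> f \<longleftrightarrow> (\<forall>a\<in>V. f (a \<oplus> \<tau>) = \<eta> * f a)"

definition fourier_eig :: "complex \<Rightarrow> 'v \<Rightarrow> ('v \<Rightarrow> complex) \<Rightarrow> bool" where
  "fourier_eig s \<tau> f \<longleftrightarrow> (\<forall>a\<in>V. fourier f a = s * of_nat D * f a)"

definition const_on :: "('v \<Rightarrow> 'v set) \<Rightarrow> 'v \<Rightarrow> ('v \<Rightarrow> complex) \<Rightarrow> bool" where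
  "const_on R \<tau> f \<longleftrightarrow> (\<forall>a\<in>R \<tau>. \<forall>b\<in>R \<tau>. f a = f b)"

definition zero_sum :: "'v \<Rightarrow> ('v \<Rightarrow> complex) \<Rightarrow> bool" where
  "zero_sum \<tau> f \<longleftrightarrow> sum f V = 0"

definition natural :: "('v \<Rightarrow> 'v set) \<Rightarrow> bool" where
  "natural R \<longleftrightarrow> (\<forall>\<tau>\<in>V. R \<tau> \<subseteq> V) \<and>
    (\<forall>h. \<forall>\<tau>\<in>V. \<forall>a\<in>V. form_aut h \<longrightarrow> (h a \<in> R (h \<tau>) \<longleftrightarrow> a \<in> R \<tau>))"

lemma natural_sets: "natural comm_set" "natural anti_set" "natural (\<lambda>\<tau>. {\<zero>})"
    "natural (\<lambda>\<tau>. {\<tau>})"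
  unfolding natural_def comm_set_def anti_set_def using form_autD by auto

lemma aut_ball:
  "form_aut h \<Longrightarrow> (\<And>a. a \<in> V \<Longrightarrow> P (h a)) \<Longrightarrow> \<forall>a\<in>V. P a"
  by (metis bij_betw_imp_surj_on form_autD(1) imageE)

lemma aut_sum: "form_aut h \<Longrightarrow> sum f V = (\<Sum>a\<in>V. f (h a))"
  by (rule sum.reindex_bij_betw[OF form_autD(1), symmetric])

lemma admissible_orbit_type: "admissible (orbit_type z)"
  unfolding admissible_def orbit_type_def
proof (intro conjI ballI allI impI)
  fix h \<tau> k and f f' :: "'v \<Rightarrow> complex"
  assume h: "form_aut h" "\<tau> \<in> V" "(\<exists>a\<in>V. f a \<noteq> 0) \<longrightarrow> (\<tau> = \<zero>) = z" "\<forall>a\<in>V. f' (h a) = k * f a"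
    and ex: "\<exists>a\<in>V. f' a \<noteq> 0"
  have "\<exists>a\<in>V. f a \<noteq> 0"
    using aut_ball[OF h(1), of "\<lambda>a. f' a = 0"] h(4) ex by force
  then show "(h \<tau> = \<zero>) = z" using h form_autD(6)[OF h(1)] by simp
next
  fix \<tau> and f g :: "'v \<Rightarrow> complex"
  assume "(\<exists>a\<in>V. f a \<noteq> 0) \<longrightarrow> (\<tau> = \<zero>) = z" "(\<exists>a\<in>V. g a \<noteq> 0) \<longrightarrow> (\<tau> = \<zero>) = z"
    "\<exists>a\<in>V. f a + g a \<noteq> (0::complex)"
  then show "(\<tau> = \<zero>) = z" by (metis add_0)
qed auto

lemma admissible_supp_in: "natural R \<Longrightarrow> admissible (supp_in R)"
  unfolding admissible_def supp_in_def
proof (intro conjI allI ballI impI)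
  fix h \<tau> k a and f f' :: "'v \<Rightarrow> complex"
  assume *: "natural R" "form_aut h" "\<tau> \<in> V" "\<forall>a\<in>V. f a \<noteq> 0 \<longrightarrow> a \<in> R \<tau>"
    "\<forall>a\<in>V. f' (h a) = k * f a" "a \<in> V" "f' a \<noteq> 0"
  have "\<forall>a\<in>V. f' a \<noteq> 0 \<longrightarrow> a \<in> R (h \<tau>)"
  proof (rule aut_ball[OF *(2)], rule impI)
    fix a assume "a \<in> V" "f' (h a) \<noteq> 0"
    then have "f a \<noteq> 0" using *(5) by auto
    then have "a \<in> R \<tau>" using *(4) \<open>a \<in> V\<close> by blast
    then show "h a \<in> R (h \<tau>)" using * \<open>a \<in> V\<close> unfolding natural_def by blast
  qed
  then show "a \<in> R (h \<tau>)" using * by blast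
next
  fix \<tau> a and f g :: "'v \<Rightarrow> complex"
  assume "\<forall>a\<in>V. f a \<noteq> 0 \<longrightarrow> a \<in> R \<tau>" "\<forall>a\<in>V. g a \<noteq> 0 \<longrightarrow> a \<in> R \<tau>" "a \<in> V" "f a + g a \<noteq> 0"
  then show "a \<in> R \<tau>" by (metis add.right_neutral)
qed simp

lemma admissible_periodic: "admissible (periodic \<eta>)"
  unfolding admissible_def periodic_def
proof (intro conjI ballI allI impI)
  fix h \<tau> k a and f f' :: "'v \<Rightarrow> complex"
  assume *: "form_aut h" "\<tau> \<in> V" "\<forall>a\<in>V. f (a \<oplus> \<tau>) = \<eta> * f a"
    "\<forall>a\<in>V. f' (h a) = k * f a" "a \<in> V"
  have "\<forall>a\<in>V. f' (a \<oplus> h \<tau>) = \<eta> * f' a"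
  proof (rule aut_ball[OF *(1)])
    fix a assume a: "a \<in> V"
    have "f' (h a \<oplus> h \<tau>) = f' (h (a \<oplus> \<tau>))" using * a by (simp add: form_autD(3))
    then show "f' (h a \<oplus> h \<tau>) = \<eta> * f' (h a)" using * a by (simp add: mult_ac)
  qed
  then show "f' (a \<oplus> h \<tau>) = \<eta> * f' a" using * by blast
qed (auto simp: algebra_simps)

lemma admissible_fourier_eig: "admissible (fourier_eig s)"
  unfolding admissible_def fourier_eig_def
proof (intro conjI ballI allI impI)
  fix h \<tau> k a and f f' :: "'v \<Rightarrow> complex"
  assume *: "form_aut h" "\<tau> \<in> V" "\<forall>a\<in>V. fourier f a = s * of_nat D * f a"
    "\<forall>a\<in>V. f' (h a) = k * f a" "a \<in> V"
  have "\<forall>a\<in>V. fourier f' a = s * of_nat D * f' a"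
    using * by (intro aut_ball[OF *(1)]) (simp add: fourier_aut[OF *(1,4)])
  then show "fourier f' a = s * of_nat D * f' a" using * by blast
qed (auto simp: fourier_add algebra_simps, simp add: fourier_def)

lemma admissible_const_on: "natural R \<Longrightarrow> admissible (const_on R)"
  unfolding admissible_def const_on_def
proof (intro conjI ballI allI impI)
  fix h \<tau> k a b and f f' :: "'v \<Rightarrow> complex"
  assume *: "natural R" "form_aut h" "\<tau> \<in> V" "\<forall>a\<in>R \<tau>. \<forall>b\<in>R \<tau>. f a = f b"
    "\<forall>a\<in>V. f' (h a) = k * f a" "a \<in> R (h \<tau>)" "b \<in> R (h \<tau>)"
  have R: "a \<in> V" "b \<in> V" using * form_autD(2)[OF *(2)] unfolding natural_def by blast+
  then obtain a' b' where ab: "a' \<in> V" "b' \<in> V" "a = h a'" "b = h b'"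
    using form_autD(1)[OF *(2)] unfolding bij_betw_def by blast
  then have "a' \<in> R \<tau>" "b' \<in> R \<tau>" using * unfolding natural_def by blast+
  then have "f a' = f b'" using * by blast
  then show "f' a = f' b" using ab * by simp
next
  fix \<tau> a b and f g :: "'v \<Rightarrow> complex"
  assume "\<forall>a\<in>R \<tau>. \<forall>b\<in>R \<tau>. f a = f b" "\<forall>a\<in>R \<tau>. \<forall>b\<in>R \<tau>. g a = g b"
    "a \<in> R \<tau>" "b \<in> R \<tau>"
  then show "f a + g a = f b + g b" by metis
qed simp

lemma admissible_zero_sum: "admissible zero_sum"
  unfolding admissible_def zero_sum_def
proof (intro conjI ballI allI impI)
  fix h \<tau> k and f f' :: "'v \<Rightarrow> complex"
  assume "form_aut h" "sum f V = 0" "\<forall>a\<in>V. f' (h a) = k * f a"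
  then show "sum f' V = 0" by (simp add: aut_sum[of h f'] flip: sum_distrib_left)
qed (simp_all add: sum.distrib)

lemmas admissible_intros = admissible_conj admissible_orbit_type admissible_periodic
  admissible_fourier_eig admissible_zero_sum admissible_supp_in admissible_const_on natural_sets

section \<open>Averaging over stabilizers and reproducing kernels\<close>

definition transv_closed :: "'v \<Rightarrow> (('v \<Rightarrow> complex) \<Rightarrow> bool) \<Rightarrow> bool" where
  "transv_closed \<tau> Q \<longleftrightarrow> (\<forall>f g. Q f \<longrightarrow> Q g \<longrightarrow> Q (\<lambda>x. f x + g x)) \<and> (\<forall>k f. Q f \<longrightarrow> Q (\<lambda>x. k * f x)) \<and>
    (\<forall>v\<in>V. \<forall>f. eps v \<tau> = 1 \<longrightarrow> Q f \<longrightarrow> Q (\<lambda>x. f (transv v x))) \<and>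
    (\<forall>f g. Q f \<longrightarrow> (\<forall>a\<in>V. f a = g a) \<longrightarrow> Q g)"

lemma transv_closedD:
  assumes "transv_closed \<tau> Q"
  shows "Q f \<Longrightarrow> Q g \<Longrightarrow> Q (\<lambda>x. f x + g x)" "Q f \<Longrightarrow> Q (\<lambda>x. k * f x)"
    "v \<in> V \<Longrightarrow> eps v \<tau> = 1 \<Longrightarrow> Q f \<Longrightarrow> Q (\<lambda>x. f (transv v x))"
    "Q f \<Longrightarrow> (\<And>a. a \<in> V \<Longrightarrow> f a = g a) \<Longrightarrow> Q g"
  using assms unfolding transv_closed_def by blast+

lemma transv_closed_sum:
  assumes "transv_closed \<tau> Q" "Q f" "finite I" "\<And>i. i \<in> I \<Longrightarrow> Q (F i)"
  shows "Q (\<lambda>x. \<Sum>i\<in>I. c i * F i x)"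
  using assms(3,4)
proof (induction I rule: finite_induct)
  case empty
  \<comment> \<open>\<open>transv_closed\<close> also holds for the empty predicate, so the zero
    function has to come from the given \<open>Q f\<close>.\<close>
  then show ?case using transv_closedD(2)[OF assms(1,2), of 0] by simp
next
  case (insert i I)
  then have "Q (\<lambda>x. c i * F i x)" "Q (\<lambda>x. \<Sum>i\<in>I. c i * F i x)"
    using transv_closedD(2)[OF assms(1)] by blast+
  from transv_closedD(1)[OF assms(1) this] show ?case using insert.hyps by simp
qed

lemma transv_closed_admissible:
  assumes "admissible \<Phi>" "\<tau> \<in> V"
  shows "transv_closed \<tau> (\<Phi> \<tau>)"
  unfolding transv_closed_def
proof (intro conjI allI ballI impI)
  fix v f assume v: "v \<in> V" "eps v \<tau> = 1" "\<Phi> \<tau> f"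
  have "\<Phi> (transv v \<tau>) (\<lambda>x. f (transv v x))"
    by (rule admissibleD(5)[OF assms form_aut_transv v(3), of v _ 1]) (use v in simp_all)
  with v show "\<Phi> \<tau> (\<lambda>x. f (transv v x))" by (simp add: transv_fix)
next
  fix f g assume *: "\<Phi> \<tau> f" "\<forall>a\<in>V. f a = g a"
  show "\<Phi> \<tau> g" by (rule admissibleD(4)[OF assms *(1)]) (simp add: *(2))
next
  show "\<Phi> \<tau> (\<lambda>x. f x + g x)" if "\<Phi> \<tau> f" "\<Phi> \<tau> g" for f g
    by (rule admissibleD(2)[OF assms that])
  show "\<Phi> \<tau> (\<lambda>x. k * f x)" if "\<Phi> \<tau> f" for f k by (rule admissibleD(3)[OF assms that])
qed

lemma transv_closed_conj:
  assumes "transv_closed \<tau> P" "transv_closed \<tau> Q"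
  shows "transv_closed \<tau> (\<lambda>f. P f \<and> Q f)"
  unfolding transv_closed_def
proof (intro conjI allI ballI impI; (elim conjE)?)
  fix f g assume "P f" "Q f" "\<forall>a\<in>V. f a = g a"
  then show "P g" "Q g"
    using transv_closedD(4)[OF assms(1), of f g] transv_closedD(4)[OF assms(2), of f g] by simp_all
qed (simp_all add: transv_closedD[OF assms(1)] transv_closedD[OF assms(2)])

text \<open>The orbit of \<open>f\<close> under the group generated by the transvections in
  \<open>K\<close>, reached without forming the group. Cutting the functions to \<open>V\<close>
  places the orbit in a finite function space.\<close>

inductive_set transv_translates :: "'v set \<Rightarrow> ('v \<Rightarrow> complex) \<Rightarrow> ('v \<Rightarrow> complex) set"
  for K f where
  base: "restrict f V \<in> transv_translates K f"
| step: "h \<in> transv_translates K f \<Longrightarrow> v \<in> K \<Longrightarrow> (\<lambda>x\<in>V. h (transv v x)) \<in> transv_translates K f"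

text \<open>The sum over the finite orbit of \<open>f\<close> is invariant. All transvections
  involved fix \<open>a\<close>, so every summand has the value \<open>f a\<close> there and nothing
  cancels.\<close>

lemma transv_average:
  assumes Q: "transv_closed \<tau> Q" "Q f" and V: "a \<in> V" "\<tau> \<in> V" and fa: "f a \<noteq> 0"
  shows "\<exists>f'. Q f' \<and> f' a \<noteq> 0 \<and>
    (\<forall>v\<in>V. eps v a = 1 \<longrightarrow> eps v \<tau> = 1 \<longrightarrow> (\<forall>x\<in>V. f' (transv v x) = f' x))"
proof -
  define K where "K = {v \<in> V. eps v a = 1 \<and> eps v \<tau> = 1}"
  define S where "S = transv_translates K f"
  have KV: "K \<subseteq> V" by (auto simp: K_def)
  have S: "h \<in> V \<rightarrow>\<^sub>E f ` V \<and> Q h \<and> h a = f a" if "h \<in> S" for h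
    using that unfolding S_def
  proof (induction rule: transv_translates.induct)
    case base
    have "Q (restrict f V)" by (rule transv_closedD(4)[OF Q]) simp
    then show ?case using V by (auto simp: restrict_def)
  next
    case (step h v)
    then have "v \<in> V" "eps v \<tau> = 1" "eps v a = 1" by (auto simp: K_def)
    moreover have "Q (\<lambda>x\<in>V. h (transv v x))"
      by (rule transv_closedD(4)[OF Q(1) transv_closedD(3)[OF Q(1), of v h]]) (use calculation step in auto)
    ultimately show ?case
      using step V transv_V[of v] by (auto simp: transv_fix PiE_iff restrict_def extensional_def)
  qed
  have fin: "finite S"
    using S finite_PiE[OF finite_V, of "\<lambda>_. f ` V"] finite_V by (meson finite_imageI finite_subset subsetI)
  have ne: "S \<noteq> {}" unfolding S_def using transv_translates.base by blast
  define f' where "f' = (\<lambda>x. \<Sum>h\<in>S. h x)"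
  have "Q f'" using transv_closed_sum[OF Q fin, of "\<lambda>h. h" "\<lambda>_. 1"] S by (simp add: f'_def)
  moreover have "f' a = (\<Sum>h\<in>S. f a)" unfolding f'_def using S by (intro sum.cong) auto
  then have "f' a \<noteq> 0" using fin ne fa by simp
  moreover have "f' (transv v x) = f' x" if v: "v \<in> V" "eps v a = 1" "eps v \<tau> = 1" and x: "x \<in> V" for v x
  proof -
    \<comment> \<open>Translation by \<open>v\<close> is an involution of the orbit, hence permutes
      the summands.\<close>
    define m where "m h = (\<lambda>x\<in>V. h (transv v x))" for h :: "'v \<Rightarrow> complex"
    have mS: "m h \<in> S" if "h \<in> S" for h
      using that v transv_translates.step[of h K f v] by (simp add: S_def K_def m_def)
    have mm: "m (m h) = h" if "h \<in> S" for h
    proof (rule ext)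
      show "m (m h) x = h x" for x
        using S[OF that] v by (cases "x \<in> V") (auto simp: m_def PiE_iff extensional_def)
    qed
    have "f' (transv v x) = (\<Sum>h\<in>S. m h x)" using x by (simp add: f'_def m_def)
    also have "\<dots> = (\<Sum>h\<in>S. h x)"
      by (rule sum.reindex_bij_witness[of _ m m]) (auto simp: mS mm)
    finally show ?thesis by (simp add: f'_def)
  qed
  ultimately show ?thesis by blast
qed

text \<open>Irreducibility of each single weight space under the transvections fixing its weight;
  \<open>irrep_Wsp\<close> passes from one weight to the whole space.\<close>

definition cyclic :: "('v \<Rightarrow> ('v \<Rightarrow> complex) \<Rightarrow> bool) \<Rightarrow> bool" where
  "cyclic \<Phi> \<longleftrightarrow> (\<forall>\<tau>\<in>V. \<forall>f. \<Phi> \<tau> f \<longrightarrow> (\<exists>a\<in>V. f a \<noteq> 0) \<longrightarrow>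
     (\<forall>Q. transv_closed \<tau> Q \<longrightarrow> Q f \<longrightarrow> (\<forall>g. \<Phi> \<tau> g \<longrightarrow> Q g)))"

lemma cyclic_one_dim:
  assumes "\<And>\<tau> f g a. \<tau> \<in> V \<Longrightarrow> \<Phi> \<tau> f \<Longrightarrow> \<Phi> \<tau> g \<Longrightarrow> a \<in> V \<Longrightarrow> f a \<noteq> 0 \<Longrightarrow> \<exists>k. \<forall>x\<in>V. g x = k * f x"
  shows "cyclic \<Phi>"
  unfolding cyclic_def
proof (intro ballI allI impI)
  fix \<tau> f Q g assume *: "\<tau> \<in> V" "\<Phi> \<tau> f" "\<exists>a\<in>V. f a \<noteq> 0" "transv_closed \<tau> Q" "Q f" "\<Phi> \<tau> g"
  then obtain k where "\<forall>x\<in>V. g x = k * f x" using assms by blast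
  then show "Q g"
    using transv_closedD(4)[OF *(4) transv_closedD(2)[OF *(4,5)], of k g] by simp
qed

text \<open>The vectors invariant under the stabilizer of \<open>a\<close> are multiples of one kernel \<open>k \<tau> a\<close>,
  and the kernels reproduce every vector of the space up to a nonzero factor.\<close>

lemma cyclic_kernel:
  assumes adm: "admissible \<Phi>"
    and supp: "\<And>\<tau> f. \<Phi> \<tau> f \<Longrightarrow> supp_in R \<tau> f"
    and R: "R = comm_set \<or> R = anti_set"
    and one: "\<And>\<tau> a f. \<tau> \<in> V \<Longrightarrow> a \<in> R \<tau> \<Longrightarrow> \<Phi> \<tau> f \<Longrightarrow> f a \<noteq> 0 \<Longrightarrow>
      (\<And>c c'. c \<in> V \<Longrightarrow> c' \<in> V \<Longrightarrow> eps c a = eps c' a \<Longrightarrow> eps c \<tau> = eps c' \<tau> \<Longrightarrow>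
        c \<notin> {\<zero>, a, \<tau>, a \<oplus> \<tau>} \<Longrightarrow> c' \<notin> {\<zero>, a, \<tau>, a \<oplus> \<tau>} \<Longrightarrow> f c = f c') \<Longrightarrow>
      \<exists>A. \<forall>x\<in>V. f x = A * k \<tau> a x"
    and repr: "\<And>\<tau> g. \<tau> \<in> V \<Longrightarrow> \<Phi> \<tau> g \<Longrightarrow> \<exists>L. L \<noteq> 0 \<and> (\<forall>x\<in>V. (\<Sum>b\<in>V. g b * k \<tau> b x) = L * g x)"
  shows "cyclic \<Phi>"
  unfolding cyclic_def
proof (intro ballI allI impI)
  fix \<tau> f Q g
  assume \<tau>: "\<tau> \<in> V" and f: "\<Phi> \<tau> f" "\<exists>a\<in>V. f a \<noteq> 0" and Q0: "transv_closed \<tau> Q" "Q f" and g: "\<Phi> \<tau> g"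
  \<comment> \<open>Averaging has to stay inside \<open>\<Phi> \<tau>\<close>, where the uniqueness
    assumption \<open>one\<close> applies.\<close>
  define Q' where "Q' h \<longleftrightarrow> \<Phi> \<tau> h \<and> Q h" for h
  have Q': "transv_closed \<tau> Q'" "Q' f"
    unfolding Q'_def using transv_closed_conj[OF transv_closed_admissible[OF adm \<tau>] Q0(1)] f Q0 by auto
  have RD: "b \<in> V" "b \<noteq> \<zero>" "b \<noteq> \<tau>" if "b \<in> R \<tau>" for b
    using R that by (auto simp: comm_set_def anti_set_def)
  have RE: "eps b \<tau> = eps c \<tau>" if "b \<in> R \<tau>" "c \<in> R \<tau>" for b c
    using R that by (auto simp: comm_set_def anti_set_def)
  obtain a where a: "a \<in> V" "f a \<noteq> 0" "a \<in> R \<tau>" using f supp[OF f(1)] unfolding supp_in_def by blast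
  have kQ: "Q (k \<tau> b)" if b: "b \<in> R \<tau>" for b
  proof -
    \<comment> \<open>The stabilizer of \<tau> is transitive on \<open>R \<tau>\<close>.
      Transporting \<open>f\<close> from \<open>a\<close> to \<open>b\<close> provides a function
      that does not vanish at \<open>b\<close> and can be averaged there.\<close>
    obtain v w where vw: "v \<in> V" "w \<in> V" "eps v \<tau> = 1" "eps w \<tau> = 1" "transv v (transv w b) = a"
      using transv_orbit[of \<tau> "\<zero>" b a] \<tau> RD[OF b] RD[OF a(3)] RE[OF a(3) b] by auto
    then have "Q' (\<lambda>x. f (transv v (transv w x)))"
      using transv_closedD(3)[OF Q'(1)] Q' by auto
    then obtain f' where f': "Q' f'" "f' b \<noteq> 0"
      "\<forall>v\<in>V. eps v b = 1 \<longrightarrow> eps v \<tau> = 1 \<longrightarrow> (\<forall>x\<in>V. f' (transv v x) = f' x)"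
      using transv_average[OF Q'(1), of "\<lambda>x. f (transv v (transv w x))" b] RD[OF b] \<tau> vw a by auto
    have "\<exists>A. \<forall>x\<in>V. f' x = A * k \<tau> b x"
    proof (rule one[OF \<tau> b])
      fix c c' assume c: "c \<in> V" "c' \<in> V" "eps c b = eps c' b" "eps c \<tau> = eps c' \<tau>"
        "c \<notin> {\<zero>, b, \<tau>, b \<oplus> \<tau>}" "c' \<notin> {\<zero>, b, \<tau>, b \<oplus> \<tau>}"
      obtain v w where "v \<in> V" "w \<in> V" "eps v b = 1" "eps v \<tau> = 1" "eps w b = 1" "eps w \<tau> = 1"
          "transv v (transv w c) = c'"
        using transv_orbit[of b \<tau> c c'] c RD[OF b] \<tau> by auto
      then show "f' c = f' c'" using f'(3) c(1) by (metis transv_V)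
    qed (use f' in \<open>auto simp: Q'_def\<close>)
    then obtain A where A: "\<forall>x\<in>V. f' x = A * k \<tau> b x" by blast
    then have "A \<noteq> 0" using f'(2) RD[OF b] by auto
    moreover have "Q (\<lambda>x. 1 / A * f' x)"
      using f'(1) transv_closedD(2)[OF Q0(1)] by (simp only: Q'_def)
    ultimately show ?thesis using A by (elim transv_closedD(4)[OF Q0(1)]) auto
  qed
  obtain L where L: "L \<noteq> 0" "\<forall>x\<in>V. (\<Sum>b\<in>V. g b * k \<tau> b x) = L * g x" using repr[OF \<tau> g] by blast
  have RV: "R \<tau> \<subseteq> V" using RD by blast
  have "(\<Sum>b\<in>V. g b * k \<tau> b x) = (\<Sum>b\<in>R \<tau>. g b * k \<tau> b x)" for x
    using supp[OF g] RV by (intro sum.mono_neutral_right finite_V) (auto simp: supp_in_def)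
  then have *: "Q (\<lambda>x. \<Sum>b\<in>V. g b * k \<tau> b x)"
    using transv_closed_sum[OF Q0, of "R \<tau>" "k \<tau>" g] kQ finite_subset[OF RV finite_V] by simp
  show "Q g"
    by (rule transv_closedD(4)[OF Q0(1) transv_closedD(2)[OF Q0(1) *, of "1/L"]]) (use L in auto)
qed


section \<open>Cyclic families\<close>

text \<open>For \<open>\<eta> * \<eta> = 1\<close>, twice the projection of the point mass at
  \<open>a\<close> to the functions with \<open>f (x \<oplus> \<tau>) = \<eta> * f x\<close>. For
  \<open>\<tau> = \<zero>\<close> the two points merge and the value at \<open>a\<close> is
  \<open>1 + \<eta>\<close>.\<close>

definition pair :: "complex \<Rightarrow> 'v \<Rightarrow> 'v \<Rightarrow> 'v \<Rightarrow> complex" where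
  "pair \<eta> \<tau> a x = of_bool (x = a) + \<eta> * of_bool (x = a \<oplus> \<tau>)"

text \<open>The Fourier transform of \<open>pair\<close> in closed form.\<close>

definition pair_dual :: "complex \<Rightarrow> 'v \<Rightarrow> 'v \<Rightarrow> 'v \<Rightarrow> complex" where
  "pair_dual \<eta> \<tau> a x = eps a x * (1 + \<eta> * eps \<tau> x)"

text \<open>For \<open>s * s = 1\<close>, twice the spectral projection of
  \<open>pair \<eta> \<tau> a\<close> to the eigenvalue \<open>s * D\<close> of the
  transform.\<close>

definition pair_proj :: "complex \<Rightarrow> complex \<Rightarrow> 'v \<Rightarrow> 'v \<Rightarrow> 'v \<Rightarrow> complex" where
  "pair_proj \<eta> s \<tau> a x = pair \<eta> \<tau> a x + s / of_nat D * pair_dual \<eta> \<tau> a x"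

lemma sum_of_bool_mult: "a \<in> V \<Longrightarrow> (\<Sum>b\<in>V. f b * of_bool (b = a)) = (f a :: complex)"
proof -
  assume "a \<in> V"
  moreover have "(\<Sum>b\<in>V. f b * of_bool (b = a)) = (\<Sum>b\<in>V. if b = a then f b else 0)"
    by (intro sum.cong) auto
  ultimately show ?thesis by (simp add: finite_V)
qed

lemma fourier_pair: "a \<in> V \<Longrightarrow> \<tau> \<in> V \<Longrightarrow> fourier (pair \<eta> \<tau> a) = pair_dual \<eta> \<tau> a"
  by (rule ext) (simp add: fourier_def pair_def pair_dual_def distrib_left sum.distrib sum_of_bool_mult
    mult.left_commute[of _ \<eta>] flip: sum_distrib_left, simp add: eps_add eps_sym)

lemma fourier_pair_dual:
  "a \<in> V \<Longrightarrow> \<tau> \<in> V \<Longrightarrow> x \<in> V \<Longrightarrow> fourier (pair_dual \<eta> \<tau> a) x = of_nat D ^ 2 * pair \<eta> \<tau> a x"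
  by (simp add: fourier_fourier flip: fourier_pair)

lemma fourier_pair_proj:
  assumes "a \<in> V" "\<tau> \<in> V" "x \<in> V" "s * s = 1"
  shows "fourier (pair_proj \<eta> s \<tau> a) x = s * of_nat D * pair_proj \<eta> s \<tau> a x"
proof -
  define k where "k = s / of_nat D"
  have k: "s * of_nat D * k = 1" "k * of_nat D ^ 2 = s * of_nat D"
    using assms(4) by (simp_all add: k_def power2_eq_square)
  have "fourier (pair_proj \<eta> s \<tau> a) x = pair_dual \<eta> \<tau> a x + k * (of_nat D ^ 2 * pair \<eta> \<tau> a x)"
    unfolding pair_proj_def[abs_def] k_def[symmetric] using assms
    by (simp add: fourier_add fourier_scale fourier_pair fourier_pair_dual)
  with k show ?thesis unfolding pair_proj_def k_def[symmetric] by algebra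
qed

text \<open>An eigenvector equals half of \<open>f + (s / D) * fourier f\<close>. The transform
  exchanges \<open>pair\<close> and \<open>pair_dual\<close> up to \<open>D^2\<close>, so the four
  terms collect into two spectral projections.\<close>

lemma eig_expand:
  assumes V: "a \<in> V" "\<tau> \<in> V" "x \<in> V" and s: "s * s = 1" and eig: "fourier_eig s \<tau> f"
    and f: "\<And>x. x \<in> V \<Longrightarrow> f x = \<alpha> * pair \<eta> \<tau> a x + \<gamma> * pair_dual \<eta> \<tau> a x
      + \<beta> * pair_dual \<eta> \<tau> \<zero> x + \<delta> * pair \<eta> \<tau> \<zero> x"
  shows "f x = (\<alpha> + \<gamma> * s * of_nat D) / 2 * pair_proj \<eta> s \<tau> a x
    + (\<delta> + \<beta> * s * of_nat D) / 2 * pair_proj \<eta> s \<tau> \<zero> x"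
proof -
  define d k where "d = (of_nat D :: complex)" and "k = s / d"
  have k: "s * d * k = 1" "k * d = s" using s by (simp_all add: k_def d_def)
  have F: "s * d * f x = fourier f x" using eig V by (simp add: fourier_eig_def d_def)
  have "fourier f x = \<alpha> * pair_dual \<eta> \<tau> a x + \<gamma> * (d ^ 2 * pair \<eta> \<tau> a x)
      + \<beta> * (d ^ 2 * pair \<eta> \<tau> \<zero> x) + \<delta> * pair_dual \<eta> \<tau> \<zero> x"
    using V by (subst fourier_cong[OF f])
      (simp_all add: fourier_add fourier_scale fourier_pair fourier_pair_dual d_def)
  with F k s f[OF V(3)] have "2 * f x = (\<alpha> + \<gamma> * s * d) * pair_proj \<eta> s \<tau> a x
      + (\<delta> + \<beta> * s * d) * pair_proj \<eta> s \<tau> \<zero> x"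
    unfolding pair_proj_def d_def[symmetric] k_def[symmetric] by algebra
  then have "f x = ((\<alpha> + \<gamma> * s * d) * pair_proj \<eta> s \<tau> a x
      + (\<delta> + \<beta> * s * d) * pair_proj \<eta> s \<tau> \<zero> x) / 2" by (simp add: mult.commute)
  moreover have "(X * p + Y * q) / 2 = X / 2 * p + Y / 2 * q" for X Y p q :: complex
    by (simp add: field_simps)
  ultimately show ?thesis by (simp only: d_def)
qed

lemma sum_pair:
  assumes "periodic \<eta> \<tau> g" "\<eta> * \<eta> = 1" "\<tau> \<in> V" "x \<in> V"
  shows "(\<Sum>b\<in>V. g b * pair \<eta> \<tau> b x) = 2 * g x"
proof -
  have "(\<Sum>b\<in>V. g b * pair \<eta> \<tau> b x) =
      (\<Sum>b\<in>V. g b * of_bool (b = x)) + \<eta> * (\<Sum>b\<in>V. g b * of_bool (b = x \<oplus> \<tau>))"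
    unfolding pair_def sum_distrib_left sum.distrib[symmetric]
    by (intro sum.cong) (auto simp: algebra_simps of_bool_def add_assoc)
  also have "\<dots> = g x + \<eta> * \<eta> * g x"
    using assms by (simp add: sum_of_bool_mult periodic_def)
  finally show ?thesis using assms by simp
qed

text \<open>The pairs contribute \<open>2 * g x\<close>, the duals the rest by the eigenvalue
  equation. On \<open>comm_set\<close> with \<open>\<eta> = 1\<close> and on \<open>anti_set\<close>
  with \<open>\<eta> = -1\<close> the factor is 4.\<close>

lemma sum_pair_proj:
  assumes "periodic \<eta> \<tau> g" "\<eta> * \<eta> = 1" "\<tau> \<in> V" "x \<in> V" "fourier_eig s \<tau> g" "s * s = 1"
  shows "(\<Sum>b\<in>V. g b * pair_proj \<eta> s \<tau> b x) = (3 + \<eta> * eps \<tau> x) * g x"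
proof -
  have "(\<Sum>b\<in>V. g b * pair_proj \<eta> s \<tau> b x) =
      (\<Sum>b\<in>V. g b * pair \<eta> \<tau> b x) + s / of_nat D * (1 + \<eta> * eps \<tau> x) * fourier g x"
    unfolding pair_proj_def pair_dual_def fourier_def sum_distrib_left sum.distrib[symmetric]
    by (intro sum.cong refl) (simp add: algebra_simps eps_sym[of x])
  also have "\<dots> = 2 * g x + (s * s) * (1 + \<eta> * eps \<tau> x) * g x"
    using sum_pair[OF assms(1-4)] assms(4,5) by (simp add: fourier_eig_def)
  finally show ?thesis using assms by (simp add: algebra_simps)
qed

definition const_part :: "bool \<Rightarrow> ('v \<Rightarrow> 'v set) \<Rightarrow> 'v \<Rightarrow> ('v \<Rightarrow> complex) \<Rightarrow> bool" where
  "const_part z R \<tau> f \<longleftrightarrow> orbit_type z \<tau> f \<and> supp_in R \<tau> f \<and> const_on R \<tau> f"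

text \<open>The functions of \<open>V_1\<close> and \<open>V_2\<close> for \<open>z = True\<close>,
  of \<open>V_br1\<close> and \<open>V_br2\<close> for \<open>z = False\<close>; in both cases
  \<open>s = 1\<close> belongs to the index 1.\<close>

definition comm_eig :: "bool \<Rightarrow> complex \<Rightarrow> 'v \<Rightarrow> ('v \<Rightarrow> complex) \<Rightarrow> bool" where
  "comm_eig z s \<tau> f \<longleftrightarrow> orbit_type z \<tau> f \<and> supp_in comm_set \<tau> f \<and> periodic 1 \<tau> f \<and> fourier_eig s \<tau> f"

text \<open>The functions of \<open>V_A_br\<close>: on commuting points, antisymmetry of the tensor
  is skew-periodicity.\<close>

definition comm_skew :: "'v \<Rightarrow> ('v \<Rightarrow> complex) \<Rightarrow> bool" where
  "comm_skew \<tau> f \<longleftrightarrow> supp_in comm_set \<tau> f \<and> periodic (-1) \<tau> f"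

text \<open>The functions of \<open>V_adj_perp\<close>: being orthogonal to the constants of
  \<open>V_adj_cu\<close> means having sum zero.\<close>

definition anti_mean_zero :: "'v \<Rightarrow> ('v \<Rightarrow> complex) \<Rightarrow> bool" where
  "anti_mean_zero \<tau> f \<longleftrightarrow> supp_in anti_set \<tau> f \<and> periodic 1 \<tau> f \<and> zero_sum \<tau> f"

text \<open>The functions of \<open>V_cu1\<close> for \<open>s = 1\<close> and of
  \<open>V_cu2\<close> for \<open>s = -1\<close>.\<close>

definition anti_eig :: "complex \<Rightarrow> 'v \<Rightarrow> ('v \<Rightarrow> complex) \<Rightarrow> bool" where
  "anti_eig s \<tau> f \<longleftrightarrow> supp_in anti_set \<tau> f \<and> periodic (-1) \<tau> f \<and> fourier_eig s \<tau> f"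

lemma admissible_parts:
  "natural R \<Longrightarrow> admissible (const_part z R)" "admissible (comm_eig z s)" "admissible comm_skew"
  "admissible anti_mean_zero" "admissible (anti_eig s)"
  unfolding const_part_def[abs_def] comm_eig_def[abs_def] comm_skew_def[abs_def]
    anti_mean_zero_def[abs_def] anti_eig_def[abs_def]
  by (intro admissible_intros; assumption)+

lemma cyclic_const_part: "cyclic (const_part z R)"
proof (rule cyclic_one_dim)
  fix \<tau> f g a
  assume f: "const_part z R \<tau> f" and g: "const_part z R \<tau> g" and a: "a \<in> V" "f a \<noteq> 0"
  have aR: "a \<in> R \<tau>" using f a by (auto simp: const_part_def supp_in_def)
  have "g x = g a / f a * f x" if x: "x \<in> V" for x
  proof (cases "x \<in> R \<tau>")
    case True
    then have "f x = f a" "g x = g a" using f g aR unfolding const_part_def const_on_def by blast+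
    then show ?thesis using a by simp
  next
    case False
    then have "f x = 0" "g x = 0" using f g x by (auto simp: const_part_def supp_in_def)
    then show ?thesis by simp
  qed
  then show "\<exists>k. \<forall>x\<in>V. g x = k * f x" by blast
qed

lemma comm_setD: "a \<in> comm_set \<tau> \<Longrightarrow> a \<in> V \<and> eps a \<tau> = 1 \<and> eps \<tau> a = 1 \<and> a \<noteq> \<zero> \<and> a \<noteq> \<tau>"
  by (auto simp: comm_set_def eps_sym1)

lemma anti_setD: "a \<in> anti_set \<tau> \<Longrightarrow> a \<in> V \<and> eps a \<tau> = -1 \<and> eps \<tau> a = -1 \<and> a \<noteq> \<zero> \<and> a \<noteq> \<tau> \<and> \<tau> \<noteq> \<zero>"
  by (auto simp: anti_set_def eps_sym[of \<tau>])

lemma supp_inD: "supp_in R \<tau> f \<Longrightarrow> x \<in> V \<Longrightarrow> x \<notin> R \<tau> \<Longrightarrow> f x = 0"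
  by (auto simp: supp_in_def)

lemma ex_common_value:
  assumes "\<And>c c'. P c \<Longrightarrow> P c' \<Longrightarrow> f c = f c'"
  shows "\<exists>y. \<forall>c. P c \<longrightarrow> f c = (y :: complex)"
  using assms by blast

text \<open>Outside the span of \<open>a\<close> and \<tau>, an invariant function has equal values
  at \<open>x\<close> and \<open>x \<oplus> \<tau>\<close>, while skew-periodicity makes them
  opposite. Only a multiple of \<open>pair (-1)\<close> survives.\<close>

lemma cyclic_comm_skew: "cyclic comm_skew"
proof (rule cyclic_kernel[where R = comm_set and k = "pair (-1)"])
  fix \<tau> a f
  assume \<tau>: "\<tau> \<in> V" and a: "a \<in> comm_set \<tau>" and f: "comm_skew \<tau> f" and
    inv: "\<And>c c'. c \<in> V \<Longrightarrow> c' \<in> V \<Longrightarrow> eps c a = eps c' a \<Longrightarrow> eps c \<tau> = eps c' \<tau> \<Longrightarrow>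
        c \<notin> {\<zero>, a, \<tau>, a \<oplus> \<tau>} \<Longrightarrow> c' \<notin> {\<zero>, a, \<tau>, a \<oplus> \<tau>} \<Longrightarrow> f c = f c'"
  have per: "f (c \<oplus> \<tau>) = - f c" if "c \<in> V" for c using f that by (simp add: comm_skew_def periodic_def)
  have "f x = f a * pair (-1) \<tau> a x" if x: "x \<in> V" for x
  proof (cases "x \<in> {\<zero>, a, \<tau>, a \<oplus> \<tau>} \<or> x \<notin> comm_set \<tau>")
    case True
    have 0: "f \<zero> = 0" "f \<tau> = 0" using f \<tau> by (auto simp: comm_skew_def supp_in_def comm_set_def)
    \<comment> \<open>Skew-periodicity under translation by zero would force
      \<open>f a = 0\<close>.\<close>
    have \<tau>0: "\<tau> \<noteq> \<zero>" if "f a \<noteq> 0" using per[of a] comm_setD[OF a] that by auto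
    have "x = \<zero> \<or> x = a \<or> x = \<tau> \<or> x = a \<oplus> \<tau> \<or> x \<notin> comm_set \<tau>" using True by blast
    then show ?thesis
    proof (elim disjE)
      assume "x \<notin> comm_set \<tau>"
      moreover have "a \<oplus> \<tau> \<in> comm_set \<tau>"
        using comm_setD[OF a] \<tau> by (simp add: comm_set_def eps_add2 add_move)
      ultimately have "x \<noteq> a" "x \<noteq> a \<oplus> \<tau>" "f x = 0"
        using a f x by (auto simp: comm_skew_def supp_in_def)
      then show ?thesis by (simp add: pair_def)
    next
      assume "x = a"
      then show ?thesis using \<tau>0 by (cases "f a = 0") (simp_all add: pair_def)
    next
      assume "x = a \<oplus> \<tau>"
      then show ?thesis using \<tau>0 per[of a] comm_setD[OF a] by (cases "f a = 0") (simp_all add: pair_def)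
    next
      assume "x = \<zero>"
      then show ?thesis using 0 comm_setD[OF a] by (simp add: pair_def) metis
    next
      assume "x = \<tau>"
      then show ?thesis using 0 comm_setD[OF a] by (simp add: pair_def) metis
    qed
  next
    case False
    then have "f x = f (x \<oplus> \<tau>)"
      using \<tau> x comm_setD[OF a] comm_setD[of x \<tau>] by (intro inv) (auto simp: eps_add2 add_move)
    then have "f x = 0" using per[OF x] by simp
    then show ?thesis using False by (simp add: pair_def)
  qed
  then show "\<exists>A. \<forall>x\<in>V. f x = A * pair (-1) \<tau> a x" by blast
next
  fix \<tau> g assume "\<tau> \<in> V" "comm_skew \<tau> g"
  then show "\<exists>L. L \<noteq> 0 \<and> (\<forall>x\<in>V. (\<Sum>b\<in>V. g b * pair (-1) \<tau> b x) = L * g x)"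
    by (intro exI[of _ 2]) (auto simp: sum_pair comm_skew_def)
qed (auto simp: admissible_parts comm_skew_def)

lemma sum_mult_diff: "(\<Sum>b\<in>A. g b * (h b - c)) = (\<Sum>b\<in>A. g b * h b) - sum g A * (c :: complex)"
  by (simp add: right_diff_distrib sum_subtractf sum_distrib_right)

text \<open>An invariant function is constant on \<open>anti_set \<tau>\<close> away from
  \<open>a\<close> and \<open>a \<oplus> \<tau>\<close>, and the vanishing sum determines this
  constant. The kernel is \<open>pair 1\<close> minus its mean over \<open>anti_set \<tau>\<close>,
  the 2 being the total mass of a pair.\<close>

lemma cyclic_anti_mean_zero: "cyclic anti_mean_zero"
proof (rule cyclic_kernel[where R = anti_set and
      k = "\<lambda>\<tau> a x. pair 1 \<tau> a x - 2 / of_nat (card (anti_set \<tau>)) * of_bool (x \<in> anti_set \<tau>)"])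
  fix \<tau> a f
  assume \<tau>: "\<tau> \<in> V" and a: "a \<in> anti_set \<tau>" and f: "anti_mean_zero \<tau> f" and
    inv: "\<And>c c'. c \<in> V \<Longrightarrow> c' \<in> V \<Longrightarrow> eps c a = eps c' a \<Longrightarrow> eps c \<tau> = eps c' \<tau> \<Longrightarrow>
        c \<notin> {\<zero>, a, \<tau>, a \<oplus> \<tau>} \<Longrightarrow> c' \<notin> {\<zero>, a, \<tau>, a \<oplus> \<tau>} \<Longrightarrow> f c = f c'"
  note aD = anti_setD[OF a]
  have per: "f (c \<oplus> \<tau>) = f c" if "c \<in> V" for c using f that by (simp add: anti_mean_zero_def periodic_def)
  have "\<exists>y. \<forall>c. c \<in> anti_set \<tau> \<and> eps c a = 1 \<and> c \<noteq> a \<longrightarrow> f c = y"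
  proof (rule ex_common_value)
    fix c c' assume "c \<in> anti_set \<tau> \<and> eps c a = 1 \<and> c \<noteq> a" "c' \<in> anti_set \<tau> \<and> eps c' a = 1 \<and> c' \<noteq> a"
    then show "f c = f c'"
      using aD anti_setD[of c \<tau>] anti_setD[of c' \<tau>] by (intro inv) (auto simp: eps_add2 eps_sym[of \<tau>])
  qed
  then obtain y where y0: "\<forall>c. c \<in> anti_set \<tau> \<and> eps c a = 1 \<and> c \<noteq> a \<longrightarrow> f c = y" by blast
  have y: "f c = y" if c: "c \<in> anti_set \<tau>" "c \<noteq> a" "c \<noteq> a \<oplus> \<tau>" for c
  proof (cases "eps c a = 1")
    case True then show ?thesis using y0 c by blast
  next
    case False
    \<comment> \<open>As \<tau> anticommutes with \<open>a\<close>, translation by \<tau> exchanges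
      the points of \<open>anti_set \<tau>\<close> commuting with \<open>a\<close> and those
      anticommuting with it.\<close>
    then have "eps (c \<oplus> \<tau>) a = 1" "c \<oplus> \<tau> \<in> anti_set \<tau>" "c \<oplus> \<tau> \<noteq> a"
      using aD anti_setD[OF c(1)] \<tau> c by (auto simp: eps_add2 anti_set_def add_move)
    then have "f (c \<oplus> \<tau>) = y" using y0 by blast
    then show ?thesis using per anti_setD[OF c(1)] by simp
  qed
  have fx: "f x = (f a - y) * pair 1 \<tau> a x + y * of_bool (x \<in> anti_set \<tau>)" if x: "x \<in> V" for x
  proof (cases "x \<in> anti_set \<tau>")
    case True
    then show ?thesis using y[OF True] per[of a] aD by (auto simp: pair_def)
  next
    case False
    then show ?thesis using supp_inD[of anti_set \<tau> f x] f x aD \<tau>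
      by (auto simp: anti_mean_zero_def pair_def anti_set_def eps_add2)
  qed
  have YV: "anti_set \<tau> \<subseteq> V" "finite (anti_set \<tau>)" using finite_V by (auto simp: anti_set_def)
  have "sum f V = (f a - y) * 2 + y * of_nat (card (anti_set \<tau>))"
  proof -
    have "sum f V = (f a - y) * (\<Sum>x\<in>V. pair 1 \<tau> a x) + y * (\<Sum>x\<in>V. of_bool (x \<in> anti_set \<tau>))"
      using fx by (simp add: sum.distrib sum_distrib_left)
    moreover have "(\<Sum>x\<in>V. pair 1 \<tau> a x) = fourier (pair 1 \<tau> a) \<zero>" by (simp add: fourier_zero)
    moreover have "V \<inter> anti_set \<tau> = anti_set \<tau>" using YV by blast
    ultimately show ?thesis using \<tau> aD by (simp add: fourier_pair pair_dual_def finite_V)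
  qed
  then have s0: "(f a - y) * 2 + y * of_nat (card (anti_set \<tau>)) = 0"
    using f by (simp add: anti_mean_zero_def zero_sum_def)
  have "card (anti_set \<tau>) \<noteq> 0" using a YV by auto
  then have "y = - ((f a - y) * (2 / of_nat (card (anti_set \<tau>))))" using s0 by (simp add: field_simps)
  then have "f x = (f a - y) * (pair 1 \<tau> a x - 2 / of_nat (card (anti_set \<tau>)) * of_bool (x \<in> anti_set \<tau>))"
    if "x \<in> V" for x using fx[OF that] by algebra
  then show "\<exists>A. \<forall>x\<in>V. f x = A * (pair 1 \<tau> a x - 2 / of_nat (card (anti_set \<tau>)) * of_bool (x \<in> anti_set \<tau>))"
    by blast
next
  fix \<tau> g assume g: "\<tau> \<in> V" "anti_mean_zero \<tau> g"
  have "(\<Sum>b\<in>V. g b * (pair 1 \<tau> b x - 2 / of_nat (card (anti_set \<tau>)) * of_bool (x \<in> anti_set \<tau>))) = 2 * g x"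
    if "x \<in> V" for x
  proof -
    have "(\<Sum>b\<in>V. g b * (pair 1 \<tau> b x - 2 / of_nat (card (anti_set \<tau>)) * of_bool (x \<in> anti_set \<tau>))) =
      (\<Sum>b\<in>V. g b * pair 1 \<tau> b x) - sum g V * (2 / of_nat (card (anti_set \<tau>)) * of_bool (x \<in> anti_set \<tau>))"
      by (rule sum_mult_diff)
    then show ?thesis using g that by (simp add: sum_pair anti_mean_zero_def zero_sum_def)
  qed
  then show "\<exists>L. L \<noteq> 0 \<and> (\<forall>x\<in>V. (\<Sum>b\<in>V. g b * (pair 1 \<tau> b x - 2 / of_nat (card (anti_set \<tau>)) * of_bool (x \<in> anti_set \<tau>))) = L * g x)"
    by (intro exI[of _ 2]) auto
qed (auto simp: admissible_parts anti_mean_zero_def)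

text \<open>Skew-periodicity now carries the common value to the other half of
  \<open>anti_set \<tau>\<close> with the sign \<open>eps a c\<close>. An invariant function is thus
  a combination of a pair and its transform, and the eigenvalue equation leaves one
  parameter.\<close>

lemma cyclic_anti_eig:
  assumes s: "s * s = 1"
  shows "cyclic (anti_eig s)"
proof (rule cyclic_kernel[where R = anti_set and k = "pair_proj (-1) s"])
  fix \<tau> a f
  assume \<tau>: "\<tau> \<in> V" and a: "a \<in> anti_set \<tau>" and f: "anti_eig s \<tau> f" and
    inv: "\<And>c c'. c \<in> V \<Longrightarrow> c' \<in> V \<Longrightarrow> eps c a = eps c' a \<Longrightarrow> eps c \<tau> = eps c' \<tau> \<Longrightarrow>
        c \<notin> {\<zero>, a, \<tau>, a \<oplus> \<tau>} \<Longrightarrow> c' \<notin> {\<zero>, a, \<tau>, a \<oplus> \<tau>} \<Longrightarrow> f c = f c'"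
  note aD = anti_setD[OF a]
  have per: "f (c \<oplus> \<tau>) = - f c" if "c \<in> V" for c using f that by (simp add: anti_eig_def periodic_def)
  have "\<exists>y. \<forall>c. c \<in> anti_set \<tau> \<and> eps c a = 1 \<and> c \<noteq> a \<longrightarrow> f c = y"
  proof (rule ex_common_value)
    fix c c' assume "c \<in> anti_set \<tau> \<and> eps c a = 1 \<and> c \<noteq> a" "c' \<in> anti_set \<tau> \<and> eps c' a = 1 \<and> c' \<noteq> a"
    then show "f c = f c'"
      using aD anti_setD[of c \<tau>] anti_setD[of c' \<tau>] by (intro inv) (auto simp: eps_add2 eps_sym[of \<tau>])
  qed
  then obtain y where y0: "\<forall>c. c \<in> anti_set \<tau> \<and> eps c a = 1 \<and> c \<noteq> a \<longrightarrow> f c = y" by blast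
  have y: "f c = y * eps a c" if c: "c \<in> anti_set \<tau>" "c \<noteq> a" "c \<noteq> a \<oplus> \<tau>" for c
  proof (cases "eps c a = 1")
    case True then show ?thesis using y0 c by (auto simp: eps_sym[of a])
  next
    case False
    then have "eps (c \<oplus> \<tau>) a = 1" "c \<oplus> \<tau> \<in> anti_set \<tau>" "c \<oplus> \<tau> \<noteq> a"
      using aD anti_setD[OF c(1)] \<tau> c by (auto simp: eps_add2 anti_set_def add_move)
    then have "f (c \<oplus> \<tau>) = y" using y0 by blast
    then show ?thesis using per anti_setD[OF c(1)] False by (auto simp: eps_sym[of a])
  qed
  \<comment> \<open>The dual equals \<open>2 * eps a x\<close> on \<open>anti_set \<tau>\<close>,
    whence \<open>y / 2\<close>. The two zero terms give the sum the shape that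
    \<open>eig_expand\<close> expects.\<close>
  have fx: "f x = (f a - y) * pair (-1) \<tau> a x + y / 2 * pair_dual (-1) \<tau> a x
     + 0 * pair_dual (-1) \<tau> \<zero> x + 0 * pair (-1) \<tau> \<zero> x" if x: "x \<in> V" for x
  proof (cases "x \<in> anti_set \<tau>")
    case True
    then show ?thesis using y[OF True] per[of a] aD anti_setD[OF True]
      by (auto simp: pair_def pair_dual_def eps_add)
  next
    case False
    then have "f x = 0" "eps \<tau> x = 1" using supp_inD[of anti_set \<tau> f x] f x
      by (auto simp: anti_eig_def anti_set_def eps_sym)
    moreover have "x \<noteq> a" "x \<noteq> a \<oplus> \<tau>" using False a aD \<tau> by (auto simp: anti_set_def eps_add2)
    ultimately show ?thesis by (simp add: pair_def pair_dual_def)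
  qed
  have "f x = (f a - y + y / 2 * s * of_nat D) / 2 * pair_proj (-1) s \<tau> a x" if "x \<in> V" for x
    using eig_expand[OF _ \<tau> that s _ fx] aD f by (simp add: anti_eig_def)
  then show "\<exists>A. \<forall>x\<in>V. f x = A * pair_proj (-1) s \<tau> a x" by blast
next
  fix \<tau> g assume g: "\<tau> \<in> V" "anti_eig s \<tau> g"
  have "(\<Sum>b\<in>V. g b * pair_proj (-1) s \<tau> b x) = 4 * g x" if "x \<in> V" for x
  proof -
    have "(3 + (-1) * eps \<tau> x) * g x = 4 * g x"
      using g that by (auto simp: anti_eig_def supp_in_def dest!: anti_setD)
    then show ?thesis using g that s by (simp add: sum_pair_proj anti_eig_def)
  qed
  then show "\<exists>L. L \<noteq> 0 \<and> (\<forall>x\<in>V. (\<Sum>b\<in>V. g b * pair_proj (-1) s \<tau> b x) = L * g x)"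
    by (intro exI[of _ 4]) auto
qed (auto simp: admissible_parts anti_eig_def)

text \<open>The value is \<open>1 + 2 * s / D\<close>, increased by 1 at weight zero; it vanishes
  only for \<open>s = -1\<close>, \<open>D = 2\<close> and nonzero weight.\<close>

lemma pair_proj_zero_neq:
  assumes "s = 1 \<or> s = -1" "\<tau> \<noteq> \<zero> \<Longrightarrow> D > 2"
  shows "pair_proj 1 s \<tau> \<zero> \<zero> \<noteq> 0"
proof -
  have "pair_proj 1 s \<tau> \<zero> \<zero> = of_real (1 + of_bool (\<tau> = \<zero>) + 2 * Re s / real D)"
    using assms(1) by (auto simp: pair_proj_def pair_def pair_dual_def)
  moreover have "1 + of_bool (\<tau> = \<zero>) + 2 * Re s / real D > 0"
    using assms D_ge by (cases "\<tau> = \<zero>") (auto simp: field_simps)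
  ultimately show ?thesis by (metis of_real_eq_0_iff less_irrefl)
qed

text \<open>The second term of the kernel makes it vanish at \<^term>\<open>\<zero>\<close>.\<close>

lemma cyclic_comm_eig:
  assumes s1: "s = 1 \<or> s = -1" and D: "z \<or> D > 2"
  shows "cyclic (comm_eig z s)"
proof (rule cyclic_kernel[where R = comm_set and k = "\<lambda>\<tau> a x. pair_proj 1 s \<tau> a x
      - (2 * s / of_nat D) / pair_proj 1 s \<tau> \<zero> \<zero> * pair_proj 1 s \<tau> \<zero> x"])
  have s: "s * s = 1" using s1 by auto
  fix \<tau> a f
  assume \<tau>: "\<tau> \<in> V" and a: "a \<in> comm_set \<tau>" and f: "comm_eig z s \<tau> f" and fa: "f a \<noteq> 0" and
    inv: "\<And>c c'. c \<in> V \<Longrightarrow> c' \<in> V \<Longrightarrow> eps c a = eps c' a \<Longrightarrow> eps c \<tau> = eps c' \<tau> \<Longrightarrow>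
        c \<notin> {\<zero>, a, \<tau>, a \<oplus> \<tau>} \<Longrightarrow> c' \<notin> {\<zero>, a, \<tau>, a \<oplus> \<tau>} \<Longrightarrow> f c = f c'"
  note aD = comm_setD[OF a]
  have zt: "(\<tau> = \<zero>) = z" using f fa aD by (auto simp: comm_eig_def orbit_type_def)
  have per: "f (c \<oplus> \<tau>) = f c" if "c \<in> V" for c using f that by (simp add: comm_eig_def periodic_def)
  define K where "K = {\<zero>, a, \<tau>, a \<oplus> \<tau>}"
  have "\<exists>y. \<forall>c. c \<in> comm_set \<tau> \<and> eps c a = 1 \<and> c \<notin> K \<longrightarrow> f c = y"
    by (rule ex_common_value, rule inv) (auto simp: comm_set_def K_def)
  then obtain y where y: "\<forall>c. c \<in> comm_set \<tau> \<and> eps c a = 1 \<and> c \<notin> K \<longrightarrow> f c = y" by blast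
  have "\<exists>y. \<forall>c. c \<in> comm_set \<tau> \<and> eps c a = -1 \<and> c \<notin> K \<longrightarrow> f c = y"
    by (rule ex_common_value, rule inv) (auto simp: comm_set_def K_def)
  then obtain y' where y': "\<forall>c. c \<in> comm_set \<tau> \<and> eps c a = -1 \<and> c \<notin> K \<longrightarrow> f c = y'" by blast
  \<comment> \<open>The value of \<open>pair 1\<close> at its base point, which is 2 when the two
    points merge.\<close>
  define m where "m = (1 + of_bool (\<tau> = \<zero>) :: complex)"
  have m: "m \<noteq> 0" by (simp add: m_def of_bool_def)
  \<comment> \<open>Solution of a linear system: \<open>2 * \<beta> + 2 * \<gamma>\<close> and
    \<open>2 * \<beta> - 2 * \<gamma>\<close> are the values \<open>y\<close> and \<open>y'\<close>
    on the two classes, while \<alpha> and \<delta> correct the values at \<open>a\<close> and at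
    \<open>\<zero>\<close>.\<close>
  define \<alpha> \<gamma> \<beta> \<delta> where "\<alpha> = (f a - y) / m" and "\<gamma> = (y - y') / 4" and "\<beta> = (y + y') / 4" and "\<delta> = - y / m"
  have f0: "f \<zero> = 0" "f \<tau> = 0" using f \<tau> by (auto simp: comm_eig_def supp_in_def comm_set_def)
  have fx: "f x = \<alpha> * pair 1 \<tau> a x + \<gamma> * pair_dual 1 \<tau> a x + \<beta> * pair_dual 1 \<tau> \<zero> x + \<delta> * pair 1 \<tau> \<zero> x"
    if x: "x \<in> V" for x
  proof (cases "x \<in> K")
    case True
    have e: "\<gamma> * 2 + \<beta> * 2 = y" by (simp add: \<gamma>_def \<beta>_def field_simps)
    have "x = \<zero> \<or> x = \<tau> \<or> x = a \<or> x = a \<oplus> \<tau>" using True by (auto simp: K_def)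
    then have "(pair 1 \<tau> a x = 0 \<and> pair 1 \<tau> \<zero> x = m \<and> f x = 0 \<or>
        pair 1 \<tau> a x = m \<and> pair 1 \<tau> \<zero> x = 0 \<and> f x = f a) \<and>
        pair_dual 1 \<tau> a x = 2 \<and> pair_dual 1 \<tau> \<zero> x = 2"
      using aD f0 per[of a] by (auto simp: pair_def pair_dual_def m_def eps_add eps_sym1)
    then show ?thesis using m e by (auto simp: \<alpha>_def \<delta>_def)
  next
    case False
    then have p: "pair 1 \<tau> a x = 0" "pair 1 \<tau> \<zero> x = 0" by (auto simp: pair_def K_def)
    consider "x \<in> comm_set \<tau>" "eps x a = 1" | "x \<in> comm_set \<tau>" "eps x a = -1" | "eps \<tau> x = -1"
      using False x eps_cases[of x \<tau>] eps_cases[of x a] by (auto simp: K_def comm_set_def eps_sym[of \<tau>])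
    then show ?thesis
    proof cases
      case 1
      then show ?thesis using y False p comm_setD[OF 1(1)]
        by (simp add: pair_dual_def eps_sym[of a] \<gamma>_def \<beta>_def field_simps)
    next
      case 2
      then show ?thesis using y' False p comm_setD[OF 2(1)]
        by (simp add: pair_dual_def eps_sym[of a] \<gamma>_def \<beta>_def field_simps)
    next
      case 3
      then have "f x = 0" using f x supp_inD[of comm_set \<tau> f x]
        by (auto simp: comm_eig_def comm_set_def eps_sym)
      then show ?thesis using 3 p by (simp add: pair_dual_def)
    qed
  qed
  define A B where "A = (\<alpha> + \<gamma> * s * of_nat D) / 2" and "B = (\<delta> + \<beta> * s * of_nat D) / 2"
  have fAB: "f x = A * pair_proj 1 s \<tau> a x + B * pair_proj 1 s \<tau> \<zero> x" if "x \<in> V" for x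
    unfolding A_def B_def using eig_expand[OF _ \<tau> that s _ fx] aD f by (simp add: comm_eig_def)
  have pz: "pair_proj 1 s \<tau> \<zero> \<zero> \<noteq> 0" using pair_proj_zero_neq[OF s1, of \<tau>] D zt by auto
  \<comment> \<open>Two parameters are left; the condition \<open>f \<zero> = 0\<close> expresses
    the second one by the first.\<close>
  have "pair_proj 1 s \<tau> a \<zero> = 2 * s / of_nat D"
    using aD by (auto simp: pair_proj_def pair_def pair_dual_def)
  then have "B * pair_proj 1 s \<tau> \<zero> \<zero> = - (A * (2 * s / of_nat D))"
    using fAB[of \<zero>] f0 by (simp add: eq_neg_iff_add_eq_0 add.commute)
  then have "B = - (A * (2 * s / of_nat D)) / pair_proj 1 s \<tau> \<zero> \<zero>"
    using pz by (metis nonzero_mult_div_cancel_right)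
  then have "B = - A * ((2 * s / of_nat D) / pair_proj 1 s \<tau> \<zero> \<zero>)" by simp
  then have "f x = A * (pair_proj 1 s \<tau> a x
      - (2 * s / of_nat D) / pair_proj 1 s \<tau> \<zero> \<zero> * pair_proj 1 s \<tau> \<zero> x)" if "x \<in> V" for x
    using fAB[OF that] by (simp add: algebra_simps)
  then show "\<exists>A. \<forall>x\<in>V. f x = A * (pair_proj 1 s \<tau> a x
      - (2 * s / of_nat D) / pair_proj 1 s \<tau> \<zero> \<zero> * pair_proj 1 s \<tau> \<zero> x)" by blast
next
  have s: "s * s = 1" using s1 by auto
  fix \<tau> g assume g: "\<tau> \<in> V" "comm_eig z s \<tau> g"
  \<comment> \<open>The eigenvalue equation at \<open>\<zero>\<close>, where \<open>g\<close>
    vanishes, gives \<open>g\<close> the sum zero; the correction term of the kernel then drops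
    out.\<close>
  have "fourier g \<zero> = 0" using g by (auto simp: comm_eig_def fourier_eig_def supp_in_def comm_set_def)
  then have g0: "sum g V = 0" by (simp add: fourier_zero)
  have "(\<Sum>b\<in>V. g b * (pair_proj 1 s \<tau> b x - c * pair_proj 1 s \<tau> \<zero> x)) = 4 * g x" if "x \<in> V" for c x
  proof -
    have "(3 + 1 * eps \<tau> x) * g x = 4 * g x"
      using g that by (auto simp: comm_eig_def supp_in_def dest!: comm_setD)
    moreover have "(\<Sum>b\<in>V. g b * (pair_proj 1 s \<tau> b x - c * pair_proj 1 s \<tau> \<zero> x)) =
       (\<Sum>b\<in>V. g b * pair_proj 1 s \<tau> b x) - sum g V * (c * pair_proj 1 s \<tau> \<zero> x)"
      by (rule sum_mult_diff)
    ultimately show ?thesis using g that s g0 by (simp add: sum_pair_proj comm_eig_def)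
  qed
  then show "\<exists>L. L \<noteq> 0 \<and> (\<forall>x\<in>V. (\<Sum>b\<in>V. g b * (pair_proj 1 s \<tau> b x
      - (2 * s / of_nat D) / pair_proj 1 s \<tau> \<zero> \<zero> * pair_proj 1 s \<tau> \<zero> x)) = L * g x)"
    by (intro exI[of _ 4] conjI ballI) (simp, blast)
qed (auto simp: admissible_parts comm_eig_def)


section \<open>Nontriviality and the decomposition of a weight space\<close>

lemma comm_set_shift: "a \<in> comm_set \<tau> \<Longrightarrow> \<tau> \<in> V \<Longrightarrow> a \<oplus> \<tau> \<in> comm_set \<tau>"
  by (auto simp: comm_set_def eps_add2 add_move)

lemma anti_set_shift: "a \<in> anti_set \<tau> \<Longrightarrow> \<tau> \<in> V \<Longrightarrow> a \<oplus> \<tau> \<in> anti_set \<tau>"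
  by (auto simp: anti_set_def eps_add2)

lemma comm_set_shift_iff: "a \<in> V \<Longrightarrow> \<tau> \<in> V \<Longrightarrow> a \<oplus> \<tau> \<in> comm_set \<tau> \<longleftrightarrow> a \<in> comm_set \<tau>"
  using comm_set_shift[of a \<tau>] comm_set_shift[of "a \<oplus> \<tau>" \<tau>] by auto

lemma anti_set_shift_iff: "a \<in> V \<Longrightarrow> \<tau> \<in> V \<Longrightarrow> a \<oplus> \<tau> \<in> anti_set \<tau> \<longleftrightarrow> a \<in> anti_set \<tau>"
  using anti_set_shift[of a \<tau>] anti_set_shift[of "a \<oplus> \<tau>" \<tau>] by auto

text \<open>Four times the indicator of the set is \<open>(1 + eps x a) * (1 + eps x b)\<close>. It
  expands into four characters, and each trivial one contributes \<open>D^2\<close>.\<close>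

lemma count_orthogonal:
  assumes "a \<in> V" "b \<in> V"
  shows "4 * card {x \<in> V. eps x a = 1 \<and> eps x b = 1} =
    D ^ 2 * (1 + of_bool (a = \<zero>) + of_bool (b = \<zero>) + of_bool (a = b))"
proof -
  have "of_nat (4 * card {x \<in> V. eps x a = 1 \<and> eps x b = 1}) =
      (\<Sum>x\<in>V. if eps x a = 1 \<and> eps x b = 1 then 4 else 0 :: complex)"
    by (simp add: sum.If_cases finite_V Int_def conj_commute)
  also have "\<dots> = (\<Sum>x\<in>V. (1 + eps x a) * (1 + eps x b))"
  proof (rule sum.cong)
    show "(if eps x a = 1 \<and> eps x b = 1 then 4 else 0) = (1 + eps x a) * (1 + eps x b)" for x
      using eps_cases[of x a] eps_cases[of x b] by auto
  qed simp
  also have "\<dots> = (\<Sum>x\<in>V. eps x \<zero> + eps x a + eps x b + eps x (a \<oplus> b))"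
    by (rule sum.cong) (auto simp: eps_add algebra_simps)
  also have "\<dots> = of_nat (D ^ 2 * (1 + of_bool (a = \<zero>) + of_bool (b = \<zero>) + of_bool (a = b)))"
    using assms by (simp only: sum.distrib sum_eps add_V zero_V if_True add_eq_zero)
      (simp add: of_bool_def algebra_simps)
  finally show ?thesis by (simp only: of_nat_eq_iff)
qed

lemma ex_nonzero: "\<exists>\<tau>\<in>V. \<tau> \<noteq> \<zero>"
proof (rule ccontr)
  assume "\<not> ?thesis"
  then have "V \<subseteq> {\<zero>}" by blast
  then have "card V \<le> 1" using card_mono[of "{\<zero>}" V] by simp
  moreover have "card V = D ^ 2" using card_V by (metis of_nat_eq_iff of_nat_power)
  moreover have "2 ^ 2 \<le> D ^ 2" using D_ge power_mono by blast
  ultimately show False by simp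
qed

lemma ex_anti: "\<tau> \<in> V \<Longrightarrow> \<tau> \<noteq> \<zero> \<Longrightarrow> \<exists>a. a \<in> anti_set \<tau>"
  using exists_separating[of "\<zero>" "\<zero>" \<tau>] by (auto simp: anti_set_def)

lemma ex_comm:
  assumes "\<tau> \<in> V" "\<tau> = \<zero> \<or> D > 2"
  shows "\<exists>a. a \<in> comm_set \<tau>"
proof (rule ccontr)
  assume neg: "\<not> ?thesis"
  show False
  proof (cases "\<tau> = \<zero>")
    case True
    then show False using neg ex_nonzero by (auto simp: comm_set_def)
  next
    case False
    have "{x \<in> V. eps x \<zero> = 1 \<and> eps x \<tau> = 1} \<subseteq> {\<zero>, \<tau>}" using neg by (auto simp: comm_set_def)
    then have "card {x \<in> V. eps x \<zero> = 1 \<and> eps x \<tau> = 1} \<le> card {\<zero>, \<tau>}" by (intro card_mono) auto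
    also have "\<dots> \<le> 2" by (simp add: card_insert_if)
    finally have "D ^ 2 * 2 \<le> 8" using count_orthogonal[of "\<zero>" \<tau>] assms False by simp
    moreover have "3 ^ 2 \<le> D ^ 2" using assms False by (intro power_mono) auto
    ultimately show False by simp
  qed
qed

text \<open>The points commuting with \<open>a\<close> and \<tau> outnumber the span of the two as
  soon as \<open>D\<close> is this large. This is the source of the threshold for the eigenvalue
  \<open>-D\<close> on \<open>comm_set\<close>.\<close>

lemma ex_comm_comm:
  assumes \<tau>: "\<tau> \<in> V" and a: "a \<in> comm_set \<tau>" and D: "D > 4 \<or> \<tau> = \<zero> \<and> D > 2"
  shows "\<exists>c\<in>comm_set \<tau>. c \<noteq> a \<and> c \<noteq> a \<oplus> \<tau> \<and> eps c a = 1"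
proof (rule ccontr)
  assume "\<not> ?thesis"
  then have "{x \<in> V. eps x a = 1 \<and> eps x \<tau> = 1} \<subseteq> {\<zero>, \<tau>} \<union> {a, a \<oplus> \<tau>}"
    by (auto simp: comm_set_def)
  then have "card {x \<in> V. eps x a = 1 \<and> eps x \<tau> = 1} \<le> card ({\<zero>, \<tau>} \<union> {a, a \<oplus> \<tau>})"
    by (intro card_mono) auto
  also have "\<dots> \<le> (if \<tau> = \<zero> then 2 else 4)" by (auto simp: card_insert_if)
  finally have le: "D ^ 2 * (1 + of_bool (\<tau> = \<zero>)) \<le> (if \<tau> = \<zero> then 8 else 16)"
    using count_orthogonal[of a \<tau>] comm_setD[OF a] \<tau> by auto
  show False
  proof (cases "\<tau> = \<zero>")
    case True
    moreover have "3 ^ 2 \<le> D ^ 2" using D by (intro power_mono) auto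
    ultimately show False using le by simp
  next
    case False
    moreover have "5 ^ 2 \<le> D ^ 2" using D False by (intro power_mono) auto
    ultimately show False using le by simp
  qed
qed

text \<open>In these dimensions \<open>a\<close> and \<tau> span a maximal isotropic subspace: the
  number of points commuting with both is exactly the size of the span.\<close>

lemma comm_set_small:
  assumes \<tau>: "\<tau> \<in> V" and a: "a \<in> comm_set \<tau>" and D: "D = (if \<tau> = \<zero> then 2 else 4)"
    and x: "x \<in> V" "eps x a = 1" "eps x \<tau> = 1"
  shows "x \<in> {\<zero>, \<tau>} \<union> {a, a \<oplus> \<tau>}"
proof -
  note aD = comm_setD[OF a]
  have "{\<zero>, \<tau>} \<union> {a, a \<oplus> \<tau>} \<subseteq> {x \<in> V. eps x a = 1 \<and> eps x \<tau> = 1}"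
    using aD \<tau> by (auto simp: eps_add2)
  moreover have "card {x \<in> V. eps x a = 1 \<and> eps x \<tau> = 1} = card ({\<zero>, \<tau>} \<union> {a, a \<oplus> \<tau>})"
  proof -
    have "card ({\<zero>, \<tau>} \<union> {a, a \<oplus> \<tau>}) = (if \<tau> = \<zero> then 2 else 4)"
      using aD by (auto simp: card_insert_if)
    moreover have "4 * card {x \<in> V. eps x a = 1 \<and> eps x \<tau> = 1} = 4 * (if \<tau> = \<zero> then 2 else 4)"
      using count_orthogonal[of a \<tau>] aD \<tau> D by (auto simp: power2_eq_square)
    ultimately show ?thesis by simp
  qed
  ultimately have "{\<zero>, \<tau>} \<union> {a, a \<oplus> \<tau>} = {x \<in> V. eps x a = 1 \<and> eps x \<tau> = 1}"
    using finite_V by (intro card_subset_eq) simp_all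
  then show ?thesis using x by blast
qed

lemma comm_set_empty:
  assumes "\<tau> \<in> V" "\<tau> \<noteq> \<zero>" "D = 2"
  shows "comm_set \<tau> = {}"
proof -
  have "4 * card {x \<in> V. eps x \<zero> = 1 \<and> eps x \<tau> = 1} = 8"
    using count_orthogonal[of "\<zero>" \<tau>] assms by simp
  moreover have "{\<zero>, \<tau>} \<subseteq> {x \<in> V. eps x \<zero> = 1 \<and> eps x \<tau> = 1}" using assms by auto
  ultimately have *: "{\<zero>, \<tau>} = {x \<in> V. eps x \<zero> = 1 \<and> eps x \<tau> = 1}"
    using finite_V assms(2) by (intro card_subset_eq) simp_all
  show ?thesis
  proof (rule equals0I)
    fix a assume a: "a \<in> comm_set \<tau>"
    then have "a \<in> {x \<in> V. eps x \<zero> = 1 \<and> eps x \<tau> = 1}" by (simp add: comm_set_def)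
    then have "a \<in> {\<zero>, \<tau>}" by (simp only: *)
    then show False using comm_setD[OF a] by blast
  qed
qed

text \<open>Two points anticommuting with \<tau> differ by a point commuting with it, and for
  \<open>D = 2\<close> only \<open>\<zero>\<close> and \<tau> commute with it.\<close>

lemma anti_set_small:
  assumes "a \<in> anti_set \<tau>" "\<tau> \<in> V" "D = 2"
  shows "anti_set \<tau> = {a, a \<oplus> \<tau>}"
proof -
  have "x \<in> {a, a \<oplus> \<tau>}" if "x \<in> anti_set \<tau>" for x
  proof (rule ccontr)
    assume "x \<notin> {a, a \<oplus> \<tau>}"
    then have "x \<oplus> a \<in> comm_set \<tau>"
      using that assms add_comm[of a \<tau>] by (auto simp: anti_set_def comm_set_def eps_add2 add_move)
    then show False using comm_set_empty[of \<tau>] anti_setD[OF assms(1)] assms by auto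
  qed
  then show ?thesis using assms anti_set_shift by blast
qed

section \<open>Nonzero members of the families\<close>

definition nontrivial :: "('v \<Rightarrow> ('v \<Rightarrow> complex) \<Rightarrow> bool) \<Rightarrow> bool" where
  "nontrivial \<Phi> \<longleftrightarrow> (\<exists>\<tau>\<in>V. \<exists>f. \<Phi> \<tau> f \<and> (\<exists>a\<in>V. f a \<noteq> 0))"

lemma nontrivialI: "\<tau> \<in> V \<Longrightarrow> \<Phi> \<tau> f \<Longrightarrow> a \<in> V \<Longrightarrow> f a \<noteq> 0 \<Longrightarrow> nontrivial \<Phi>"
  unfolding nontrivial_def by blast

lemma nontrivial_const_part:
  assumes "\<tau> \<in> V" "(\<tau> = \<zero>) = z" "a \<in> V" "a \<in> R \<tau>"
  shows "nontrivial (const_part z R)"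
  by (rule nontrivialI[of \<tau> _ "\<lambda>x. of_bool (x \<in> R \<tau>)" a])
    (use assms in \<open>auto simp: const_part_def orbit_type_def supp_in_def const_on_def\<close>)

lemma nontrivial_comm_skew: "D > 2 \<Longrightarrow> nontrivial comm_skew"
proof -
  assume D: "D > 2"
  obtain \<tau> where \<tau>: "\<tau> \<in> V" "\<tau> \<noteq> \<zero>" using ex_nonzero by blast
  then obtain a where a: "a \<in> comm_set \<tau>" using ex_comm D by blast
  show ?thesis
    by (rule nontrivialI[of \<tau> _ "pair (-1) \<tau> a" a])
      (use \<tau> comm_setD[OF a] a comm_set_shift[OF a]
        in \<open>auto simp: comm_skew_def pair_def supp_in_def periodic_def of_bool_def add_move\<close>)
qed

text \<open>The difference of two pairs has sum zero; translating by a point of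
  \<open>comm_set \<tau>\<close> yields a second pair inside \<open>anti_set \<tau>\<close>.\<close>

lemma nontrivial_anti_mean_zero: "D > 2 \<Longrightarrow> nontrivial anti_mean_zero"
proof -
  assume D: "D > 2"
  obtain \<tau> where \<tau>: "\<tau> \<in> V" "\<tau> \<noteq> \<zero>" using ex_nonzero by blast
  then obtain a where a: "a \<in> anti_set \<tau>" using ex_anti by blast
  obtain c where c: "c \<in> comm_set \<tau>" using ex_comm D \<tau> by blast
  note D = \<tau> anti_setD[OF a] comm_setD[OF c]
  have ac: "a \<oplus> c \<in> anti_set \<tau>" using D by (simp add: anti_set_def eps_add2)
  define f where "f x = pair 1 \<tau> a x - pair 1 \<tau> (a \<oplus> c) x" for x
  have "supp_in anti_set \<tau> f"
    using a ac anti_set_shift[OF a \<tau>(1)] anti_set_shift[OF ac \<tau>(1)]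
    by (auto simp: supp_in_def f_def pair_def)
  moreover have "periodic 1 \<tau> f" by (auto simp: periodic_def f_def pair_def add_move)
  moreover have "sum f V = fourier (pair 1 \<tau> a) \<zero> - fourier (pair 1 \<tau> (a \<oplus> c)) \<zero>"
    by (simp add: fourier_zero f_def sum_subtractf)
  then have "zero_sum \<tau> f" using D by (simp add: zero_sum_def fourier_pair pair_dual_def)
  moreover have "f a \<noteq> 0" using D by (auto simp: f_def pair_def add_assoc)
  ultimately show ?thesis using D by (intro nontrivialI[of \<tau> _ f a]) (auto simp: anti_mean_zero_def)
qed

text \<open>The spectral projection of a pair has the value \<open>1 + 2 * s / D\<close> at its base
  point, which vanishes only for \<open>s = -1\<close> and \<open>D = 2\<close>.\<close>

lemma nontrivial_anti_eig:
  assumes s: "s = 1 \<or> s = -1 \<and> D > 2"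
  shows "nontrivial (anti_eig s)"
proof -
  obtain \<tau> where \<tau>: "\<tau> \<in> V" "\<tau> \<noteq> \<zero>" using ex_nonzero by blast
  then obtain a where a: "a \<in> anti_set \<tau>" using ex_anti by blast
  note D = \<tau> anti_setD[OF a]
  define f where "f = pair_proj (-1) s \<tau> a"
  have e: "eps \<tau> x = 1 \<longleftrightarrow> x \<notin> anti_set \<tau>" if "x \<in> V" for x
    using that eps_cases[of \<tau> x] by (auto simp: anti_set_def eps_sym[of \<tau>])
  have "supp_in anti_set \<tau> f"
    using a anti_set_shift[OF a \<tau>(1)] by (auto simp: supp_in_def f_def pair_proj_def pair_def pair_dual_def e)
  moreover have "periodic (-1) \<tau> f"
    using D by (auto simp: periodic_def f_def pair_proj_def pair_def pair_dual_def add_move eps_add eps_sym[of a \<tau>] of_bool_def)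
  moreover have "fourier_eig s \<tau> f"
    using D s by (auto simp: fourier_eig_def f_def fourier_pair_proj)
  moreover have "f a = 1 + s * (2 / of_nat D)"
    using D by (simp add: f_def pair_proj_def pair_def pair_dual_def)
  then have "f a = of_real (1 + Re s * (2 / real D))" using s by auto
  moreover have "1 + Re s * (2 / real D) \<noteq> 0"
    using s D_ge by (auto simp: field_simps add_eq_0_iff)
  ultimately show ?thesis using D by (intro nontrivialI[of \<tau> _ f a]) (auto simp: anti_eig_def simp del: of_real_add of_real_mult of_real_divide)
qed

text \<open>The difference of the projections at \<open>a\<close> and \<open>b\<close> vanishes
  outside \<open>comm_set \<tau>\<close>. The choice \<open>eps b a = - s\<close> keeps its value at
  \<open>a\<close> nonzero. For \<open>s = -1\<close> this \<open>b\<close> commutes with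
  \<open>a\<close>, and its existence requires the larger \<open>D\<close>.\<close>

lemma nontrivial_comm_eig:
  assumes s: "s = 1 \<and> D > (if z then 1 else 2) \<or> s = -1 \<and> D > (if z then 2 else 4)"
  shows "nontrivial (comm_eig z s)"
proof -
  obtain \<tau> where \<tau>: "\<tau> \<in> V" "(\<tau> = \<zero>) = z" using ex_nonzero zero_V by blast
  then obtain a where a: "a \<in> comm_set \<tau>" using ex_comm[of \<tau>] s by (auto split: if_splits)
  note D = \<tau> comm_setD[OF a]
  obtain b where b: "b \<in> comm_set \<tau>" "b \<noteq> a" "b \<noteq> a \<oplus> \<tau>" "eps b a = - s"
  proof (cases "s = 1")
    case True
    obtain v where "v \<in> V" "eps v a = -1" "eps v \<tau> = 1"
      using exists_separating[of \<tau> "\<zero>" a] D by auto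
    then have "v \<in> comm_set \<tau>" "v \<noteq> a" "v \<noteq> a \<oplus> \<tau>" "eps v a = -s"
      using D True by (auto simp: comm_set_def eps_add2)
    then show ?thesis using that by blast
  next
    case False
    then have "s = -1" "D > 4 \<or> \<tau> = \<zero> \<and> D > 2" using s \<tau> by (auto split: if_splits)
    then show ?thesis using ex_comm_comm[OF \<tau>(1) a] that by auto
  qed
  have s2: "s * s = 1" using s by auto
  define f where "f x = pair_proj 1 s \<tau> a x - pair_proj 1 s \<tau> b x" for x
  have e: "eps \<tau> x = -1" if "x \<in> V" "x \<notin> comm_set \<tau>" "x \<noteq> \<zero>" "x \<noteq> \<tau>" for x
    using that eps_cases[of \<tau> x] by (auto simp: comm_set_def eps_sym[of \<tau>])
  have "f x = 0" if "x \<in> V" "x \<notin> comm_set \<tau>" for x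
  proof -
    have "pair 1 \<tau> a x = 0" "pair 1 \<tau> b x = 0"
      using that a b comm_set_shift[OF a \<tau>(1)] comm_set_shift[OF b(1) \<tau>(1)] by (auto simp: pair_def)
    moreover have "pair_dual 1 \<tau> a x = pair_dual 1 \<tau> b x"
      using e[OF that] D comm_setD[OF b(1)] by (cases "x = \<zero> \<or> x = \<tau>") (auto simp: pair_dual_def)
    ultimately show ?thesis by (simp add: f_def pair_proj_def)
  qed
  then have "supp_in comm_set \<tau> f" by (auto simp: supp_in_def)
  moreover have "periodic 1 \<tau> f"
    using D comm_setD[OF b(1)]
    by (auto simp: periodic_def f_def pair_proj_def pair_def pair_dual_def add_move eps_add)
  moreover have "fourier f x = s * of_nat D * f x" if "x \<in> V" for x
    using D comm_setD[OF b(1)] s2 that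
    by (simp add: f_def[abs_def] fourier_diff fourier_pair_proj right_diff_distrib)
  then have "fourier_eig s \<tau> f" by (auto simp: fourier_eig_def)
  moreover have "f a \<noteq> 0"
  proof -
    have fa: "f a = 1 + of_bool (\<tau> = \<zero>) + s / of_nat D * (2 * (1 + s))"
      using D b comm_setD[OF b(1)] by (auto simp: f_def pair_proj_def pair_def pair_dual_def algebra_simps add_move)
    show ?thesis
    proof (cases "s = 1")
      case True
      then have "f a = of_real (1 + of_bool (\<tau> = \<zero>) + 4 / real D)" using fa by simp
      moreover have "1 + of_bool (\<tau> = \<zero>) + 4 / real D > 0" by (simp add: add_pos_nonneg)
      ultimately show ?thesis by (metis less_irrefl of_real_eq_0_iff)
    next
      case False
      then show ?thesis using fa s by (auto simp: of_bool_def)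
    qed
  qed
  moreover have "orbit_type z \<tau> f" using \<tau> by (simp add: orbit_type_def)
  ultimately show ?thesis using D by (intro nontrivialI[of \<tau> _ f a]) (auto simp: comm_eig_def)
qed

text \<open>The sum of \<open>(1 + eps a x) * f x\<close> is computed twice. The eigenvalue equation
  gives \<open>- D * f a\<close>; and as only \<open>a\<close> and \<open>a \<oplus> \<tau>\<close>
  in \<open>comm_set \<tau>\<close> commute with \<open>a\<close>, the sum is a positive multiple of
  \<open>f a\<close>.\<close>

lemma comm_eig_trivial:
  assumes \<tau>: "\<tau> \<in> V" and D: "D = (if \<tau> = \<zero> then 2 else 4)" and f: "comm_eig z (-1) \<tau> f" and a: "a \<in> V"
  shows "f a = 0"
proof (cases "a \<in> comm_set \<tau>")
  case False then show ?thesis using f a by (auto simp: comm_eig_def supp_in_def)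
next
  case True
  note aD = comm_setD[OF True]
  have "fourier f \<zero> = 0" using f by (auto simp: comm_eig_def fourier_eig_def supp_in_def comm_set_def)
  then have "(\<Sum>x\<in>V. (1 + eps a x) * f x) = fourier f a"
    by (simp add: fourier_def distrib_right sum.distrib)
  also have "\<dots> = - of_nat D * f a" using f a by (simp add: comm_eig_def fourier_eig_def)
  also have "(\<Sum>x\<in>V. (1 + eps a x) * f x) =
      (\<Sum>x\<in>V. f x * (2 * of_bool (x = a)) + f x * (2 * of_bool (\<tau> \<noteq> \<zero>) * of_bool (x = a \<oplus> \<tau>)))"
  proof (rule sum.cong)
    fix x assume x: "x \<in> V"
    show "(1 + eps a x) * f x = f x * (2 * of_bool (x = a)) + f x * (2 * of_bool (\<tau> \<noteq> \<zero>) * of_bool (x = a \<oplus> \<tau>))"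
    proof (cases "x = a \<or> x = a \<oplus> \<tau>")
      case True then show ?thesis using aD by (auto simp: eps_add eps_sym)
    next
      case False
      then have "f x = 0 \<or> eps a x = -1"
        using comm_set_small[OF \<tau> True D x] f x eps_cases[of a x]
        by (auto simp: comm_eig_def supp_in_def comm_set_def eps_sym[of a])
      then show ?thesis using False by auto
    qed
  qed simp
  also have "\<dots> = 2 * f a + 2 * of_bool (\<tau> \<noteq> \<zero>) * f (a \<oplus> \<tau>)"
  proof -
    have "(\<Sum>x\<in>V. f x * (c * of_bool (x = b))) = c * f b" if "b \<in> V" for b c
      using sum_of_bool_mult[OF that, of "\<lambda>x. f x * c"] by (simp add: mult_ac)
    then show ?thesis using a \<tau> by (simp add: sum.distrib)
  qed
  also have "f (a \<oplus> \<tau>) = f a" using f a by (simp add: comm_eig_def periodic_def)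
  finally have "(2 + 2 * of_bool (\<tau> \<noteq> \<zero>) + of_nat D) * f a = 0" by (simp add: algebra_simps)
  moreover have "2 + 2 * of_bool (\<tau> \<noteq> \<zero>) + (of_nat D :: complex) \<noteq> 0" using D by auto
  ultimately show ?thesis by simp
qed

section \<open>Splitting a weight space by support, periodicity, mean and eigenvalue\<close>

lemma fourier_shift:
  assumes "supp_in R \<tau> f" "\<And>b. b \<in> R \<tau> \<Longrightarrow> eps \<tau> b = e"
  shows "fourier f (x \<oplus> \<tau>) = e * fourier f x"
  unfolding fourier_def sum_distrib_left
proof (rule sum.cong)
  fix b assume "b \<in> V"
  then show "eps (x \<oplus> \<tau>) b * f b = e * (eps x b * f b)"
    using assms by (cases "f b = 0") (auto simp: supp_in_def eps_add2)
qed simp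

text \<open>Translating the summation variable by \<tau> reverses the sign of the sum. Together with
  \<open>fourier_shift\<close>: the transform turns a support condition relative to \<tau> into a
  periodicity, and a periodicity into a support condition.\<close>

lemma fourier_periodic_zero:
  assumes "periodic \<eta> \<tau> f" "\<tau> \<in> V" "\<eta> * eps x \<tau> = -1"
  shows "fourier f x = 0"
proof -
  have "fourier f x = (\<Sum>b\<in>V. eps x (b \<oplus> \<tau>) * f (b \<oplus> \<tau>))"
    unfolding fourier_def using assms(2) by (simp add: sum_shift[of \<tau> "\<lambda>b. eps x b * f b"])
  also have "\<dots> = (\<Sum>b\<in>V. (\<eta> * eps x \<tau>) * (eps x b * f b))"
    using assms(1) by (intro sum.cong refl) (simp add: eps_add periodic_def mult_ac)
  also have "\<dots> = - fourier f x" by (simp only: assms(3)) (simp add: fourier_def sum_negf)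
  finally show ?thesis by simp
qed

text \<open>For \<open>s = 1\<close> and \<open>s = -1\<close> these are the spectral projections of
  the transform, whose square is \<open>D^2\<close>.\<close>

definition half :: "complex \<Rightarrow> ('v \<Rightarrow> complex) \<Rightarrow> 'v \<Rightarrow> complex" where
  "half s f x = (f x + s / of_nat D * fourier f x) / 2"

lemma fourier_eig_half:
  assumes "s * s = 1"
  shows "fourier_eig s \<tau> (half s f)"
  unfolding fourier_eig_def
proof
  fix x assume x: "x \<in> V"
  define k where "k = s / of_nat D"
  have k: "s * of_nat D * k = 1" "k * of_nat D ^ 2 = s * of_nat D"
    using assms by (simp_all add: k_def power2_eq_square)
  have "half s f = (\<lambda>x. 1/2 * (f x + k * fourier f x))" by (auto simp: half_def k_def)
  then have "fourier (half s f) x = 1/2 * (fourier f x + k * (of_nat D ^ 2 * f x))"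
    using x by (simp only: fourier_scale fourier_add fourier_fourier)
  then have "2 * fourier (half s f) x = fourier f x + k * (of_nat D ^ 2 * f x)" by (simp add: mult.commute)
  moreover have "2 * half s f x = f x + k * fourier f x" by (simp add: half_def k_def)
  ultimately have "2 * fourier (half s f) x = 2 * (s * of_nat D * half s f x)" using k by algebra
  then show "fourier (half s f) x = s * of_nat D * half s f x" by simp
qed

lemma half_sum: "half 1 f x + half (-1) f x = f x"
  by (simp add: half_def field_simps)

lemma sum_indicator: "R \<subseteq> V \<Longrightarrow> (\<Sum>x\<in>V. c * of_bool (x \<in> R)) = c * of_nat (card R)"
  by (simp add: finite_V Int_absorb1 flip: sum_distrib_left)

lemma split_mean:
  assumes R: "R \<tau> \<subseteq> V" "\<And>x. x \<in> V \<Longrightarrow> x \<oplus> \<tau> \<in> R \<tau> \<longleftrightarrow> x \<in> R \<tau>" and f: "supp_in R \<tau> f" "periodic 1 \<tau> f"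
  shows "\<exists>c g. supp_in R \<tau> c \<and> const_on R \<tau> c \<and> supp_in R \<tau> g \<and> periodic 1 \<tau> g \<and> sum g V = 0 \<and>
    (\<forall>x\<in>V. f x = c x + g x)"
proof -
  define c where "c x = sum f V / of_nat (card (R \<tau>)) * of_bool (x \<in> R \<tau>)" for x
  have "sum c V = sum f V"
  proof (cases "R \<tau> = {}")
    case True
    then have "sum f V = 0" using f by (intro sum.neutral) (auto simp: supp_in_def)
    then show ?thesis using True by (simp add: c_def)
  next
    case False
    then have "card (R \<tau>) \<noteq> 0" using R(1) finite_V by (auto dest: finite_subset)
    then show ?thesis unfolding c_def using R(1) by (simp only: sum_indicator) simp
  qed
  then have "sum (\<lambda>x. f x - c x) V = 0" by (simp add: sum_subtractf)
  then show ?thesis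
    using f R(2) by (intro exI[of _ c] exI[of _ "\<lambda>x. f x - c x"])
      (auto simp: supp_in_def const_on_def periodic_def c_def)
qed

text \<open>At \<open>\<zero>\<close> and \<tau> the transform of a function on
  \<open>comm_set \<tau>\<close> equals its sum. Only after the mean is removed does the transform
  preserve the support, so that both spectral projections stay inside.\<close>

lemma split_comm:
  assumes \<tau>: "\<tau> \<in> V" and f: "supp_in comm_set \<tau> f" "periodic 1 \<tau> f"
  shows "\<exists>c g h. supp_in comm_set \<tau> c \<and> const_on comm_set \<tau> c \<and>
    supp_in comm_set \<tau> g \<and> periodic 1 \<tau> g \<and> fourier_eig 1 \<tau> g \<and>
    supp_in comm_set \<tau> h \<and> periodic 1 \<tau> h \<and> fourier_eig (-1) \<tau> h \<and> (\<forall>x\<in>V. f x = c x + g x + h x)"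
proof -
  have "comm_set \<tau> \<subseteq> V" by (auto simp: comm_set_def)
  then obtain c f0 where c: "supp_in comm_set \<tau> c" "const_on comm_set \<tau> c"
    and f0: "supp_in comm_set \<tau> f0" "periodic 1 \<tau> f0" "sum f0 V = 0" and eq: "\<forall>x\<in>V. f x = c x + f0 x"
    using split_mean[of comm_set \<tau> f] f comm_set_shift_iff \<tau> by blast
  have shift: "fourier f0 (x \<oplus> \<tau>) = fourier f0 x" for x
    using fourier_shift[OF f0(1), of 1 x] comm_setD by simp
  have "fourier f0 x = 0" if x: "x \<in> V" "x \<notin> comm_set \<tau>" for x
  proof -
    consider "x = \<zero>" | "x = \<tau>" | "eps x \<tau> = -1" using x by (auto simp: comm_set_def)
    then show ?thesis
    proof cases
      case 1 then show ?thesis using f0 by (simp add: fourier_zero)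
    next
      case 2 then show ?thesis using f0 shift[of \<zero>] by (simp add: fourier_zero)
    next
      case 3 then show ?thesis using fourier_periodic_zero[OF f0(2) \<tau>] by simp
    qed
  qed
  then have "supp_in comm_set \<tau> (half s f0)" for s
    using f0 by (auto simp: supp_in_def half_def)
  moreover have "periodic 1 \<tau> (half s f0)" for s
    using f0 shift by (auto simp: periodic_def half_def)
  ultimately show ?thesis using c eq
    by (intro exI[of _ c] exI[of _ "half 1 f0"] exI[of _ "half (-1) f0"])
      (simp add: fourier_eig_half add.assoc half_sum)
qed

text \<open>No mean has to be removed: skew-periodicity makes the transform vanish at every point
  commuting with \<tau>.\<close>

lemma split_anti_skew:
  assumes \<tau>: "\<tau> \<in> V" and f: "supp_in anti_set \<tau> f" "periodic (-1) \<tau> f"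
  shows "anti_eig 1 \<tau> (half 1 f)" "anti_eig (-1) \<tau> (half (-1) f)"
proof -
  have "fourier f x = 0" if x: "x \<in> V" "x \<notin> anti_set \<tau>" for x
    using x fourier_periodic_zero[OF f(2) \<tau>, of x] by (auto simp: anti_set_def)
  then have "supp_in anti_set \<tau> (half s f)" for s
    using f by (auto simp: supp_in_def half_def)
  moreover have "fourier f (x \<oplus> \<tau>) = - fourier f x" for x
    using fourier_shift[OF f(1), of "-1" x] anti_setD by simp
  then have "periodic (-1) \<tau> (half s f)" for s
    using f by (auto simp: periodic_def half_def)
  ultimately show "anti_eig 1 \<tau> (half 1 f)" "anti_eig (-1) \<tau> (half (-1) f)"
    by (simp_all add: anti_eig_def fourier_eig_half)
qed

text \<open>Transforming \<open>g + h = 0\<close> gives \<open>D * (g - h) = 0\<close>.\<close>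

lemma fourier_eig_indep:
  assumes "fourier_eig 1 \<tau> g" "fourier_eig (-1) \<tau> h" "\<forall>x\<in>V. g x + h x = 0" "x \<in> V"
  shows "g x = 0" "h x = 0"
proof -
  have "fourier (\<lambda>x. g x + h x) x = 0" using assms(3) by (simp add: fourier_def)
  then have "of_nat D * (g x - h x) = 0"
    using assms(1,2,4) by (simp add: fourier_add fourier_eig_def right_diff_distrib)
  then show "g x = 0" "h x = 0" using assms(3,4) by (auto simp: eq_neg_iff_add_eq_0)
qed

lemma const_zero_sum:
  assumes "supp_in R \<tau> c" "const_on R \<tau> c" "sum c V = 0" "R \<tau> \<subseteq> V" "x \<in> V"
  shows "c x = 0"
proof (cases "x \<in> R \<tau>")
  case True
  have "sum c V = sum c (R \<tau>)"
    using assms by (intro sum.mono_neutral_right finite_V) (auto simp: supp_in_def)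
  also have "\<dots> = (\<Sum>y\<in>R \<tau>. c x)"
    using assms(2) True unfolding const_on_def by (intro sum.cong refl) blast
  finally have "of_nat (card (R \<tau>)) * c x = 0" using assms(3) by simp
  moreover have "card (R \<tau>) \<noteq> 0" using True finite_subset[OF assms(4) finite_V] by auto
  ultimately show ?thesis by simp
qed (use assms in \<open>auto simp: supp_in_def\<close>)

lemma fourier_eig_sum:
  "fourier_eig s \<tau> f \<Longrightarrow> f \<zero> = 0 \<Longrightarrow> sum f V = 0"
  by (auto simp: fourier_eig_def fourier_zero[symmetric])

text \<open>Order of the parts as in the decomposition for \<open>q \<ge> 3\<close>.\<close>

definition part :: "nat \<Rightarrow> 'v \<Rightarrow> ('v \<Rightarrow> complex) \<Rightarrow> bool" where
  "part i = [const_part True (\<lambda>_. {\<zero>}), const_part False (\<lambda>_. {\<zero>}), const_part False (\<lambda>\<tau>. {\<tau>}),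
     const_part True comm_set, comm_eig True 1, comm_eig True (-1),
     const_part False comm_set, comm_eig False 1, comm_eig False (-1),
     const_part False anti_set, anti_eig 1, anti_eig (-1), comm_skew, anti_mean_zero] ! i"

lemma part_simps:
  "part 0 = const_part True (\<lambda>_. {\<zero>})" "part 1 = const_part False (\<lambda>_. {\<zero>})"
  "part 2 = const_part False (\<lambda>\<tau>. {\<tau>})" "part 3 = const_part True comm_set"
  "part 4 = comm_eig True 1" "part 5 = comm_eig True (-1)" "part 6 = const_part False comm_set"
  "part 7 = comm_eig False 1" "part 8 = comm_eig False (-1)" "part 9 = const_part False anti_set"
  "part 10 = anti_eig 1" "part 11 = anti_eig (-1)" "part 12 = comm_skew" "part 13 = anti_mean_zero"
  by (simp_all add: part_def)

lemma all_less_14: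
  "(\<forall>i<14. P i) \<longleftrightarrow> P 0 \<and> P 1 \<and> P 2 \<and> P 3 \<and> P 4 \<and> P 5 \<and> P 6 \<and> P 7 \<and> P 8 \<and> P 9 \<and> P 10 \<and> P 11 \<and> P 12 \<and> P (13::nat)"
  by (simp add: eval_nat_numeral All_less_Suc conj_ac)

lemma sum_less_14:
  "(\<Sum>i<14. h i) = h 0 + h 1 + h 2 + h 3 + h 4 + h 5 + h 6 + h 7 + h 8 + h 9 + h 10 + h 11 + h 12 + (h (13::nat) :: complex)"
  by (simp add: eval_nat_numeral)

lemma admissible_part: "i < 14 \<Longrightarrow> admissible (part i)"
proof -
  have "\<forall>i<14. admissible (part i)"
    unfolding all_less_14 part_simps by (intro conjI admissible_parts natural_sets)
  then show "i < 14 \<Longrightarrow> admissible (part i)" by blast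
qed

lemma orbit_type_anti: "supp_in anti_set \<tau> f \<Longrightarrow> orbit_type False \<tau> f"
  by (auto simp: supp_in_def orbit_type_def anti_set_def)

text \<open>\<open>f\<close> is cut by support into the points \<open>\<zero>\<close> and \<tau>,
  the commuting and the anticommuting set. On the two sets it is split by parity under translation
  by \<tau>, and the pieces then by mean and eigenvalue.\<close>

lemma parts_exist:
  assumes \<tau>: "\<tau> \<in> V"
  shows "\<exists>h. (\<forall>i<14. part i \<tau> (h i)) \<and> (\<forall>x\<in>V. f x = (\<Sum>i<14. h i x))"
proof -
  define XS where "XS x = of_bool (x \<in> comm_set \<tau>) * (f x + f (x \<oplus> \<tau>)) / 2" for x
  define XA where "XA x = of_bool (x \<in> comm_set \<tau>) * (f x - f (x \<oplus> \<tau>)) / 2" for x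
  define YS where "YS x = of_bool (x \<in> anti_set \<tau>) * (f x + f (x \<oplus> \<tau>)) / 2" for x
  define YA where "YA x = of_bool (x \<in> anti_set \<tau>) * (f x - f (x \<oplus> \<tau>)) / 2" for x
  have "supp_in comm_set \<tau> XS" "periodic 1 \<tau> XS"
    using \<tau> by (auto simp: supp_in_def periodic_def XS_def comm_set_shift_iff)
  then obtain c g h where cgh: "supp_in comm_set \<tau> c" "const_on comm_set \<tau> c"
    "supp_in comm_set \<tau> g" "periodic 1 \<tau> g" "fourier_eig 1 \<tau> g"
    "supp_in comm_set \<tau> h" "periodic 1 \<tau> h" "fourier_eig (-1) \<tau> h" "\<forall>x\<in>V. XS x = c x + g x + h x"
    using split_comm[OF \<tau>] by metis
  have "supp_in anti_set \<tau> YS" "periodic 1 \<tau> YS"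
    using \<tau> by (auto simp: supp_in_def periodic_def YS_def anti_set_shift_iff)
  then obtain c' g' where c': "supp_in anti_set \<tau> c'" "const_on anti_set \<tau> c'"
    "supp_in anti_set \<tau> g'" "periodic 1 \<tau> g'" "sum g' V = 0" "\<forall>x\<in>V. YS x = c' x + g' x"
    using split_mean[of anti_set \<tau> YS] anti_set_shift_iff \<tau> anti_setD by (metis subsetI)
  have XA: "comm_skew \<tau> XA"
    using \<tau> by (auto simp: comm_skew_def supp_in_def periodic_def XA_def comm_set_shift_iff)
  have YA0: "supp_in anti_set \<tau> YA" by (auto simp: supp_in_def YA_def)
  have YA1: "periodic (-1) \<tau> YA"
    using \<tau> by (auto simp: periodic_def YA_def anti_set_shift_iff)
  note YA = split_anti_skew[OF \<tau> YA0 YA1]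
  \<comment> \<open>Keeps a component only at weights of its orbit type, so
    \<open>sel True k\<close> and \<open>sel False k\<close> add up to \<open>k\<close>. At weight
    zero \<open>sel False\<close> also prevents counting the value at \<open>\<zero>\<close> a
    second time as the value at \<tau>.\<close>
  define sel where "sel z k = (if (\<tau> = \<zero>) = z then k else (\<lambda>_. 0 :: complex))" for z and k :: "'v \<Rightarrow> complex"
  define p where "p r x = of_bool (x = r) * f x" for r x
  define H where "H = [sel True (p \<zero>), sel False (p \<zero>), sel False (p \<tau>), sel True c, sel True g, sel True h,
    sel False c, sel False g, sel False h, c', half 1 YA, half (-1) YA, XA, g']"
  have cp: "const_part z R \<tau> (sel z k)" if "supp_in R \<tau> k" "const_on R \<tau> k" for z k R
  proof -
    have "const_on R \<tau> (\<lambda>_. 0)" by (simp add: const_on_def)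
    then show ?thesis
      using that by (cases "(\<tau> = \<zero>) = z") (auto simp: const_part_def sel_def orbit_type_def supp_in_def)
  qed
  have ce: "comm_eig z s \<tau> (sel z k)"
    if "supp_in comm_set \<tau> k" "periodic 1 \<tau> k" "fourier_eig s \<tau> k" for z s k
    using that by (auto simp: comm_eig_def sel_def orbit_type_def supp_in_def periodic_def fourier_eig_def fourier_def)
  have "\<forall>i<14. part i \<tau> (H ! i)"
    unfolding all_less_14 part_simps
  proof (intro conjI)
    show "const_part True (\<lambda>_. {\<zero>}) \<tau> (H ! 0)" "const_part False (\<lambda>_. {\<zero>}) \<tau> (H ! 1)"
      "const_part False (\<lambda>\<tau>. {\<tau>}) \<tau> (H ! 2)"
      by (auto simp: H_def p_def supp_in_def const_on_def intro!: cp)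
    show "const_part False anti_set \<tau> (H ! 9)" using c' by (simp add: H_def const_part_def orbit_type_anti)
    show "anti_mean_zero \<tau> (H ! 13)" using c' by (simp add: H_def anti_mean_zero_def zero_sum_def)
  qed (simp_all add: H_def cp ce cgh XA YA)
  moreover have "f x = (\<Sum>i<14. (H ! i) x)" if x: "x \<in> V" for x
  proof -
    have "(\<Sum>i<14. (H ! i) x) = sel True (p \<zero>) x + sel False (p \<zero>) x + sel False (p \<tau>) x
       + (sel True c x + sel False c x + (sel True g x + sel False g x) + (sel True h x + sel False h x)) + XA x
       + (c' x + g' x) + (half 1 YA x + half (-1) YA x)"
      by (simp add: sum_less_14 H_def)
    also have "\<dots> = p \<zero> x + sel False (p \<tau>) x + XS x + XA x + YS x + YA x"
    proof -
      have "sel True k x + sel False k x = k x" for k by (simp add: sel_def)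
      then show ?thesis using cgh(9) c'(6) x by (simp add: half_sum)
    qed
    also have "\<dots> = f x"
    proof -
      have XY: "XS x + XA x = of_bool (x \<in> comm_set \<tau>) * f x" "YS x + YA x = of_bool (x \<in> anti_set \<tau>) * f x"
        by (simp_all add: XS_def XA_def YS_def YA_def field_simps)
      have "p \<zero> x + sel False (p \<tau>) x + of_bool (x \<in> comm_set \<tau>) * f x + of_bool (x \<in> anti_set \<tau>) * f x = f x"
        using x by (auto simp: p_def sel_def comm_set_def anti_set_def)
      then show ?thesis using XY by (simp add: add.assoc)
    qed
    finally show ?thesis by simp
  qed
  ultimately show ?thesis by blast
qed

lemma orbit_type_exclusive:
  assumes "orbit_type True \<tau> f" "orbit_type False \<tau> g" "\<forall>x\<in>V. f x + g x = 0" "x \<in> V"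
  shows "f x = 0" "g x = 0"
proof -
  have "f y = 0 \<and> g y = 0" if "y \<in> V" for y
    using assms(1-3) that by (cases "\<tau> = \<zero>") (force simp: orbit_type_def)+
  then show "f x = 0" "g x = 0" using assms(4) by auto
qed

text \<open>The components are separated by support, by parity under translation by \<tau>, and by
  mean and eigenvalue. Families differing only in orbit type are added first and told apart at the
  end.\<close>

lemma parts_indep:
  assumes \<tau>: "\<tau> \<in> V" and h: "\<forall>i<14. part i \<tau> (h i)" and s0: "\<forall>x\<in>V. (\<Sum>i<14. h i x) = 0"
    and x: "x \<in> V"
  shows "\<forall>i<14. h i x = 0"
proof -
  note P = h[unfolded all_less_14 part_simps]
  note defs = const_part_def comm_eig_def comm_skew_def anti_mean_zero_def anti_eig_def
  have P': "supp_in (\<lambda>_. {\<zero>}) \<tau> (h 0)" "supp_in (\<lambda>_. {\<zero>}) \<tau> (h 1)" "supp_in (\<lambda>\<tau>. {\<tau>}) \<tau> (h 2)"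
    "orbit_type True \<tau> (h 0)" "orbit_type False \<tau> (h 1)" "orbit_type False \<tau> (h 2)"
    "\<And>i. i \<in> {3, 4, 5, 6, 7, 8, 12} \<Longrightarrow> supp_in comm_set \<tau> (h i)"
    "\<And>i. i \<in> {9, 10, 11, 13} \<Longrightarrow> supp_in anti_set \<tau> (h i)"
    using P by (auto simp: defs)
  have C: "h 3 y = 0" "h 4 y = 0" "h 5 y = 0" "h 6 y = 0" "h 7 y = 0" "h 8 y = 0" "h 12 y = 0"
    if "y \<in> V" "y \<notin> comm_set \<tau>" for y
    using supp_inD[OF P'(7) that] by simp_all
  have A: "h 9 y = 0" "h 10 y = 0" "h 11 y = 0" "h 13 y = 0" if "y \<in> V" "y \<notin> anti_set \<tau>" for y
    using supp_inD[OF P'(8) that] by simp_all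
  have notin: "\<zero> \<notin> comm_set \<tau>" "\<tau> \<notin> comm_set \<tau>" "\<zero> \<notin> anti_set \<tau>" "\<tau> \<notin> anti_set \<tau>"
    by (auto simp: comm_set_def anti_set_def)
  note sum = s0[unfolded sum_less_14, rule_format]
  have 2: "h 2 y = 0" if "y \<in> V" for y
  proof (rule ccontr)
    assume n: "h 2 y \<noteq> 0"
    then have y: "y = \<tau>" "\<tau> \<noteq> \<zero>" using P' that by (auto simp: supp_in_def orbit_type_def)
    then have "h 0 y = 0" "h 1 y = 0" using P' that by (auto simp: supp_in_def)
    then show False using n sum[OF that] C[OF that] A[OF that] y notin by simp
  qed
  have 01: "h 0 y + h 1 y = 0" if "y \<in> V" for y
  proof (cases "y = \<zero>")
    case True
    then show ?thesis using sum[OF that] 2[OF that] C[OF that] A[OF that] notin by simp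
  qed (use P' that in \<open>auto simp: supp_in_def\<close>)
  have h01: "h 0 x = 0" "h 1 x = 0"
    using orbit_type_exclusive[OF P'(4,5)] 01 x by blast+
  have com: "h 3 y + h 4 y + h 5 y + h 6 y + h 7 y + h 8 y + h 12 y = 0"
    and ant: "h 9 y + h 10 y + h 11 y + h 13 y = 0" if y: "y \<in> V" for y
  proof -
    have "y \<notin> comm_set \<tau> \<or> y \<notin> anti_set \<tau>" by (auto simp: comm_set_def anti_set_def)
    moreover have "(h 3 y + h 4 y + h 5 y + h 6 y + h 7 y + h 8 y + h 12 y) + (h 9 y + h 10 y + h 11 y + h 13 y) = 0"
      using sum[OF y] 01[OF y] 2[OF y] by algebra
    ultimately show "h 3 y + h 4 y + h 5 y + h 6 y + h 7 y + h 8 y + h 12 y = 0"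
      "h 9 y + h 10 y + h 11 y + h 13 y = 0"
      using C[OF y] A[OF y] by auto
  qed
  have const_per: "k (y \<oplus> \<tau>) = k y" if "supp_in R \<tau> k" "const_on R \<tau> k" "y \<in> V"
      "\<And>x. x \<in> V \<Longrightarrow> x \<oplus> \<tau> \<in> R \<tau> \<longleftrightarrow> x \<in> R \<tau>" for k R y
  proof (cases "y \<in> R \<tau>")
    case True
    then show ?thesis using that unfolding const_on_def by blast
  next
    case False
    then show ?thesis using that \<tau> supp_inD[OF that(1)] by auto
  qed
  have "periodic 1 \<tau> (h i)" if "i \<in> {3, 4, 5, 6, 7, 8, 9, 13}" for i
  proof -
    have "const_part z R \<tau> k \<Longrightarrow> R = comm_set \<or> R = anti_set \<Longrightarrow> periodic 1 \<tau> k" for z R k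
      using const_per[of R k] comm_set_shift_iff[OF _ \<tau>] anti_set_shift_iff[OF _ \<tau>]
      by (auto simp: const_part_def periodic_def)
    moreover have "comm_eig z s \<tau> k \<Longrightarrow> periodic 1 \<tau> k" for z s k by (simp add: comm_eig_def)
    moreover have "anti_mean_zero \<tau> k \<Longrightarrow> periodic 1 \<tau> k" for k by (simp add: anti_mean_zero_def)
    ultimately show ?thesis using that P by fast
  qed
  from this[unfolded periodic_def, rule_format, of 3] this[unfolded periodic_def, rule_format, of 4]
    this[unfolded periodic_def, rule_format, of 5] this[unfolded periodic_def, rule_format, of 6]
    this[unfolded periodic_def, rule_format, of 7] this[unfolded periodic_def, rule_format, of 8]
    this[unfolded periodic_def, rule_format, of 9] this[unfolded periodic_def, rule_format, of 13]
  have per: "h 3 (y \<oplus> \<tau>) = h 3 y" "h 4 (y \<oplus> \<tau>) = h 4 y" "h 5 (y \<oplus> \<tau>) = h 5 y" "h 6 (y \<oplus> \<tau>) = h 6 y"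
    "h 7 (y \<oplus> \<tau>) = h 7 y" "h 8 (y \<oplus> \<tau>) = h 8 y" "h 9 (y \<oplus> \<tau>) = h 9 y" "h 13 (y \<oplus> \<tau>) = h 13 y"
    if "y \<in> V" for y using that by simp_all
  have skew: "h 10 (y \<oplus> \<tau>) = - h 10 y" "h 11 (y \<oplus> \<tau>) = - h 11 y" "h 12 (y \<oplus> \<tau>) = - h 12 y"
    if "y \<in> V" for y
    using that P by (simp_all add: defs periodic_def)
  have 12: "h 12 y = 0" if y: "y \<in> V" for y
    using com[OF y] com[of "y \<oplus> \<tau>"] y \<tau> by (simp add: per[OF y] skew[OF y])
  have 9: "h 9 y + h 13 y = 0" "h 10 y + h 11 y = 0" if y: "y \<in> V" for y
  proof -
    have 1: "h 9 y + h 13 y + (h 10 y + h 11 y) = 0" using ant[OF y] by (simp add: algebra_simps)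
    have 2: "h 9 y + h 13 y - (h 10 y + h 11 y) = 0"
      using ant[of "y \<oplus> \<tau>"] y \<tau> by (simp add: per[OF y] skew[OF y] algebra_simps)
    from 1 2 have "2 * (h 9 y + h 13 y) = 0" by algebra
    then show 3: "h 9 y + h 13 y = 0" by (simp only: mult_eq_0_iff) simp
    then show "h 10 y + h 11 y = 0" using 1 by simp
  qed
  have h1011: "h 10 x = 0" "h 11 x = 0"
    using fourier_eig_indep[of \<tau> "h 10" "h 11"] 9 x P by (auto simp: defs)
  have "sum (\<lambda>y. h 9 y + h 13 y) V = 0" using 9 by simp
  then have "sum (h 9) V = 0" using P by (simp add: sum.distrib defs zero_sum_def)
  then have h9: "h 9 x = 0"
    using const_zero_sum[of anti_set \<tau> "h 9" x] P x by (auto simp: defs anti_set_def)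
  then have h13: "h 13 x = 0" using 9[OF x] by simp
  \<comment> \<open>Adding the two orbit types leaves one eigenvector for \<open>D\<close>, one for
    \<open>-D\<close>, and one constant.\<close>
  define g where "g z = (if z then (\<lambda>y. h 4 y + h 7 y) else (\<lambda>y. h 5 y + h 8 y))" for z
  have eig: "fourier_eig 1 \<tau> (g True)" "fourier_eig (-1) \<tau> (g False)"
    using P \<tau> admissibleD(2)[OF admissible_fourier_eig] by (auto simp: g_def defs)
  have gz: "g z \<zero> = 0" for z using C[OF zero_V notin(1)] by (simp add: g_def)
  have cg: "(h 3 y + h 6 y) + g True y + g False y = 0" if "y \<in> V" for y
    using com[OF that] 12[OF that] by (simp add: g_def algebra_simps)
  \<comment> \<open>Eigenvectors that vanish at \<open>\<zero>\<close> have sum zero, so the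
    constant has sum zero too and must vanish.\<close>
  have sg: "sum (g z) V = 0" for z
    using fourier_eig_sum[OF eig(1)] fourier_eig_sum[OF eig(2)] gz by (cases z) auto
  have "sum (\<lambda>y. (h 3 y + h 6 y) + g True y + g False y) V = 0" using cg by simp
  then have c1: "sum (\<lambda>y. h 3 y + h 6 y) V = 0" by (simp add: sum.distrib sg)
  have c2: "supp_in comm_set \<tau> (\<lambda>y. h 3 y + h 6 y)"
    by (rule admissibleD(2)[OF admissible_supp_in[OF natural_sets(1)] \<tau>]) (use P in \<open>simp_all add: defs\<close>)
  have c3: "const_on comm_set \<tau> (\<lambda>y. h 3 y + h 6 y)"
    by (rule admissibleD(2)[OF admissible_const_on[OF natural_sets(1)] \<tau>]) (use P in \<open>simp_all add: defs\<close>)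
  have c4: "comm_set \<tau> \<subseteq> V" by (auto simp: comm_set_def)
  have 36: "h 3 y + h 6 y = 0" if "y \<in> V" for y
    by (rule const_zero_sum[OF c2 c3 c1 c4 that])
  have "g True y = 0" "g False y = 0" if "y \<in> V" for y
  proof -
    have "\<forall>y\<in>V. g True y + g False y = 0" using cg 36 by simp
    from fourier_eig_indep[OF eig this that] show "g True y = 0" "g False y = 0" .
  qed
  then have "h 4 y + h 7 y = 0" "h 5 y + h 8 y = 0" if "y \<in> V" for y
    using that by (auto simp: g_def)
  then have "h 3 x = 0" "h 6 x = 0" "h 4 x = 0" "h 7 x = 0" "h 5 x = 0" "h 8 x = 0"
    using orbit_type_exclusive[of \<tau> "h 3" "h 6" x] orbit_type_exclusive[of \<tau> "h 4" "h 7" x]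
      orbit_type_exclusive[of \<tau> "h 5" "h 8" x] 36 P x by (simp_all add: defs)
  then show ?thesis
    unfolding all_less_14 using h01 2[OF x] 12[OF x] h1011 h9 h13 by blast
qed

end

section \<open>Pauli strings\<close>

lemma less_4_iff: "k < 4 \<longleftrightarrow> k = 0 \<or> k = 1 \<or> k = 2 \<or> k = (3::nat)" by auto

lemma less_2_iff: "k < 2 \<longleftrightarrow> k = 0 \<or> k = (1::nat)" by auto

lemma sum_less_4: "(\<Sum>k<4. f k) = f 0 + f 1 + f 2 + (f (3::nat) :: complex)"
  by (simp add: eval_nat_numeral)

lemma bitof_less: "bitof t i < 2" by (simp add: bitof_def)

text \<open>The letters 0, 1, 2, 3 for identity, X, Y, Z are two-bit vectors, on which
  \<open>xor\<close> is multiplication of Pauli matrices up to a phase.\<close>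

definition string_add :: "(nat \<Rightarrow> nat) \<Rightarrow> (nat \<Rightarrow> nat) \<Rightarrow> nat \<Rightarrow> nat" (infixl "\<boxplus>" 65) where
  "a \<boxplus> b = (\<lambda>t. xor (a t) (b t))"

text \<open>The symplectic form on two-bit vectors, written as a sign.\<close>

definition sign1 :: "nat \<Rightarrow> nat \<Rightarrow> complex" where
  "sign1 j k = (if (bit j 0 \<and> bit k 1) \<noteq> (bit j 1 \<and> bit k 0) then -1 else 1)"

definition comm_sign :: "nat \<Rightarrow> (nat \<Rightarrow> nat) \<Rightarrow> (nat \<Rightarrow> nat) \<Rightarrow> complex" where
  "comm_sign q a b = (\<Prod>t<q. sign1 (a t) (b t))"

text \<open>The cyclic rule XY = iZ, YZ = iX, ZX = iY, with -i for the reversed order.\<close>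

definition phase1 :: "nat \<Rightarrow> nat \<Rightarrow> complex" where
  "phase1 j k = (if j = 0 \<or> k = 0 \<or> j = k then 1
     else if (j, k) \<in> {(1, 2), (2, 3), (3, 1)} then \<i> else - \<i>)"

definition phase :: "nat \<Rightarrow> (nat \<Rightarrow> nat) \<Rightarrow> (nat \<Rightarrow> nat) \<Rightarrow> complex" where
  "phase q a b = (\<Prod>t<q. phase1 (a t) (b t))"

lemma sum_lessThan_add: "(\<Sum>k<m + n. f k) = (\<Sum>k<m. f k) + (\<Sum>k<(n::nat). f (m + k) :: complex)"
  by (induction n) (simp_all add: add.assoc)

lemma bitof_add_power:
  assumes "k < 2 ^ q"
  shows "t < q \<Longrightarrow> bitof t (2 ^ q + k) = bitof t k" "bitof q (2 ^ q + k) = 1" "bitof q k = 0"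
proof -
  assume "t < q"
  then have "(2::nat) ^ q = 2 ^ t * (2 * 2 ^ (q - t - 1))" by (simp flip: power_Suc power_add)
  then obtain m where "(2 ^ q + k) div 2 ^ t = 2 * m + k div 2 ^ t" by simp
  then show "bitof t (2 ^ q + k) = bitof t k" by (simp add: bitof_def)
next
  show "bitof q (2 ^ q + k) = 1" "bitof q k = 0" using assms by (simp_all add: bitof_def)
qed

text \<open>Splitting off the top bit shows that sums over matrix indices factor over the qubits;
  identities for Pauli strings thereby reduce to one qubit.\<close>

lemma sum_prod_bits: "(\<Sum>k<2 ^ q. \<Prod>t<q. h t (bitof t k)) = (\<Prod>t<q. h t 0 + h t 1 :: complex)"
proof (induction q)
  case (Suc q)
  have "(\<Sum>k<2 ^ Suc q. \<Prod>t<Suc q. h t (bitof t k)) =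
      (\<Sum>k<2 ^ q. \<Prod>t<Suc q. h t (bitof t k)) + (\<Sum>k<2 ^ q. \<Prod>t<Suc q. h t (bitof t (2 ^ q + k)))"
    using sum_lessThan_add[of "\<lambda>k. \<Prod>t<Suc q. h t (bitof t k)" "2 ^ q" "2 ^ q"] by (simp add: mult_2)
  also have "\<dots> = (\<Sum>k<2 ^ q. (\<Prod>t<q. h t (bitof t k)) * h q 0) + (\<Sum>k<2 ^ q. (\<Prod>t<q. h t (bitof t k)) * h q 1)"
    by (intro arg_cong2[where f = "(+)"] sum.cong refl) (simp_all add: bitof_add_power)
  also have "\<dots> = (\<Prod>t<Suc q. h t 0 + h t 1)"
    unfolding sum_distrib_right[symmetric] by (simp add: Suc algebra_simps)
  finally show ?case .
qed simp

lemma bitof_eqI: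
  assumes "i < 2 ^ q" "j < 2 ^ q" "\<And>t. t < q \<Longrightarrow> bitof t i = bitof t j"
  shows "i = j"
proof (rule bit_eqI)
  fix n
  show "bit i n = bit j n"
  proof (cases "n < q")
    case True
    then have "bitof n i = bitof n j" by (rule assms(3))
    then show ?thesis by (simp add: bitof_def bit_iff_odd odd_iff_mod_2_eq_one)
  next
    case False
    then have "(2::nat) ^ q \<le> 2 ^ n" by simp
    then have "i < 2 ^ n" "j < 2 ^ n" using assms(1,2) by linarith+
    then show ?thesis by (simp add: bit_iff_odd)
  qed
qed

lemma pstrings_Suc: "pstrings (Suc q) = (\<lambda>(s, k). s(q := k)) ` (pstrings q \<times> {..<4})"
proof (intro equalityI subsetI)
  fix s assume "s \<in> pstrings (Suc q)"
  then have "(s(q := 0), s q) \<in> pstrings q \<times> {..<4}" by (auto simp: pstrings_def)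
  moreover have "s = (\<lambda>(s, k). s(q := k)) (s(q := 0), s q)" by auto
  ultimately show "s \<in> (\<lambda>(s, k). s(q := k)) ` (pstrings q \<times> {..<4})" by (rule rev_image_eqI)
qed (auto simp: pstrings_def)

lemma finite_pstrings: "finite (pstrings q)"
proof (induction q)
  case 0
  have "pstrings 0 = {\<lambda>_. 0}" by (auto simp: pstrings_def)
  then show ?case by simp
qed (simp add: pstrings_Suc)

text \<open>Distributivity over the letters of a string; it yields both the nondegeneracy of
  \<open>comm_sign\<close> and the completeness relation.\<close>

lemma sum_prod_pstrings: "(\<Sum>s\<in>pstrings q. \<Prod>t<q. h t (s t)) = (\<Prod>t<q. \<Sum>k<4. h t k :: complex)"
proof (induction q)
  case 0
  have "pstrings 0 = {\<lambda>_. 0}" by (auto simp: pstrings_def)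
  then show ?case by simp
next
  case (Suc q)
  have inj: "inj_on (\<lambda>(s, k). s(q := k)) (pstrings q \<times> {..<4})"
  proof (rule inj_onI, clarsimp)
    fix s s' and k k' :: nat assume *: "s \<in> pstrings q" "s' \<in> pstrings q" "s(q := k) = s'(q := k')"
    have "s t = s' t" for t
      using *(1,2) fun_cong[OF *(3), of t] by (cases "t = q") (auto simp: pstrings_def)
    then show "s = s' \<and> k = k'" using fun_cong[OF *(3), of q] by auto
  qed
  have "(\<Sum>s\<in>pstrings (Suc q). \<Prod>t<Suc q. h t (s t)) =
      (\<Sum>p\<in>pstrings q \<times> {..<4}. (\<Prod>t<q. h t (fst p t)) * h q (snd p))"
    unfolding pstrings_Suc by (subst sum.reindex[OF inj]) (auto intro!: sum.cong)
  also have "\<dots> = (\<Sum>s\<in>pstrings q. \<Sum>k<4. (\<Prod>t<q. h t (s t)) * h q k)"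
    by (simp add: sum.cartesian_product split_def)
  also have "\<dots> = (\<Prod>t<Suc q. \<Sum>k<4. h t k)"
    by (simp add: Suc flip: sum_distrib_left sum_distrib_right)
  finally show ?case .
qed

lemma sign1_simps [simp]: "sign1 0 k = 1" "sign1 k 0 = 1" "sign1 k k = 1"
  by (auto simp: sign1_def)

lemma sign1_add: "sign1 j (xor k l) = sign1 j k * sign1 j l"
  unfolding sign1_def bit_xor_iff by (cases "bit j 0"; cases "bit j 1"; auto)

lemma xor_less_4: "j < 4 \<Longrightarrow> k < 4 \<Longrightarrow> xor j k < (4::nat)"
  unfolding less_4_iff by (elim disjE) simp_all

lemma pauli1_mult:
  "j < 4 \<Longrightarrow> k < 4 \<Longrightarrow> x < 2 \<Longrightarrow> y < 2 \<Longrightarrow>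
   pauli1 j x 0 * pauli1 k 0 y + pauli1 j x 1 * pauli1 k 1 y = phase1 j k * pauli1 (xor j k) x y"
  unfolding less_4_iff less_2_iff by (elim disjE; simp add: pauli1_def phase1_def)

lemma pauli1_complete:
  "x < 2 \<Longrightarrow> y < 2 \<Longrightarrow> x' < 2 \<Longrightarrow> y' < 2 \<Longrightarrow>
   (\<Sum>k<4. pauli1 k x y * cnj (pauli1 k x' y')) = (if x = x' \<and> y = y' then 2 else 0)"
  unfolding less_2_iff sum_less_4 by (elim disjE; simp add: pauli1_def)

lemma pauli1_orthogonal:
  "j < 4 \<Longrightarrow> k < 4 \<Longrightarrow>
   (cnj (pauli1 j 0 0) * pauli1 k 0 0 + cnj (pauli1 j 0 1) * pauli1 k 0 1) +
   (cnj (pauli1 j 1 0) * pauli1 k 1 0 + cnj (pauli1 j 1 1) * pauli1 k 1 1) = (if j = k then 2 else 0)"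
  unfolding less_4_iff by (elim disjE; simp add: pauli1_def)

lemma pauli1_adj: "j < 4 \<Longrightarrow> x < 2 \<Longrightarrow> y < 2 \<Longrightarrow> cnj (pauli1 j y x) = pauli1 j x y"
  unfolding less_4_iff less_2_iff by (elim disjE; simp add: pauli1_def)

lemma phase1_simps:
  "j < 4 \<Longrightarrow> k < 4 \<Longrightarrow> phase1 j k * phase1 j k = sign1 j k"
  "j < 4 \<Longrightarrow> k < 4 \<Longrightarrow> phase1 k j = sign1 j k * phase1 j k"
  "j < 4 \<Longrightarrow> k < 4 \<Longrightarrow> phase1 j k * phase1 (xor j k) k = 1"
  "j < 4 \<Longrightarrow> k < 4 \<Longrightarrow> phase1 j k * phase1 j (xor j k) = 1"
  "cnj (phase1 j k) * phase1 j k = 1" "phase1 0 k = 1" "phase1 j j = 1"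
  unfolding less_4_iff by (auto simp: phase1_def sign1_def bit_iff_odd)

lemma phase1_power: "\<exists>n. phase1 j k = \<i> ^ n"
proof -
  have "phase1 j k \<in> {\<i> ^ 0, \<i> ^ 1, \<i> ^ 3}" by (auto simp: phase1_def power3_eq_cube)
  then show ?thesis by blast
qed

lemma pstringsD: "s \<in> pstrings q \<Longrightarrow> t < q \<Longrightarrow> s t < 4" by (auto simp: pstrings_def)

lemma pstrings_add: "a \<in> pstrings q \<Longrightarrow> b \<in> pstrings q \<Longrightarrow> a \<boxplus> b \<in> pstrings q"
  by (auto simp: pstrings_def string_add_def xor_less_4)

lemma pstrings_zero: "(\<lambda>_. 0) \<in> pstrings q" by (simp add: pstrings_def)

lemma string_add_simps: "a \<boxplus> b \<boxplus> c = a \<boxplus> (b \<boxplus> c)" "a \<boxplus> b = b \<boxplus> a" "a \<boxplus> a = (\<lambda>_. 0)" "(\<lambda>_. 0) \<boxplus> a = a"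
  by (auto simp: string_add_def ac_simps)

text \<open>Nondegeneracy is checked letter by letter: the signs of a nonzero letter against the
  four letters cancel.\<close>

lemma sign_form_pauli: "q \<ge> 1 \<Longrightarrow> sign_form (pstrings q) (\<boxplus>) (\<lambda>_. 0) (comm_sign q) (2 ^ q)"
proof
  assume q: "q \<ge> 1"
  show "2 \<le> (2::nat) ^ q" using power_increasing[OF q, of "2::nat"] by simp
  fix a b c :: "nat \<Rightarrow> nat"
  show "finite (pstrings q)" by (rule finite_pstrings)
  show "(\<lambda>_. 0) \<in> pstrings q" by (rule pstrings_zero)
  show "a \<in> pstrings q \<Longrightarrow> b \<in> pstrings q \<Longrightarrow> a \<boxplus> b \<in> pstrings q" by (rule pstrings_add)
  show "a \<boxplus> b \<boxplus> c = a \<boxplus> (b \<boxplus> c)" "a \<boxplus> b = b \<boxplus> a" "a \<boxplus> a = (\<lambda>_. 0)" "(\<lambda>_. 0) \<boxplus> a = a"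
    by (rule string_add_simps)+
  show "comm_sign q a b = comm_sign q b a"
    unfolding comm_sign_def sign1_def by (intro prod.cong) auto
  show "comm_sign q a (b \<boxplus> c) = comm_sign q a b * comm_sign q a c"
    by (simp add: comm_sign_def string_add_def sign1_add prod.distrib)
  show "comm_sign q a a = 1" by (simp add: comm_sign_def)
  show "comm_sign q a b = 1 \<or> comm_sign q a b = -1"
  proof -
    have "(\<Prod>t<n. sign1 (a t) (b t)) = 1 \<or> (\<Prod>t<n. sign1 (a t) (b t)) = -1" for n
      by (induction n) (auto simp: sign1_def)
    then show ?thesis by (simp add: comm_sign_def)
  qed
  assume b: "b \<in> pstrings q"
  have "(\<Sum>a\<in>pstrings q. comm_sign q a b) = (\<Prod>t<q. \<Sum>k<4. sign1 k (b t))"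
    unfolding comm_sign_def by (rule sum_prod_pstrings)
  also have "\<dots> = (\<Prod>t<q. if b t = 0 then 4 else 0)"
  proof (rule prod.cong)
    fix t assume "t \<in> {..<q}"
    then have "b t < 4" using b pstringsD by auto
    then show "(\<Sum>k<4. sign1 k (b t)) = (if b t = 0 then 4 else 0)"
      unfolding less_4_iff sum_less_4 by (auto simp: sign1_def bit_iff_odd)
  qed simp
  also have "\<dots> = (if b = (\<lambda>_. 0) then of_nat (2 ^ q) ^ 2 else 0)"
  proof (cases "b = (\<lambda>_. 0)")
    case True
    then show ?thesis by (simp add: power2_eq_square flip: power_mult_distrib)
  next
    case False
    then obtain t where "b t \<noteq> 0" by auto
    then have "t < q" "b t \<noteq> 0" using b by (auto simp: pstrings_def not_less[symmetric])
    then show ?thesis using False by (auto intro!: prod_zero)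
  qed
  finally show "(\<Sum>a\<in>pstrings q. comm_sign q a b) = (if b = (\<lambda>_. 0) then of_nat (2 ^ q) ^ 2 else 0)" .
qed

lemma phase_simps:
  "a \<in> pstrings q \<Longrightarrow> b \<in> pstrings q \<Longrightarrow> phase q a b * phase q a b = comm_sign q a b"
  "a \<in> pstrings q \<Longrightarrow> b \<in> pstrings q \<Longrightarrow> phase q b a = comm_sign q a b * phase q a b"
  "a \<in> pstrings q \<Longrightarrow> b \<in> pstrings q \<Longrightarrow> phase q a b * phase q (a \<boxplus> b) b = 1"
  "a \<in> pstrings q \<Longrightarrow> b \<in> pstrings q \<Longrightarrow> phase q a b * phase q a (a \<boxplus> b) = 1"
  "cnj (phase q a b) * phase q a b = 1" "phase q (\<lambda>_. 0) a = 1" "phase q a a = 1"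
  unfolding phase_def comm_sign_def string_add_def cnj_prod prod.distrib[symmetric]
  by (intro prod.cong refl phase1_simps pstringsD[where q = q] prod.neutral ballI; simp)+

lemma phase_power: "\<exists>n. phase q a b = \<i> ^ n"
proof -
  have "\<forall>t. \<exists>n. phase1 (a t) (b t) = \<i> ^ n" using phase1_power by blast
  then obtain n where "\<And>t. phase1 (a t) (b t) = \<i> ^ n t" by metis
  then have "phase q a b = \<i> ^ (\<Sum>t<q. n t)" by (simp add: phase_def power_sum)
  then show ?thesis by blast
qed

lemma mmult_pmat:
  assumes "a \<in> pstrings q" "b \<in> pstrings q"
  shows "mmult q (pmat q a) (pmat q b) = msc (phase q a b) (pmat q (a \<boxplus> b))"
proof (intro ext)
  fix i j
  show "mmult q (pmat q a) (pmat q b) i j = msc (phase q a b) (pmat q (a \<boxplus> b)) i j"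
  proof (cases "i < 2 ^ q \<and> j < 2 ^ q")
    case True
    then have "mmult q (pmat q a) (pmat q b) i j =
      (\<Sum>k<2 ^ q. \<Prod>t<q. pauli1 (a t) (bitof t i) (bitof t k) * pauli1 (b t) (bitof t k) (bitof t j))"
      unfolding mmult_def pmat_def by (intro sum.cong) (auto simp: prod.distrib)
    also have "\<dots> = (\<Prod>t<q. phase1 (a t) (b t) * pauli1 (xor (a t) (b t)) (bitof t i) (bitof t j))"
      unfolding sum_prod_bits[where h = "\<lambda>t k. pauli1 (a t) (bitof t i) k * pauli1 (b t) k (bitof t j)"]
      using assms by (intro prod.cong refl pauli1_mult bitof_less pstringsD[where q = q]) auto
    finally show ?thesis using True by (simp add: msc_def pmat_def phase_def string_add_def prod.distrib)
  qed (auto simp: mmult_def pmat_def msc_def)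
qed

lemma pmat_orthogonal:
  assumes "a \<in> pstrings q" "b \<in> pstrings q"
  shows "(\<Sum>i<2 ^ q. \<Sum>j<2 ^ q. cnj (pmat q a i j) * pmat q b i j) = (if a = b then 2 ^ q else 0)"
proof -
  have "(\<Sum>i<2 ^ q. \<Sum>j<2 ^ q. cnj (pmat q a i j) * pmat q b i j) =
    (\<Sum>i<2 ^ q. \<Sum>j<2 ^ q. \<Prod>t<q. cnj (pauli1 (a t) (bitof t i) (bitof t j)) * pauli1 (b t) (bitof t i) (bitof t j))"
    unfolding pmat_def by (intro sum.cong) (auto simp: prod.distrib)
  also have "\<dots> = (\<Prod>t<q. if a t = b t then 2 else 0)"
    unfolding sum_prod_bits[where h = "\<lambda>t j. cnj (pauli1 (a t) (bitof t i) j) * pauli1 (b t) (bitof t i) j" for i]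
      sum_prod_bits[where h = "\<lambda>t i. cnj (pauli1 (a t) i 0) * pauli1 (b t) i 0 + cnj (pauli1 (a t) i 1) * pauli1 (b t) i 1"]
    using assms by (intro prod.cong refl pauli1_orthogonal pstringsD[where q = q]) auto
  also have "\<dots> = (if a = b then 2 ^ q else 0)"
  proof (cases "a = b")
    case False
    then obtain t where "a t \<noteq> b t" by auto
    then have "t < q" using assms by (cases "t < q") (auto simp: pstrings_def)
    with \<open>a t \<noteq> b t\<close> show ?thesis using False by (auto intro!: prod_zero)
  qed simp
  finally show ?thesis .
qed

lemma pmat_complete:
  assumes "i < 2 ^ q" "j < 2 ^ q" "k < 2 ^ q" "l < 2 ^ q"
  shows "(\<Sum>a\<in>pstrings q. pmat q a i j * cnj (pmat q a k l)) = (if i = k \<and> j = l then 2 ^ q else 0)"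
proof -
  have "(\<Sum>a\<in>pstrings q. pmat q a i j * cnj (pmat q a k l)) =
    (\<Sum>a\<in>pstrings q. \<Prod>t<q. pauli1 (a t) (bitof t i) (bitof t j) * cnj (pauli1 (a t) (bitof t k) (bitof t l)))"
    unfolding pmat_def using assms by (simp add: prod.distrib)
  also have "\<dots> = (\<Prod>t<q. if bitof t i = bitof t k \<and> bitof t j = bitof t l then 2 else 0)"
    unfolding sum_prod_pstrings[where h = "\<lambda>t a. pauli1 a (bitof t i) (bitof t j) * cnj (pauli1 a (bitof t k) (bitof t l))"]
    by (intro prod.cong refl pauli1_complete bitof_less)
  also have "\<dots> = (if i = k \<and> j = l then 2 ^ q else 0)"
  proof (cases "i = k \<and> j = l")
    case False
    then obtain t where "t < q" "\<not> (bitof t i = bitof t k \<and> bitof t j = bitof t l)"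
      using bitof_eqI assms by metis
    then show ?thesis using False by (auto intro!: prod_zero)
  qed simp
  finally show ?thesis .
qed

lemma madj_pmat: "a \<in> pstrings q \<Longrightarrow> madj (pmat q a) = pmat q a"
  unfolding madj_def pmat_def by (intro ext) (auto simp: pauli1_adj bitof_less pstringsD intro!: prod.cong)

definition msum :: "cmat \<Rightarrow> cmat \<Rightarrow> cmat" where "msum A B = (\<lambda>i j. A i j + B i j)"

lemma mmult_assoc: "mmult q (mmult q A B) C = mmult q A (mmult q B C)"
  unfolding mmult_def
  by (intro ext) (simp add: sum_distrib_left sum_distrib_right mult.assoc, rule sum.swap)

lemma mmult_linear:
  "mmult q (msc c A) B = msc c (mmult q A B)" "mmult q A (msc c B) = msc c (mmult q A B)"
  "mmult q (msum A A') B = msum (mmult q A B) (mmult q A' B)"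
  "mmult q A (msum B B') = msum (mmult q A B) (mmult q A B')"
  by (intro ext; simp add: mmult_def msc_def msum_def sum_distrib_left sum.distrib algebra_simps)+

lemma madj_simps:
  "madj (madj A) = A" "madj (msc c A) = msc (cnj c) (madj A)" "madj (msum A B) = msum (madj A) (madj B)"
  "madj (mmult q A B) = mmult q (madj B) (madj A)"
  by (intro ext; simp add: mmult_def msc_def msum_def madj_def mult.commute)+

lemma msc_simps: "msc c (msc c' A) = msc (c * c') A" "msc 1 A = A"
  "msc c (msum A B) = msum (msc c A) (msc c B)"
  by (intro ext; simp add: msc_def msum_def algebra_simps)+

definition supported :: "nat \<Rightarrow> cmat \<Rightarrow> bool" where
  "supported q A \<longleftrightarrow> (\<forall>i j. 2 ^ q \<le> i \<or> 2 ^ q \<le> j \<longrightarrow> A i j = 0)"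

lemma idm_apply: "idm q i j = (if i = j \<and> i < 2 ^ q then 1 else 0)"
proof (cases "i < 2 ^ q \<and> j < 2 ^ q \<and> i \<noteq> j")
  case True
  then obtain t where "t < q" "bitof t i \<noteq> bitof t j" using bitof_eqI by metis
  then show ?thesis using True by (auto simp: idm_def pmat_def pauli1_def intro!: prod_zero)
qed (auto simp: idm_def pmat_def pauli1_def)

lemma mmult_idm:
  assumes "supported q A"
  shows "mmult q (idm q) A = A" "mmult q A (idm q) = A"
proof -
  have "mmult q (idm q) A i j = A i j \<and> mmult q A (idm q) i j = A i j" for i j
  proof -
    have "(\<Sum>k<2 ^ q. idm q i k * A k j) = (\<Sum>k<2 ^ q. if k = i then A k j else 0)"
      "(\<Sum>k<2 ^ q. A i k * idm q k j) = (\<Sum>k<2 ^ q. if k = j then A i k else 0)"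
      by (intro sum.cong refl; auto simp: idm_apply)+
    then show ?thesis using assms by (auto simp: mmult_def supported_def)
  qed
  then show "mmult q (idm q) A = A" "mmult q A (idm q) = A" by blast+
qed

lemma supported_simps: "supported q (pmat q a)" "supported q A \<Longrightarrow> supported q (msc c A)"
  "supported q A \<Longrightarrow> supported q B \<Longrightarrow> supported q (mmult q A B)"
  "supported q A \<Longrightarrow> supported q B \<Longrightarrow> supported q (msum A B)" "supported q A \<Longrightarrow> supported q (madj A)"
  by (auto simp: supported_def pmat_def msc_def mmult_def msum_def madj_def)

lemma pauli_grp_eq:
  assumes "q \<ge> 1"
  shows "pauli_grp q = {msc (\<i> ^ n) (pmat q s) | n s. s \<in> pstrings q}"
proof (intro equalityI subsetI)
  fix M assume "M \<in> pauli_grp q"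
  then obtain k s where "s \<in> pstrings q" and M: "M = (\<lambda>i j. if i < 2 ^ q \<and> j < 2 ^ q
             then (\<Prod>t<q. \<i> ^ (k t) * pauli1 (s t) (bitof t i) (bitof t j)) else 0)"
    unfolding pauli_grp_def by auto
  moreover have "M = msc (\<i> ^ (\<Sum>t<q. k t)) (pmat q s)"
    unfolding M by (auto simp: msc_def pmat_def prod.distrib power_sum intro!: ext)
  ultimately show "M \<in> {msc (\<i> ^ n) (pmat q s) | n s. s \<in> pstrings q}" by blast
next
  fix M assume "M \<in> {msc (\<i> ^ n) (pmat q s) | n s. s \<in> pstrings q}"
  then obtain n s where s: "s \<in> pstrings q" and M: "M = msc (\<i> ^ n) (pmat q s)" by auto
  \<comment> \<open>The global phase is put on the first tensor factor, which exists because
    \<open>q \<ge> 1\<close>.\<close>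
  define k where "k t = (if t = 0 then n else 0)" for t :: nat
  have "(\<Sum>t<q. k t) = n" using assms by (simp add: k_def sum.delta)
  then have "M = (\<lambda>i j. if i < 2 ^ q \<and> j < 2 ^ q
             then (\<Prod>t<q. \<i> ^ (k t) * pauli1 (s t) (bitof t i) (bitof t j)) else 0)"
    unfolding M by (auto simp: msc_def pmat_def prod.distrib simp flip: power_sum intro!: ext)
  then show "M \<in> pauli_grp q" unfolding pauli_grp_def using s by blast
qed

section \<open>Tensors and the Clifford action\<close>

lemma tens_sum_apply: "(\<Sum>x\<in>A. F x) i j k l = (\<Sum>x\<in>A. (F x :: ctens) i j k l)"
  by (induction A rule: infinite_finite_induct) simp_all

lemma tens_apply: "tens A B i j k l = A i j * B k l" by (simp add: tens_def)

lemma tsc_apply: "tsc c T i j k l = c * T i j k l" by (simp add: tsc_def)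

lemma tsc_simps: "tsc c (x + y) = tsc c x + tsc c y" "tsc (c + c') x = tsc c x + tsc c' x"
  "tsc c (tsc c' x) = tsc (c * c') x" "tsc 1 x = x" "tsc 0 x = 0" "tsc c 0 = 0"
  "tsc c (x - y) = tsc c x - tsc c y" "tsc (-1) x = - x"
  by (intro ext; simp add: tsc_def algebra_simps)+

lemma tsc_sum: "tsc c (sum F A) = (\<Sum>x\<in>A. tsc c (F x))"
  by (intro ext) (simp add: tsc_def tens_sum_apply sum_distrib_left)

lemma tens_msc: "tens (msc c A) (msc c' B) = tsc (c * c') (tens A B)"
  by (intro ext) (simp add: tens_def msc_def tsc_def)

lemma csubspace_diff: "csubspace W \<Longrightarrow> x \<in> W \<Longrightarrow> y \<in> W \<Longrightarrow> x - y \<in> W"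
  unfolding csubspace_def using tsc_simps(8)[of y] by (metis diff_conv_add_uminus)

lemma csubspace_sum: "csubspace W \<Longrightarrow> (\<And>x. x \<in> A \<Longrightarrow> F x \<in> W) \<Longrightarrow> sum F A \<in> W"
  by (induction A rule: infinite_finite_induct) (auto simp: csubspace_def)

lemma csubspace_cspan: "csubspace (cspan S)"
  unfolding csubspace_def
proof (intro conjI ballI allI)
  show "0 \<in> cspan S" unfolding cspan_def by (auto intro!: exI[of _ "{}"])
  show "tsc c x \<in> cspan S" if x: "x \<in> cspan S" for c x
  proof -
    obtain F d where F: "finite F" "F \<subseteq> S" "x = (\<Sum>v\<in>F. tsc (d v) v)" using x by (auto simp: cspan_def)
    then have "tsc c x = (\<Sum>v\<in>F. tsc (c * d v) v)" by (simp add: tsc_sum tsc_simps)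
    then show ?thesis using F unfolding cspan_def by (auto intro!: exI[of _ F] exI[of _ "\<lambda>v. c * d v"])
  qed
  show "x + y \<in> cspan S" if x: "x \<in> cspan S" and y: "y \<in> cspan S" for x y
  proof -
    obtain F d where F: "finite F" "F \<subseteq> S" "x = (\<Sum>v\<in>F. tsc (d v) v)" using x by (auto simp: cspan_def)
    obtain G e where G: "finite G" "G \<subseteq> S" "y = (\<Sum>v\<in>G. tsc (e v) v)" using y by (auto simp: cspan_def)
    have "x = (\<Sum>v\<in>F \<union> G. tsc (if v \<in> F then d v else 0) v)"
      unfolding F(3) by (intro sum.mono_neutral_cong_left) (use F G in \<open>auto simp: tsc_simps\<close>)
    moreover have "y = (\<Sum>v\<in>F \<union> G. tsc (if v \<in> G then e v else 0) v)"
      unfolding G(3) by (intro sum.mono_neutral_cong_left) (use F G in \<open>auto simp: tsc_simps\<close>)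
    ultimately have "x + y = (\<Sum>v\<in>F \<union> G. tsc ((if v \<in> F then d v else 0) + (if v \<in> G then e v else 0)) v)"
      by (simp only: sum.distrib tsc_simps)
    then show ?thesis unfolding cspan_def using F G by (intro CollectI exI[of _ "F \<union> G"] exI) auto
  qed
qed

lemma cspan_base: "x \<in> S \<Longrightarrow> x \<in> cspan S"
  unfolding cspan_def by (auto simp: tsc_simps intro!: exI[of _ "{x}"] exI[of _ "\<lambda>_. 1"])

lemma cspan_least: "csubspace W \<Longrightarrow> S \<subseteq> W \<Longrightarrow> cspan S \<subseteq> W"
  unfolding cspan_def by (auto intro!: csubspace_sum) (auto simp: csubspace_def)

lemma phi2_linear: "phi2 q U (x + y) = phi2 q U x + phi2 q U y" "phi2 q U (tsc c x) = tsc c (phi2 q U x)"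
  by (intro ext; simp add: phi2_def tsc_def sum_distrib_left sum.distrib algebra_simps)+

lemma phi2_sum: "phi2 q U (sum F A) = (\<Sum>x\<in>A. phi2 q U (F x))"
proof -
  have "phi2 q U 0 = 0" by (intro ext) (simp add: phi2_def)
  then show ?thesis by (induction A rule: infinite_finite_induct) (simp_all add: phi2_linear)
qed

definition mconj :: "nat \<Rightarrow> cmat \<Rightarrow> cmat \<Rightarrow> cmat" where
  "mconj q U A = mmult q (mmult q U A) (madj U)"

lemma phi2_tens: "phi2 q U (tens A B) = tens (mconj q U A) (mconj q U B)"
proof (intro ext)
  fix i j k l
  have mc: "mconj q U A i j = (\<Sum>a<2^q. \<Sum>b<2^q. U i a * cnj (U j b) * A a b)" for A i j
    unfolding mconj_def mmult_def madj_def sum_distrib_right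
    by (subst sum.swap) (intro sum.cong refl, simp add: mult_ac)
  have "phi2 q U (tens A B) i j k l =
      (\<Sum>a<2^q. \<Sum>b<2^q. U i a * cnj (U j b) * A a b * (\<Sum>c<2^q. \<Sum>e<2^q. U k c * cnj (U l e) * B c e))"
    unfolding phi2_def tens_def sum_distrib_left by (intro sum.cong refl) (simp add: mult_ac)
  then show "phi2 q U (tens A B) i j k l = tens (mconj q U A) (mconj q U B) i j k l"
    unfolding tens_def mc by (simp only: sum_distrib_right)
qed

lemma mconj_msc: "mconj q U (msc c A) = msc c (mconj q U A)"
  by (simp add: mconj_def mmult_linear)

lemma tinner_linear:
  "tinner q U (x + y) = tinner q U x + tinner q U y" "tinner q U (tsc c x) = c * tinner q U x"
  "tinner q (x + y) U = tinner q x U + tinner q y U" "tinner q (tsc c x) U = cnj c * tinner q x U"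
  "tinner q 0 U = 0" "tinner q U 0 = 0"
  by (simp_all add: tinner_def tsc_def sum_distrib_left sum.distrib algebra_simps)

lemma tinner_sum: "tinner q U (sum F A) = (\<Sum>x\<in>A. tinner q U (F x))"
  "tinner q (sum F A) U = (\<Sum>x\<in>A. tinner q (F x) U)"
  by (induction A rule: infinite_finite_induct) (simp_all add: tinner_linear)

lemma tinner_tens:
  "tinner q (tens A B) (tens A' B') =
     (\<Sum>i<2^q. \<Sum>j<2^q. cnj (A i j) * A' i j) * (\<Sum>k<2^q. \<Sum>l<2^q. cnj (B k l) * B' k l)"
  unfolding tinner_def tens_def sum_distrib_right
  unfolding sum_distrib_left
  by (intro sum.cong refl) (simp add: mult_ac)

lemma Tspace_csubspace: "csubspace (Tspace q)"
  by (auto simp: csubspace_def Tspace_def tsc_def)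

text \<open>The zero string is included and gives \<open>sigma0\<close>; the nonzero strings give
  \<open>sig\<close>.\<close>

definition sg :: "nat \<Rightarrow> (nat \<Rightarrow> nat) \<Rightarrow> cmat" where
  "sg q a = msc (of_real (1 / sqrt (2 ^ q))) (pmat q a)"

lemma sqrt_sq: "complex_of_real (1 / sqrt (2 ^ q)) * complex_of_real (1 / sqrt (2 ^ q)) = 1 / 2 ^ q"
proof -
  have "1 / sqrt (2 ^ q) * (1 / sqrt (2 ^ q)) = 1 / (2 :: real) ^ q" by simp
  then show ?thesis unfolding of_real_mult[symmetric] by simp
qed

lemma sg_orthonormal:
  assumes "a \<in> pstrings q" "b \<in> pstrings q"
  shows "(\<Sum>i<2 ^ q. \<Sum>j<2 ^ q. cnj (sg q a i j) * sg q b i j) = of_bool (a = b)"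
proof -
  have "(\<Sum>i<2 ^ q. \<Sum>j<2 ^ q. cnj (sg q a i j) * sg q b i j) =
     (1 / 2 ^ q) * (\<Sum>i<2 ^ q. \<Sum>j<2 ^ q. cnj (pmat q a i j) * pmat q b i j)"
    unfolding sqrt_sq[symmetric] sum_distrib_left sg_def msc_def by (intro sum.cong refl) simp
  then show ?thesis using pmat_orthogonal[OF assms] by simp
qed

lemma sg_complete:
  assumes "i < 2 ^ q" "j < 2 ^ q" "k < 2 ^ q" "l < 2 ^ q"
  shows "(\<Sum>a\<in>pstrings q. sg q a i j * cnj (sg q a k l)) = of_bool (i = k \<and> j = l)"
proof -
  have "(\<Sum>a\<in>pstrings q. sg q a i j * cnj (sg q a k l)) =
     (1 / 2 ^ q) * (\<Sum>a\<in>pstrings q. pmat q a i j * cnj (pmat q a k l))"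
    unfolding sqrt_sq[symmetric] sum_distrib_left sg_def msc_def by (intro sum.cong refl) simp
  then show ?thesis using pmat_complete[OF assms] by simp
qed

text \<open>The completeness relation, applied in both tensor factors, collapses the sum over the
  four matrix indices hidden in \<open>tinner\<close>.\<close>

lemma sg_expansion:
  assumes T: "T \<in> Tspace q"
  shows "T = (\<Sum>a\<in>pstrings q. \<Sum>b\<in>pstrings q. tsc (tinner q (tens (sg q a) (sg q b)) T) (tens (sg q a) (sg q b)))"
proof (intro ext)
  fix i j k l
  define I where "I = {..<2 ^ q :: nat} \<times> {..<2 ^ q :: nat} \<times> {..<2 ^ q :: nat} \<times> {..<2 ^ q :: nat}"
  have supp: "sg q a i j = 0" if "\<not> (i < 2 ^ q \<and> j < 2 ^ q)" for a i j
    using that by (auto simp: sg_def msc_def pmat_def)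
  show "T i j k l = (\<Sum>a\<in>pstrings q. \<Sum>b\<in>pstrings q. tsc (tinner q (tens (sg q a) (sg q b)) T) (tens (sg q a) (sg q b))) i j k l"
  proof (cases "i < 2 ^ q \<and> j < 2 ^ q \<and> k < 2 ^ q \<and> l < 2 ^ q")
    case False
    then have z: "sg q a i j * sg q b k l = 0" for a b using supp by auto
    moreover have "2 ^ q \<le> i \<or> 2 ^ q \<le> j \<or> 2 ^ q \<le> k \<or> 2 ^ q \<le> l" using False by auto
    then have "T i j k l = 0" using T unfolding Tspace_def by blast
    ultimately show ?thesis unfolding tens_sum_apply tsc_apply tens_apply z by simp
  next
    case True
    have tin: "tinner q (tens (sg q a) (sg q b)) T =
        (\<Sum>(i', j', k', l')\<in>I. cnj (sg q a i' j') * cnj (sg q b k' l') * T i' j' k' l')" for a b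
      by (simp add: tinner_def I_def tens_apply sum.cartesian_product split_def)
    have "(\<Sum>a\<in>pstrings q. \<Sum>b\<in>pstrings q. tsc (tinner q (tens (sg q a) (sg q b)) T) (tens (sg q a) (sg q b))) i j k l =
      (\<Sum>a\<in>pstrings q. \<Sum>b\<in>pstrings q. \<Sum>(i', j', k', l')\<in>I.
        T i' j' k' l' * ((sg q a i j * cnj (sg q a i' j')) * (sg q b k l * cnj (sg q b k' l'))))"
      unfolding tens_sum_apply tsc_apply tens_apply tin sum_distrib_right
      by (intro sum.cong refl) (auto simp: mult_ac)
    also have "\<dots> = (\<Sum>a\<in>pstrings q. \<Sum>(i', j', k', l')\<in>I. \<Sum>b\<in>pstrings q.
        T i' j' k' l' * ((sg q a i j * cnj (sg q a i' j')) * (sg q b k l * cnj (sg q b k' l'))))"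
      unfolding split_def by (intro sum.cong refl sum.swap)
    also have "\<dots> = (\<Sum>(i', j', k', l')\<in>I. \<Sum>a\<in>pstrings q. \<Sum>b\<in>pstrings q.
        T i' j' k' l' * ((sg q a i j * cnj (sg q a i' j')) * (sg q b k l * cnj (sg q b k' l'))))"
      unfolding split_def by (rule sum.swap)
    also have "\<dots> = (\<Sum>(i', j', k', l')\<in>I. T i' j' k' l' *
        ((\<Sum>a\<in>pstrings q. sg q a i j * cnj (sg q a i' j')) * (\<Sum>b\<in>pstrings q. sg q b k l * cnj (sg q b k' l'))))"
      unfolding sum_product unfolding sum_distrib_left by (rule refl)
    also have "\<dots> = (\<Sum>p\<in>I. if p = (i, j, k, l) then T i j k l else 0)"
      using True by (intro sum.cong refl) (auto simp: I_def sg_complete)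
    also have "\<dots> = T i j k l" using True by (simp add: I_def)
    finally show ?thesis by simp
  qed
qed

text \<open>The inner product with \<open>pmat q a\<close> reads off the coefficient.\<close>

lemma pmat_msc_inj:
  assumes "a \<in> pstrings q" "b \<in> pstrings q" "c \<noteq> 0" "msc c (pmat q a) = msc c' (pmat q b)"
  shows "a = b" "c = c'"
proof -
  have "(\<Sum>i<2 ^ q. \<Sum>j<2 ^ q. cnj (pmat q a i j) * msc c (pmat q a) i j) = c * 2 ^ q"
    "(\<Sum>i<2 ^ q. \<Sum>j<2 ^ q. cnj (pmat q a i j) * msc c' (pmat q b) i j) = c' * (if a = b then 2 ^ q else 0)"
    using pmat_orthogonal[OF assms(1,1)] pmat_orthogonal[OF assms(1,2)]
    by (simp_all add: msc_def mult.left_commute[of _ c] mult.left_commute[of _ c'] flip: sum_distrib_left)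
  then have "c * 2 ^ q = c' * (if a = b then 2 ^ q else 0)" using assms(4) by simp
  then show "a = b" "c = c'" using assms(3) by (auto split: if_splits)
qed

lemma i_power_cases: "\<i> ^ n \<in> {1, \<i>, -1, -\<i>}"
  by (induction n) auto

lemma mconj_mult:
  assumes "unitary_mat q U" "supported q A" "supported q B"
  shows "mconj q U (mmult q A B) = mmult q (mconj q U A) (mconj q U B)"
proof -
  have "mmult q (mconj q U A) (mconj q U B) =
      mmult q U (mmult q A (mmult q (mmult q (madj U) U) (mmult q B (madj U))))"
    by (simp add: mconj_def mmult_assoc)
  also have "mmult q (madj U) U = idm q" using assms by (simp add: unitary_mat_def)
  also have "mmult q (idm q) (mmult q B (madj U)) = mmult q B (madj U)"
    using assms by (intro mmult_idm supported_simps) (auto simp: unitary_mat_def supported_def)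
  finally show ?thesis by (simp add: mconj_def mmult_assoc)
qed

lemma mconj_inverse:
  assumes "unitary_mat q U" "supported q A"
  shows "mconj q (madj U) (mconj q U A) = A"
proof -
  have "mconj q (madj U) (mconj q U A) = mmult q (mmult q (madj U) U) (mmult q A (mmult q (madj U) U))"
    by (simp add: mconj_def mmult_assoc madj_simps)
  then show ?thesis using assms by (simp add: unitary_mat_def mmult_idm)
qed

lemma madj_mconj: "madj (mconj q U A) = mconj q U (madj A)"
  by (simp add: mconj_def madj_simps mmult_assoc)

lemma (in sign_form) cyclicD:
  assumes "cyclic \<Phi>" "\<tau> \<in> V" "\<Phi> \<tau> f" "a \<in> V" "f a \<noteq> 0" "transv_closed \<tau> Q" "Q f" "\<Phi> \<tau> g"
  shows "Q g"
  using assms unfolding cyclic_def by blast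

locale qubits =
  fixes q :: nat
  assumes q_ge: "q \<ge> 1"
begin

sublocale sign_form "pstrings q" "(\<boxplus>)" "\<lambda>_. 0" "comm_sign q" "2 ^ q"
  by (rule sign_form_pauli[OF q_ge])

abbreviation "V \<equiv> pstrings q"

text \<open>Conjugation respects adjoints and products. Adjoints restrict the phase of an image to a
  sign; products make \<open>g\<close> additive and give the cocycle identity for \<open>s\<close>,
  from which \<open>comm_sign\<close> is seen to be preserved.\<close>

lemma clifford_action:
  assumes U: "U \<in> clifford q"
  shows "\<exists>g s. form_aut g \<and> (\<forall>a\<in>V. (s a = 1 \<or> s a = -1) \<and> mconj q U (pmat q a) = msc (s a) (pmat q (g a))) \<and>
    (\<forall>a\<in>V. \<forall>b\<in>V. phase q a b * s (a \<boxplus> b) = s a * s b * phase q (g a) (g b))"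
proof -
  have un: "unitary_mat q U" using U by (simp add: clifford_def)
  have "\<exists>b s. b \<in> V \<and> (s = 1 \<or> s = -1) \<and> mconj q U (pmat q a) = msc s (pmat q b)" if a: "a \<in> V" for a
  proof -
    have "pmat q a \<in> pauli_grp q"
      unfolding pauli_grp_eq[OF q_ge] using a by (auto simp: msc_simps intro!: exI[of _ 0] exI[of _ a])
    then have "mconj q U (pmat q a) \<in> pauli_grp q" using U by (auto simp: clifford_def mconj_def)
    then obtain n b where b: "b \<in> V" "mconj q U (pmat q a) = msc (\<i> ^ n) (pmat q b)"
      unfolding pauli_grp_eq[OF q_ge] by auto
    \<comment> \<open>Pauli strings are Hermitian, hence so are their images, and the phase equals
      its conjugate.\<close>
    have "msc (\<i> ^ n) (pmat q b) = msc (cnj (\<i> ^ n)) (pmat q b)"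
      using madj_mconj[of q U "pmat q a"] a b by (simp add: madj_pmat madj_simps)
    then have "\<i> ^ n = cnj (\<i> ^ n)" using pmat_msc_inj(2)[OF b(1) b(1)] by fastforce
    then have "\<i> ^ n = 1 \<or> \<i> ^ n = -1" using i_power_cases[of n] by (auto simp del: complex_cnj_power)
    then show ?thesis using b by blast
  qed
  then obtain g s where gs: "\<And>a. a \<in> V \<Longrightarrow> g a \<in> V"
    "\<And>a. a \<in> V \<Longrightarrow> s a = 1 \<or> s a = -1" "\<And>a. a \<in> V \<Longrightarrow> mconj q U (pmat q a) = msc (s a) (pmat q (g a))"
    by metis
  have mult: "g (a \<boxplus> b) = g a \<boxplus> g b \<and> phase q a b * s (a \<boxplus> b) = s a * s b * phase q (g a) (g b)"
    if a: "a \<in> V" and b: "b \<in> V" for a b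
  proof -
    have "msc (phase q a b * s (a \<boxplus> b)) (pmat q (g (a \<boxplus> b))) = mconj q U (mmult q (pmat q a) (pmat q b))"
      using a b by (simp add: mmult_pmat mconj_msc gs msc_simps)
    also have "\<dots> = msc (s a * s b * phase q (g a) (g b)) (pmat q (g a \<boxplus> g b))"
      by (simp only: mconj_mult[OF un supported_simps(1) supported_simps(1)] gs(3)[OF a] gs(3)[OF b]
        mmult_linear mmult_pmat[OF gs(1)[OF a] gs(1)[OF b]] msc_simps mult_ac)
    finally have "msc (phase q a b * s (a \<boxplus> b)) (pmat q (g (a \<boxplus> b))) =
      msc (s a * s b * phase q (g a) (g b)) (pmat q (g a \<boxplus> g b))" .
    moreover have "phase q a b * s (a \<boxplus> b) \<noteq> 0"
      using gs(2)[of "a \<boxplus> b"] phase_simps(5)[of q a b] a b by auto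
    ultimately show ?thesis using pmat_msc_inj[of "g (a \<boxplus> b)" q "g a \<boxplus> g b"] gs(1) a b add_V by metis
  qed
  have eps: "comm_sign q (g a) (g b) = comm_sign q a b" if a: "a \<in> V" and b: "b \<in> V" for a b
  proof -
    \<comment> \<open>Squaring the cocycle identity removes the unknown signs and turns each phase
      into \<open>comm_sign\<close>.\<close>
    have "(phase q a b * s (a \<boxplus> b)) * (phase q a b * s (a \<boxplus> b)) =
        (s a * s b * phase q (g a) (g b)) * (s a * s b * phase q (g a) (g b))"
      using mult[OF a b] by simp
    moreover have "s x * s x = 1" if "x \<in> V" for x using gs(2)[OF that] by auto
    ultimately show ?thesis
      using a b phase_simps(1)[OF a b] phase_simps(1)[OF gs(1)[OF a] gs(1)[OF b]] add_V[OF a b]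
      by (metis (no_types, opaque_lifting) mult.assoc mult.left_commute mult.right_neutral)
  qed
  have inj: "inj_on g V"
  proof (rule inj_onI)
    fix a b assume ab: "a \<in> V" "b \<in> V" "g a = g b"
    \<comment> \<open>If \<open>g\<close> identifies \<open>a\<close> and \<open>b\<close>, the
      string \<open>a \<boxplus> b\<close> is conjugated to a scalar matrix and therefore is
      one.\<close>
    then have "mconj q U (pmat q (a \<boxplus> b)) = msc (s (a \<boxplus> b)) (idm q)"
      using mult[of a b] gs(3)[of "a \<boxplus> b"] by (simp add: idm_def)
    then have "pmat q (a \<boxplus> b) = msc (s (a \<boxplus> b)) (mconj q (madj U) (idm q))"
      using mconj_inverse[OF un, of "pmat q (a \<boxplus> b)"] by (simp add: supported_simps mconj_msc)
    also have "mconj q (madj U) (idm q) = idm q"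
    proof -
      have "supported q (madj U)" "mmult q (madj U) U = idm q"
        using un by (auto simp: unitary_mat_def supported_def madj_def)
      then show ?thesis by (simp add: mconj_def madj_simps mmult_idm)
    qed
    finally have "msc 1 (pmat q (a \<boxplus> b)) = msc (s (a \<boxplus> b)) (pmat q (\<lambda>_. 0))"
      by (simp add: msc_simps idm_def)
    then have "a \<boxplus> b = (\<lambda>_. 0)" using pmat_msc_inj(1)[of "a \<boxplus> b" q "\<lambda>_. 0" 1] ab by simp
    then show "a = b" by simp
  qed
  then have "bij_betw g V V"
    using endo_inj_surj[OF finite_V _ inj] gs(1) by (auto simp: bij_betw_def)
  then have "form_aut g" using mult eps by (simp add: form_aut_def)
  then show ?thesis using gs mult by blast
qed

text \<open>The factor \<open>phase q a \<tau>\<close> turns the second matrix into the normalized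
  product of \<open>sg q a\<close> and \<open>sg q \<tau>\<close>; it is what removes the signs
  depending on \<open>a\<close> from the Clifford action.\<close>

definition syn :: "(nat \<Rightarrow> nat) \<Rightarrow> ((nat \<Rightarrow> nat) \<Rightarrow> complex) \<Rightarrow> ctens" where
  "syn \<tau> f = (\<Sum>a\<in>V. tsc (f a * phase q a \<tau>) (tens (sg q a) (sg q (a \<boxplus> \<tau>))))"

text \<open>The coordinates belonging to \<open>syn\<close>; the conjugate inverts the phase, which
  has modulus 1.\<close>

definition fc :: "ctens \<Rightarrow> (nat \<Rightarrow> nat) \<Rightarrow> (nat \<Rightarrow> nat) \<Rightarrow> complex" where
  "fc T \<tau> a = (if a \<in> V then cnj (phase q a \<tau>) * tinner q (tens (sg q a) (sg q (a \<boxplus> \<tau>))) T else 0)"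

lemma syn_cong: "(\<And>a. a \<in> V \<Longrightarrow> f a = g a) \<Longrightarrow> syn \<tau> f = syn \<tau> g"
  by (simp add: syn_def)

lemma syn_add: "syn \<tau> (\<lambda>x. f x + g x) = syn \<tau> f + syn \<tau> g"
  by (simp add: syn_def distrib_right tsc_simps sum.distrib)

lemma syn_scale: "syn \<tau> (\<lambda>x. k * f x) = tsc k (syn \<tau> f)"
  by (simp add: syn_def tsc_sum tsc_simps mult.assoc)

lemma syn_zero: "syn \<tau> (\<lambda>_. 0) = 0"
  by (simp add: syn_def tsc_simps)

lemma syn_sum: "syn \<tau> (\<lambda>x. \<Sum>i\<in>I. F i x) = (\<Sum>i\<in>I. syn \<tau> (F i))"
  by (induction I rule: infinite_finite_induct) (simp_all add: syn_zero syn_add)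

lemma fc_linear: "fc (x + y) \<tau> = (\<lambda>a. fc x \<tau> a + fc y \<tau> a)" "fc (tsc c x) \<tau> = (\<lambda>a. c * fc x \<tau> a)"
  "fc 0 \<tau> = (\<lambda>_. 0)"
  by (auto simp: fc_def tinner_linear algebra_simps)

lemma fc_sum: "fc (sum F A) \<tau> a = (\<Sum>x\<in>A. fc (F x) \<tau> a)"
  by (simp add: fc_def tinner_sum sum_distrib_left)

lemma tens_Tspace: "tens (sg q a) (sg q b) \<in> Tspace q"
  by (auto simp: Tspace_def tens_def sg_def msc_def pmat_def)

lemma syn_Tspace: "syn \<tau> f \<in> Tspace q"
  unfolding syn_def using Tspace_csubspace tens_Tspace
  by (intro csubspace_sum) (auto simp: csubspace_def)

lemma fc_syn:
  assumes "\<tau> \<in> V" "\<tau>' \<in> V" "a \<in> V"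
  shows "fc (syn \<tau>' f) \<tau> a = (if \<tau> = \<tau>' then f a else 0)"
proof -
  have "tinner q (tens (sg q a) (sg q (a \<boxplus> \<tau>))) (syn \<tau>' f) =
      (\<Sum>b\<in>V. f b * phase q b \<tau>' * (of_bool (a = b) * of_bool (a \<boxplus> \<tau> = b \<boxplus> \<tau>')))"
    unfolding syn_def tinner_sum tinner_linear tinner_tens
    using assms by (intro sum.cong refl) (simp add: sg_orthonormal)
  also have "\<dots> = (\<Sum>b\<in>V. if b = a then f a * phase q a \<tau>' * of_bool (\<tau> = \<tau>') else 0)"
    by (intro sum.cong refl) auto
  also have "\<dots> = f a * phase q a \<tau>' * of_bool (\<tau> = \<tau>')" using assms by (simp add: finite_V)
  finally have "fc (syn \<tau>' f) \<tau> a = f a * (cnj (phase q a \<tau>) * phase q a \<tau>') * of_bool (\<tau> = \<tau>')"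
    using assms by (simp add: fc_def)
  then show ?thesis by (simp add: phase_simps)
qed

lemma fc_sum_syn:
  assumes "\<tau> \<in> V" "a \<in> V"
  shows "fc (\<Sum>\<tau>\<in>V. syn \<tau> (F \<tau>)) \<tau> a = F \<tau> a"
proof -
  have "fc (\<Sum>\<tau>\<in>V. syn \<tau> (F \<tau>)) \<tau> a = (\<Sum>\<tau>'\<in>V. if \<tau> = \<tau>' then F \<tau>' a else 0)"
    unfolding fc_sum using assms by (intro sum.cong refl) (simp add: fc_syn)
  then show ?thesis using assms by (simp add: finite_V)
qed

lemma sum_syn_fc:
  assumes "T \<in> Tspace q"
  shows "(\<Sum>\<tau>\<in>V. syn \<tau> (fc T \<tau>)) = T"
proof -
  have "fc T \<tau> a * phase q a \<tau> = tinner q (tens (sg q a) (sg q (a \<boxplus> \<tau>))) T" if "a \<in> V" for a \<tau>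
  proof -
    have "fc T \<tau> a * phase q a \<tau> = (cnj (phase q a \<tau>) * phase q a \<tau>) * tinner q (tens (sg q a) (sg q (a \<boxplus> \<tau>))) T"
      using that by (simp add: fc_def)
    then show ?thesis unfolding phase_simps(5) by simp
  qed
  then have "syn \<tau> (fc T \<tau>) = (\<Sum>a\<in>V. tsc (tinner q (tens (sg q a) (sg q (a \<boxplus> \<tau>))) T) (tens (sg q a) (sg q (a \<boxplus> \<tau>))))" for \<tau>
    by (simp add: syn_def)
  then have "(\<Sum>\<tau>\<in>V. syn \<tau> (fc T \<tau>)) = (\<Sum>\<tau>\<in>V. \<Sum>a\<in>V.
      tsc (tinner q (tens (sg q a) (sg q (a \<boxplus> \<tau>))) T) (tens (sg q a) (sg q (a \<boxplus> \<tau>))))" by simp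
  also have "\<dots> = (\<Sum>a\<in>V. \<Sum>\<tau>\<in>V.
      tsc (tinner q (tens (sg q a) (sg q (a \<boxplus> \<tau>))) T) (tens (sg q a) (sg q (a \<boxplus> \<tau>))))"
    by (rule sum.swap)
  also have "\<dots> = (\<Sum>a\<in>V. \<Sum>b\<in>V. tsc (tinner q (tens (sg q a) (sg q b)) T) (tens (sg q a) (sg q b)))"
  proof (rule sum.cong[OF refl])
    fix a assume "a \<in> V"
    from sum_shift[OF this, of "\<lambda>b. tsc (tinner q (tens (sg q a) (sg q b)) T) (tens (sg q a) (sg q b))"]
    show "(\<Sum>\<tau>\<in>V. tsc (tinner q (tens (sg q a) (sg q (a \<boxplus> \<tau>))) T) (tens (sg q a) (sg q (a \<boxplus> \<tau>)))) =
      (\<Sum>b\<in>V. tsc (tinner q (tens (sg q a) (sg q b)) T) (tens (sg q a) (sg q b)))"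
      by (simp only: string_add_simps(2)[of _ a])
  qed
  finally show ?thesis using sg_expansion[OF assms] by simp
qed

lemma fc_eqI:
  assumes "S \<in> Tspace q" "T \<in> Tspace q" "\<And>\<tau> a. \<tau> \<in> V \<Longrightarrow> a \<in> V \<Longrightarrow> fc S \<tau> a = fc T \<tau> a"
  shows "S = T"
proof -
  have "(\<Sum>\<tau>\<in>V. syn \<tau> (fc S \<tau>)) = (\<Sum>\<tau>\<in>V. syn \<tau> (fc T \<tau>))"
    using assms(3) by (intro sum.cong refl syn_cong) auto
  then show ?thesis using assms sum_syn_fc by simp
qed

text \<open>By \<open>ph\<close> at \<open>a\<close> and \<tau>,
  \<open>phase q a \<tau> * s (a \<boxplus> \<tau>)\<close> becomes \<open>s a * s \<tau>\<close>
  times the new phase, and the two factors \<open>s a\<close> cancel.\<close>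

lemma phi2_syn:
  assumes g: "form_aut g" and s: "\<And>a. a \<in> V \<Longrightarrow> s a = 1 \<or> s a = -1"
    and U: "\<And>a. a \<in> V \<Longrightarrow> mconj q U (pmat q a) = msc (s a) (pmat q (g a))"
    and ph: "\<And>a b. a \<in> V \<Longrightarrow> b \<in> V \<Longrightarrow> phase q a b * s (a \<boxplus> b) = s a * s b * phase q (g a) (g b)"
    and \<tau>: "\<tau> \<in> V" and f': "\<And>a. a \<in> V \<Longrightarrow> f' (g a) = s \<tau> * f a"
  shows "phi2 q U (syn \<tau> f) = syn (g \<tau>) f'"
proof -
  have sgU: "mconj q U (sg q a) = msc (s a) (sg q (g a))" if "a \<in> V" for a
    using that by (simp add: sg_def mconj_msc U msc_simps mult.commute)
  have "phi2 q U (syn \<tau> f) = (\<Sum>a\<in>V. tsc (f a * phase q a \<tau>) (tens (mconj q U (sg q a)) (mconj q U (sg q (a \<boxplus> \<tau>)))))"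
    by (simp add: syn_def phi2_sum phi2_linear phi2_tens)
  also have "\<dots> = (\<Sum>a\<in>V. tsc (f' (g a) * phase q (g a) (g \<tau>)) (tens (sg q (g a)) (sg q (g a \<boxplus> g \<tau>))))"
  proof (intro sum.cong refl)
    fix a assume a: "a \<in> V"
    have "f a * phase q a \<tau> * (s a * s (a \<boxplus> \<tau>)) = f a * s a * (phase q a \<tau> * s (a \<boxplus> \<tau>))" by simp
    also have "\<dots> = (s a * s a) * (s \<tau> * f a) * phase q (g a) (g \<tau>)"
      using ph[OF a \<tau>] by simp
    also have "s a * s a = 1" using s[OF a] by auto
    finally have eq: "f a * phase q a \<tau> * (s a * s (a \<boxplus> \<tau>)) = f' (g a) * phase q (g a) (g \<tau>)"
      by (simp add: f'[OF a])
    show "tsc (f a * phase q a \<tau>) (tens (mconj q U (sg q a)) (mconj q U (sg q (a \<boxplus> \<tau>)))) =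
        tsc (f' (g a) * phase q (g a) (g \<tau>)) (tens (sg q (g a)) (sg q (g a \<boxplus> g \<tau>)))"
      unfolding eq[symmetric] sgU[OF a] sgU[OF add_V[OF a \<tau>]] tens_msc tsc_simps(3) form_autD(3)[OF g a \<tau>] ..
  qed
  also have "\<dots> = syn (g \<tau>) f'"
    unfolding syn_def by (rule sum.reindex_bij_betw[OF form_autD(1)[OF g]])
  finally show ?thesis .
qed

text \<open>\<Phi> is imposed at all weights; a family with a fixed orbit type thereby forces the
  components of the other weights to vanish.\<close>

definition Wsp :: "((nat \<Rightarrow> nat) \<Rightarrow> ((nat \<Rightarrow> nat) \<Rightarrow> complex) \<Rightarrow> bool) \<Rightarrow> ctens set" where
  "Wsp \<Phi> = {T \<in> Tspace q. \<forall>\<tau>\<in>V. \<Phi> \<tau> (fc T \<tau>)}"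

lemma Wsp_sum_syn:
  assumes "admissible \<Phi>" "\<And>\<tau>. \<tau> \<in> V \<Longrightarrow> \<Phi> \<tau> (F \<tau>)"
  shows "(\<Sum>\<tau>\<in>V. syn \<tau> (F \<tau>)) \<in> Wsp \<Phi>"
proof -
  have "\<Phi> \<tau> (fc (\<Sum>\<tau>\<in>V. syn \<tau> (F \<tau>)) \<tau>)" if \<tau>: "\<tau> \<in> V" for \<tau>
  proof (rule admissibleD(4)[OF assms(1) \<tau>])
    show "\<Phi> \<tau> (F \<tau>)" by (rule assms(2)[OF \<tau>])
    show "a \<in> V \<Longrightarrow> F \<tau> a = fc (\<Sum>\<tau>\<in>V. syn \<tau> (F \<tau>)) \<tau> a" for a
      by (rule fc_sum_syn[OF \<tau>, symmetric])
  qed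
  moreover have "(\<Sum>\<tau>\<in>V. syn \<tau> (F \<tau>)) \<in> Tspace q"
    by (rule csubspace_sum[OF Tspace_csubspace syn_Tspace])
  ultimately show ?thesis by (simp add: Wsp_def)
qed

lemma csubspace_Wsp: "admissible \<Phi> \<Longrightarrow> csubspace (Wsp \<Phi>)"
  unfolding csubspace_def
proof (intro conjI ballI allI)
  assume adm: "admissible \<Phi>"
  note T = Tspace_csubspace[of q, unfolded csubspace_def]
  show "0 \<in> Wsp \<Phi>" using T by (simp add: Wsp_def fc_linear admissibleD(1)[OF adm])
  show "x + y \<in> Wsp \<Phi>" if "x \<in> Wsp \<Phi>" "y \<in> Wsp \<Phi>" for x y
  proof -
    have "\<Phi> \<tau> (fc (x + y) \<tau>)" if "\<tau> \<in> V" for \<tau>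
      unfolding fc_linear using \<open>x \<in> Wsp \<Phi>\<close> \<open>y \<in> Wsp \<Phi>\<close> that
      by (intro admissibleD(2)[OF adm]) (auto simp: Wsp_def)
    then show ?thesis using T that by (simp add: Wsp_def)
  qed
  show "tsc c x \<in> Wsp \<Phi>" if "x \<in> Wsp \<Phi>" for c x
  proof -
    have "\<Phi> \<tau> (fc (tsc c x) \<tau>)" if "\<tau> \<in> V" for \<tau>
      unfolding fc_linear using \<open>x \<in> Wsp \<Phi>\<close> that
      by (intro admissibleD(3)[OF adm]) (auto simp: Wsp_def)
    then show ?thesis using T that by (simp add: Wsp_def)
  qed
qed

lemma syn_Wsp:
  assumes "admissible \<Phi>" "\<tau> \<in> V" "\<Phi> \<tau> f"
  shows "syn \<tau> f \<in> Wsp \<Phi>"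
proof -
  have "(\<Sum>\<tau>'\<in>V. syn \<tau>' (if \<tau>' = \<tau> then f else (\<lambda>_. 0))) \<in> Wsp \<Phi>"
    using assms admissibleD(1)[OF assms(1)] by (intro Wsp_sum_syn) auto
  also have "(\<Sum>\<tau>'\<in>V. syn \<tau>' (if \<tau>' = \<tau> then f else (\<lambda>_. 0))) = (\<Sum>\<tau>'\<in>V. if \<tau>' = \<tau> then syn \<tau> f else 0)"
    by (intro sum.cong refl) (simp add: syn_zero)
  also have "\<dots> = syn \<tau> f" using assms by (simp add: finite_V)
  finally show ?thesis .
qed

lemma invariant_Wsp:
  assumes adm: "admissible \<Phi>"
  shows "invariant q (Wsp \<Phi>)"
  unfolding invariant_def
proof (intro ballI)
  fix U T assume U: "U \<in> clifford q" and T: "T \<in> Wsp \<Phi>"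
  obtain g s where gs: "form_aut g" "\<And>a. a \<in> V \<Longrightarrow> s a = 1 \<or> s a = -1"
    "\<And>a. a \<in> V \<Longrightarrow> mconj q U (pmat q a) = msc (s a) (pmat q (g a))"
    "\<And>a b. a \<in> V \<Longrightarrow> b \<in> V \<Longrightarrow> phase q a b * s (a \<boxplus> b) = s a * s b * phase q (g a) (g b)"
    using clifford_action[OF U] by blast
  define f' where "f' \<tau> x = s \<tau> * fc T \<tau> (inv_into V g x)" for \<tau> x
  have f': "f' \<tau> (g a) = s \<tau> * fc T \<tau> a" if "a \<in> V" for \<tau> a
    using that bij_betw_inv_into_left[OF form_autD(1)[OF gs(1)]] by (simp add: f'_def)
  have "phi2 q U T = (\<Sum>\<tau>\<in>V. phi2 q U (syn \<tau> (fc T \<tau>)))"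
    using sum_syn_fc[of T] T by (simp add: Wsp_def flip: phi2_sum)
  also have "\<dots> = (\<Sum>\<tau>\<in>V. syn (g \<tau>) (f' \<tau>))"
    by (rule sum.cong[OF refl], rule phi2_syn[OF gs]) (simp_all add: f')
  also have "\<dots> \<in> Wsp \<Phi>"
  proof (intro csubspace_sum csubspace_Wsp adm syn_Wsp)
    fix \<tau> assume \<tau>: "\<tau> \<in> V"
    show "g \<tau> \<in> V" using \<tau> form_autD(2)[OF gs(1)] by blast
    have "\<Phi> \<tau> (fc T \<tau>)" using T \<tau> by (simp add: Wsp_def)
    then show "\<Phi> (g \<tau>) (f' \<tau>)" by (rule admissibleD(5)[OF adm \<tau> gs(1), where k = "s \<tau>"]) (simp add: f')
  qed
  finally show "phi2 q U T \<in> Wsp \<Phi>" .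
qed

section \<open>Clifford unitaries acting as transvections\<close>

definition trU :: "(nat \<Rightarrow> nat) \<Rightarrow> cmat" where
  "trU v = msc (of_real (1 / sqrt 2)) (msum (idm q) (msc \<i> (pmat q v)))"

text \<open>For anticommuting \<open>v\<close> and \<open>a\<close> the phase squares to -1, so this
  scalar is a sign in both cases.\<close>

definition trs :: "(nat \<Rightarrow> nat) \<Rightarrow> (nat \<Rightarrow> nat) \<Rightarrow> complex" where
  "trs v a = (if comm_sign q v a = 1 then 1 else \<i> * phase q v a)"

lemma sqrt2_sq: "complex_of_real (1 / sqrt 2) * complex_of_real (1 / sqrt 2) = 1 / 2"
  by (simp flip: of_real_mult)

lemma madj_trU: "v \<in> V \<Longrightarrow> madj (trU v) = msc (of_real (1 / sqrt 2)) (msum (idm q) (msc (-\<i>) (pmat q v)))"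
  by (simp add: trU_def madj_simps madj_pmat idm_def pstrings_zero)

lemma pmat_sq: "v \<in> V \<Longrightarrow> mmult q (pmat q v) (pmat q v) = idm q"
  by (simp add: mmult_pmat phase_simps string_add_simps(3) msc_simps idm_def)

text \<open>The product \<open>(1 + i P) A (1 - i P) / 2\<close> is \<open>A\<close> if the two
  matrices commute and \<open>i P A\<close> if they anticommute.\<close>

lemma mconj_trU:
  assumes v: "v \<in> V" and a: "a \<in> V"
  shows "mconj q (trU v) (pmat q a) = msc (trs v a) (pmat q (transv v a))"
proof -
  define P A X where "P = pmat q v" and "A = pmat q a" and "X = mmult q P A"
  define e where "e = comm_sign q v a"
  have AP: "mmult q A P = msc e X"
    using assms by (simp add: A_def P_def X_def e_def mmult_pmat msc_simps phase_simps(2)[OF v a] string_add_simps(2)[of a v])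
  have PX: "mmult q P X = A"
    using assms by (simp add: X_def P_def A_def pmat_sq mmult_idm supported_simps flip: mmult_assoc)
  have idmP: "supported q (idm q)" "mmult q (idm q) A = A" "mmult q (idm q) X = X" "mmult q A (idm q) = A" "mmult q X (idm q) = X"
    by (simp_all add: mmult_idm supported_simps A_def X_def P_def) (simp add: idm_def supported_simps)
  have XP: "mmult q X P = msc e A" by (simp add: X_def mmult_assoc AP mmult_linear PX[unfolded X_def])
  have "mconj q (trU v) A = msc (1 / 2) (mmult q (mmult q (msum (idm q) (msc \<i> P)) A) (msum (idm q) (msc (-\<i>) P)))"
    unfolding mconj_def madj_trU[OF v] unfolding trU_def mmult_linear(1,2) msc_simps(1) sqrt2_sq P_def ..
  also have "\<dots> = msc (1 / 2) (msum (msum A (msc \<i> X)) (msc (-\<i>) (msum (msc e X) (msc (\<i> * e) A))))"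
    by (simp add: mmult_linear idmP AP XP msc_simps flip: X_def)
  also have "\<dots> = msc (trs v a) (pmat q (transv v a))"
  proof (cases "e = 1")
    case True
    then show ?thesis
      by (intro ext) (simp add: msc_def msum_def trs_def transv_def e_def[symmetric] A_def algebra_simps)
  next
    case False
    then have e: "e = -1" by (simp add: e_def)
    have "X = msc (phase q v a) (pmat q (a \<boxplus> v))"
      using assms by (simp add: X_def P_def A_def mmult_pmat string_add_simps(2)[of a v])
    then show ?thesis using e
      by (intro ext) (simp add: msc_def msum_def trs_def transv_def e_def[symmetric] algebra_simps)
  qed
  finally show ?thesis by (simp add: A_def)
qed

lemma trU_clifford:
  assumes v: "v \<in> V"
  shows "trU v \<in> clifford q"
proof -
  have supp: "supported q (trU v)" by (simp add: trU_def supported_simps idm_def)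
  define P where "P = pmat q v"
  have i: "mmult q (idm q) P = P" "mmult q P (idm q) = P" "mmult q (idm q) (idm q) = idm q" "mmult q P P = idm q"
  proof -
    have "supported q (idm q)" by (simp add: idm_def supported_simps)
    then show "mmult q (idm q) P = P" "mmult q P (idm q) = P" "mmult q (idm q) (idm q) = idm q"
      by (simp_all add: P_def mmult_idm supported_simps)
    show "mmult q P P = idm q" using v by (simp add: P_def pmat_sq)
  qed
  \<comment> \<open>Stated for a general square root \<open>x\<close> of -1, so that
    \<open>\<i>\<close> and \<open>-\<i>\<close> give both orders of the product.\<close>
  have key: "mmult q (msc r (msum (idm q) (msc x P))) (msc r (msum (idm q) (msc (- x) P))) = idm q"
    if x: "x * x = -1" and r: "r * r = 1 / 2" for x r
  proof (intro ext)
    fix k l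
    have "mmult q (msc r (msum (idm q) (msc x P))) (msc r (msum (idm q) (msc (- x) P))) k l =
        (r * r) * (idm q k l - (x * x) * idm q k l)"
      unfolding mmult_linear i by (simp add: msc_def msum_def algebra_simps)
    then show "mmult q (msc r (msum (idm q) (msc x P))) (msc r (msum (idm q) (msc (- x) P))) k l = idm q k l"
      by (simp only: x r) simp
  qed
  have "mmult q (trU v) (madj (trU v)) = idm q" "mmult q (madj (trU v)) (trU v) = idm q"
    unfolding madj_trU[OF v] unfolding trU_def P_def[symmetric]
    using key[OF _ sqrt2_sq, of \<i>] key[OF _ sqrt2_sq, of "-\<i>"] by (simp_all only: complex_i_mult_minus minus_mult_minus i_squared minus_minus)
  then have "unitary_mat q (trU v)" using supp by (simp add: unitary_mat_def supported_def)
  moreover have "mconj q (trU v) M \<in> pauli_grp q" if M: "M \<in> pauli_grp q" for M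
  proof -
    obtain n a where a: "a \<in> V" and M: "M = msc (\<i> ^ n) (pmat q a)" using M unfolding pauli_grp_eq[OF q_ge] by auto
    obtain m where m: "phase q v a = \<i> ^ m" using phase_power by blast
    have "\<exists>m. trs v a = \<i> ^ m"
    proof (cases "comm_sign q v a = 1")
      case True then show ?thesis by (intro exI[of _ 0]) (simp add: trs_def)
    next
      case False then show ?thesis by (intro exI[of _ "Suc m"]) (simp add: trs_def m)
    qed
    then obtain m where "trs v a = \<i> ^ m" by blast
    then have "mconj q (trU v) M = msc (\<i> ^ (n + m)) (pmat q (transv v a))"
      using v a by (simp add: M mconj_msc mconj_trU msc_simps power_add)
    then show ?thesis unfolding pauli_grp_eq[OF q_ge] using v a transv_V by blast
  qed
  ultimately show ?thesis by (simp add: clifford_def mconj_def)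
qed

text \<open>\<open>clifford_action\<close> only asserts that some \<open>g\<close> and
  \<open>s\<close> exist; comparison with the explicit conjugation identifies them as the
  transvection and \<open>trs\<close>.\<close>

lemma phi2_trU:
  assumes v: "v \<in> V" and \<tau>: "\<tau> \<in> V"
  shows "phi2 q (trU v) (syn \<tau> f) = syn (transv v \<tau>) (\<lambda>x. trs v \<tau> * f (transv v x))"
proof -
  obtain g s where gs: "form_aut g" "\<And>a. a \<in> V \<Longrightarrow> s a = 1 \<or> s a = -1"
    "\<And>a. a \<in> V \<Longrightarrow> mconj q (trU v) (pmat q a) = msc (s a) (pmat q (g a))"
    "\<And>a b. a \<in> V \<Longrightarrow> b \<in> V \<Longrightarrow> phase q a b * s (a \<boxplus> b) = s a * s b * phase q (g a) (g b)"
    using clifford_action[OF trU_clifford[OF v]] by blast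
  have eq: "g a = transv v a \<and> s a = trs v a" if a: "a \<in> V" for a
  proof -
    have "msc (s a) (pmat q (g a)) = msc (trs v a) (pmat q (transv v a))"
      using gs(3)[OF a] mconj_trU[OF v a] by simp
    moreover have "s a \<noteq> 0" using gs(2)[OF a] by auto
    ultimately show ?thesis
      using pmat_msc_inj[of "g a" q "transv v a"] form_autD(2)[OF gs(1) a] transv_V[OF v a] by blast
  qed
  have "phi2 q (trU v) (syn \<tau> f) = syn (g \<tau>) (\<lambda>x. trs v \<tau> * f (transv v x))"
    by (rule phi2_syn[OF gs \<tau>]) (use eq \<tau> in auto)
  then show ?thesis using eq[OF \<tau>] by simp
qed

lemma trs_nonzero: "a \<in> V \<Longrightarrow> v \<in> V \<Longrightarrow> trs v a \<noteq> 0"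
  using phase_simps(5)[of q v a] by (auto simp: trs_def)

text \<open>Reflects that \<open>trU v\<close> squares to \<open>i\<close> times the Pauli matrix of
  \<open>v\<close>, conjugation by which multiplies by \<open>comm_sign\<close>.\<close>

lemma trs_trs: "a \<in> V \<Longrightarrow> v \<in> V \<Longrightarrow> trs v a * trs v (transv v a) = comm_sign q v a"
proof -
  assume av: "a \<in> V" "v \<in> V"
  show ?thesis
  proof (cases "comm_sign q v a = 1")
    case True
    then show ?thesis by (simp add: trs_def transv_def)
  next
    case False
    then have "comm_sign q v a = -1" by simp
    moreover have "\<i> * phase q v a * (\<i> * phase q v (v \<boxplus> a)) = \<i> * \<i> * (phase q v a * phase q v (v \<boxplus> a))"
      by (simp only: mult_ac)
    ultimately show ?thesis using phase_simps(4)[OF av(2,1)]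
      by (simp add: trs_def transv_def eps_add string_add_simps(2)[of a v])
  qed
qed

text \<open>Applying \<open>trU v\<close> twice multiplies the component of weight \<tau> by
  \<open>comm_sign q v \<tau>\<close>. Summing over \<open>v\<close> against this character isolates
  one weight.\<close>

lemma weight_component:
  assumes W: "csubspace W" "invariant q W" "W \<subseteq> Tspace q" and T: "T \<in> W" and \<tau>: "\<tau> \<in> V"
  shows "syn \<tau> (fc T \<tau>) \<in> W"
proof -
  define S where "S v = phi2 q (trU v) (phi2 q (trU v) T)" for v
  have S: "S v = (\<Sum>\<tau>\<in>V. tsc (comm_sign q v \<tau>) (syn \<tau> (fc T \<tau>)))" if v: "v \<in> V" for v
  proof -
    have "S v = (\<Sum>\<tau>\<in>V. phi2 q (trU v) (phi2 q (trU v) (syn \<tau> (fc T \<tau>))))"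
      using sum_syn_fc[of T] T W by (auto simp: S_def simp flip: phi2_sum)
    also have "\<dots> = (\<Sum>\<tau>\<in>V. syn \<tau> (\<lambda>x. comm_sign q v \<tau> * fc T \<tau> x))"
    proof (intro sum.cong refl)
      fix \<tau> assume \<tau>: "\<tau> \<in> V"
      show "phi2 q (trU v) (phi2 q (trU v) (syn \<tau> (fc T \<tau>))) = syn \<tau> (\<lambda>x. comm_sign q v \<tau> * fc T \<tau> x)"
        using \<tau> v trs_trs[OF \<tau> v] by (simp add: phi2_trU mult.assoc[symmetric] mult.commute[of "trs v (transv v \<tau>)"])
    qed
    finally show ?thesis by (simp add: syn_scale)
  qed
  have SW: "S v \<in> W" if "v \<in> V" for v
    using W T trU_clifford[OF that] unfolding S_def invariant_def by blast
  have "(\<Sum>v\<in>V. tsc (comm_sign q v \<tau>) (S v)) = (\<Sum>v\<in>V. \<Sum>\<tau>'\<in>V. tsc (comm_sign q v (\<tau> \<boxplus> \<tau>')) (syn \<tau>' (fc T \<tau>')))"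
    by (intro sum.cong refl) (simp add: S tsc_sum tsc_simps eps_add)
  also have "\<dots> = (\<Sum>\<tau>'\<in>V. tsc (\<Sum>v\<in>V. comm_sign q v (\<tau> \<boxplus> \<tau>')) (syn \<tau>' (fc T \<tau>')))"
  proof (subst sum.swap, intro sum.cong refl)
    fix \<tau>'
    have "(\<Sum>v\<in>A. tsc (c v) x) = tsc (sum c A) x" for c x and A :: "(nat \<Rightarrow> nat) set"
      by (induction A rule: infinite_finite_induct) (simp_all add: tsc_simps)
    then show "(\<Sum>v\<in>V. tsc (comm_sign q v (\<tau> \<boxplus> \<tau>')) (syn \<tau>' (fc T \<tau>'))) =
      tsc (\<Sum>v\<in>V. comm_sign q v (\<tau> \<boxplus> \<tau>')) (syn \<tau>' (fc T \<tau>'))" .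
  qed
  also have "\<dots> = (\<Sum>\<tau>'\<in>V. if \<tau>' = \<tau> then tsc (of_nat (2 ^ q) ^ 2) (syn \<tau> (fc T \<tau>)) else 0)"
    using \<tau> by (intro sum.cong refl) (auto simp: sum_eps tsc_simps)
  also have "\<dots> = tsc (of_nat (2 ^ q) ^ 2) (syn \<tau> (fc T \<tau>))" using \<tau> by (simp add: finite_V)
  finally have "tsc (of_nat (2 ^ q) ^ 2) (syn \<tau> (fc T \<tau>)) = (\<Sum>v\<in>V. tsc (comm_sign q v \<tau>) (S v))" ..
  moreover have "(\<Sum>v\<in>V. tsc (comm_sign q v \<tau>) (S v)) \<in> W"
    using W(1) SW by (intro csubspace_sum) (auto simp: csubspace_def)
  ultimately have "tsc (1 / of_nat (2 ^ q) ^ 2) (tsc (of_nat (2 ^ q) ^ 2) (syn \<tau> (fc T \<tau>))) \<in> W"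
    using W(1) unfolding csubspace_def by metis
  then show ?thesis by (simp add: tsc_simps)
qed

text \<open>Cyclicity fills the weight space of one weight occurring in the subspace, and
  transvections carry it to the other weights of the same orbit; by \<open>orb\<close> no further
  orbit is involved.\<close>

lemma irrep_Wsp:
  assumes adm: "admissible \<Phi>" and cyc: "cyclic \<Phi>" and nt: "nontrivial \<Phi>"
    and orb: "\<And>\<tau> f. \<Phi> \<tau> f \<Longrightarrow> orbit_type z \<tau> f"
  shows "irrep_sub q (Wsp \<Phi>)"
  unfolding irrep_sub_def
proof (intro conjI allI impI)
  show "csubspace (Wsp \<Phi>)" "invariant q (Wsp \<Phi>)" by (intro csubspace_Wsp invariant_Wsp adm)+
  show "Wsp \<Phi> \<subseteq> Tspace q" by (auto simp: Wsp_def)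
  obtain \<tau> f a where "\<tau> \<in> V" "\<Phi> \<tau> f" "a \<in> V" "f a \<noteq> 0" using nt unfolding nontrivial_def by blast
  then have "syn \<tau> f \<in> Wsp \<Phi>" "fc (syn \<tau> f) \<tau> a \<noteq> 0" using syn_Wsp[OF adm] by (auto simp: fc_syn)
  then show "Wsp \<Phi> \<noteq> {0}" by (auto simp: fc_linear)
  fix W assume "csubspace W \<and> W \<subseteq> Wsp \<Phi> \<and> invariant q W"
  then have W: "csubspace W" "W \<subseteq> Wsp \<Phi>" "invariant q W" by auto
  then have WT: "W \<subseteq> Tspace q" by (auto simp: Wsp_def)
  note comp = weight_component[OF W(1,3) WT]
  show "W = {0} \<or> W = Wsp \<Phi>"
  proof (cases "W = {0}")
    case False
    moreover have "0 \<in> W" using W by (simp add: csubspace_def)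
    ultimately obtain T where T: "T \<in> W" "T \<noteq> 0" by blast
    have TT: "T \<in> Tspace q" using T WT by blast
    obtain \<tau> a where \<tau>: "\<tau> \<in> V" "a \<in> V" "fc T \<tau> a \<noteq> 0"
      using fc_eqI[OF TT, of 0] T Tspace_csubspace by (auto simp: fc_linear csubspace_def)
    have \<Phi>T: "\<Phi> \<tau> (fc T \<tau>)" using T W \<tau> by (auto simp: Wsp_def)
    have z: "(\<tau> = (\<lambda>_. 0)) = z" using orb[OF \<Phi>T] \<tau> by (auto simp: orbit_type_def)
    \<comment> \<open>If \<open>v\<close> commutes with \<tau>, the unitary fixes the weight and its
      scalar \<open>trs v \<tau>\<close> is 1.\<close>
    have closed: "transv_closed \<tau> (\<lambda>f. syn \<tau> f \<in> W)"
      unfolding transv_closed_def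
    proof (intro conjI allI ballI impI)
      fix v f assume v: "v \<in> V" "comm_sign q v \<tau> = 1" "syn \<tau> f \<in> W"
      then have "phi2 q (trU v) (syn \<tau> f) \<in> W" using W(3) trU_clifford unfolding invariant_def by blast
      then show "syn \<tau> (\<lambda>x. f (transv v x)) \<in> W" using v \<tau> by (simp add: phi2_trU transv_fix trs_def)
    next
      fix f g assume "syn \<tau> f \<in> W" "\<forall>a\<in>V. f a = g a"
      then show "syn \<tau> g \<in> W" using syn_cong[of f g \<tau>] by simp
    qed (use W(1) in \<open>simp_all add: syn_add syn_scale csubspace_def\<close>)
    have all: "syn \<tau> f \<in> W" if "\<Phi> \<tau> f" for f
      using cyclicD[where Q = "\<lambda>f. syn \<tau> f \<in> W" and f = "fc T \<tau>" and \<Phi> = \<Phi> and \<tau> = \<tau> and a = a and g = f]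
        cyc \<tau> \<Phi>T closed comp[OF T(1) \<tau>(1)] that by blast
    \<comment> \<open>The function is pulled back to weight \<rho>, where membership is known; the
      unitary then brings it back up to a nonzero scalar.\<close>
    have move: "syn (transv v \<rho>) f \<in> W"
      if v: "v \<in> V" and \<rho>: "\<rho> \<in> V" and H: "\<And>f. \<Phi> \<rho> f \<Longrightarrow> syn \<rho> f \<in> W" and f: "\<Phi> (transv v \<rho>) f" for v \<rho> f
    proof -
      have "\<Phi> (transv v (transv v \<rho>)) (\<lambda>x. f (transv v x))"
        using admissibleD(5)[where \<Phi> = \<Phi> and \<tau> = "transv v \<rho>" and f = f and h = "transv v" and k = 1
            and f' = "\<lambda>x. f (transv v x)"] adm transv_V[OF v \<rho>] form_aut_transv[OF v] f by simp
      then have "syn \<rho> (\<lambda>x. f (transv v x)) \<in> W" using H by simp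
      then have "phi2 q (trU v) (syn \<rho> (\<lambda>x. f (transv v x))) \<in> W"
        using W(3) trU_clifford[OF v] unfolding invariant_def by blast
      then have "tsc (trs v \<rho>) (syn (transv v \<rho>) f) \<in> W"
        using v \<rho> by (simp add: phi2_trU syn_scale)
      then have "tsc (1 / trs v \<rho>) (tsc (trs v \<rho>) (syn (transv v \<rho>) f)) \<in> W"
        using W(1) unfolding csubspace_def by blast
      then show ?thesis using trs_nonzero[OF \<rho> v] by (simp add: tsc_simps)
    qed
    have every: "syn \<rho> f \<in> W" if \<rho>: "\<rho> \<in> V" and f: "\<Phi> \<rho> f" for \<rho> f
    proof (cases "\<exists>a\<in>V. f a \<noteq> 0")
      case False
      then have "syn \<rho> f = syn \<rho> (\<lambda>_. 0)" by (intro syn_cong) auto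
      then show ?thesis using W(1) by (simp add: syn_zero csubspace_def)
    next
      case True
      then have z': "(\<rho> = (\<lambda>_. 0)) = z" using orb[OF f] by (auto simp: orbit_type_def)
      show ?thesis
      proof (cases z)
        case True
        then show ?thesis using z z' all f by simp
      next
        case False
        then obtain v w where vw: "v \<in> V" "w \<in> V" "transv v (transv w \<tau>) = \<rho>"
          using transv_orbit[of "\<lambda>_. 0" "\<lambda>_. 0" \<tau> \<rho>] z z' \<tau> \<rho> by auto
        have "syn (transv v (transv w \<tau>)) f \<in> W"
        proof (rule move[OF vw(1)])
          show "transv w \<tau> \<in> V" using vw \<tau> by simp
          show "syn (transv w \<tau>) f \<in> W" if "\<Phi> (transv w \<tau>) f" for f
            by (rule move[OF vw(2) \<tau>(1) all that])
          show "\<Phi> (transv v (transv w \<tau>)) f" using f vw by simp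
        qed
        then show ?thesis using vw by simp
      qed
    qed
    have "S \<in> W" if S: "S \<in> Wsp \<Phi>" for S
    proof -
      have "(\<Sum>\<tau>\<in>V. syn \<tau> (fc S \<tau>)) \<in> W"
        using S every by (intro csubspace_sum[OF W(1)]) (auto simp: Wsp_def)
      then show ?thesis using S sum_syn_fc[of S] by (simp add: Wsp_def)
    qed
    then show ?thesis using W(2) by blast
  qed simp
qed

end

context qubits
begin

lemma syn_eq_iff: "\<tau> \<in> V \<Longrightarrow> syn \<tau> f = syn \<tau> g \<longleftrightarrow> (\<forall>x\<in>V. f x = g x)"
  using fc_syn[of \<tau> \<tau>] syn_cong[of f g \<tau>] by metis

text \<open>The indices missing from \<open>ks\<close> belong to families that vanish for the given
  \<open>q\<close>. Padding with zeros reduces the claim to all fourteen parts, where existence and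
  uniqueness hold weight by weight.\<close>

lemma direct_sum_parts:
  assumes dist: "distinct ks" and sub: "set ks \<subseteq> {..<14}"
    and triv: "\<And>i \<tau> f a. i < 14 \<Longrightarrow> i \<notin> set ks \<Longrightarrow> \<tau> \<in> V \<Longrightarrow> part i \<tau> f \<Longrightarrow> a \<in> V \<Longrightarrow> f a = 0"
  shows "direct_sum q (map (\<lambda>i. Wsp (part i)) ks)"
  unfolding direct_sum_def
proof (intro conjI ballI)
  define n where "n = length ks"
  have bij: "bij_betw ((!) ks) {..<n} (set ks)" using dist by (simp add: n_def bij_betw_nth)
  show "W \<subseteq> Tspace q" if "W \<in> set (map (\<lambda>i. Wsp (part i)) ks)" for W
    using that by (auto simp: Wsp_def)
  have reindex: "(\<Sum>i<n. F (ks ! i)) = (\<Sum>j<14. F j)" if "\<And>j. j < 14 \<Longrightarrow> j \<notin> set ks \<Longrightarrow> F j = 0" for F :: "nat \<Rightarrow> ctens"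
  proof -
    have "(\<Sum>i<n. F (ks ! i)) = sum F (set ks)" by (rule sum.reindex_bij_betw[OF bij])
    also have "\<dots> = (\<Sum>j<14. F j)" using sub that by (intro sum.mono_neutral_left) auto
    finally show ?thesis .
  qed
  fix T assume T: "T \<in> Tspace q"
  have "\<exists>x. (\<forall>i<n. x i \<in> Wsp (part (ks ! i))) \<and> (\<forall>i\<ge>n. x i = 0) \<and> T = (\<Sum>i<n. x i)"
  proof -
    have "\<forall>\<tau>\<in>V. \<exists>h. (\<forall>i<14. part i \<tau> (h i)) \<and> (\<forall>x\<in>V. fc T \<tau> x = (\<Sum>i<14. h i x))"
      using parts_exist by blast
    then obtain H where H: "\<And>\<tau> i. \<tau> \<in> V \<Longrightarrow> i < 14 \<Longrightarrow> part i \<tau> (H \<tau> i)"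
      "\<And>\<tau> x. \<tau> \<in> V \<Longrightarrow> x \<in> V \<Longrightarrow> fc T \<tau> x = (\<Sum>i<14. H \<tau> i x)" by metis
    define y where "y i = (\<Sum>\<tau>\<in>V. syn \<tau> (H \<tau> i))" for i
    have yW: "y i \<in> Wsp (part i)" if "i < 14" for i
      unfolding y_def by (rule Wsp_sum_syn[OF admissible_part[OF that] H(1)[OF _ that]])
    have y0: "y i = 0" if i: "i < 14" "i \<notin> set ks" for i
    proof -
      have "syn \<tau> (H \<tau> i) = 0" if "\<tau> \<in> V" for \<tau>
        using syn_cong[of "H \<tau> i" "\<lambda>_. 0" \<tau>] triv[OF i that H(1)[OF that i(1)]] by (simp add: syn_zero)
      then show ?thesis by (simp add: y_def)
    qed
    have "T = (\<Sum>\<tau>\<in>V. syn \<tau> (\<lambda>x. \<Sum>i<14. H \<tau> i x))"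
    proof -
      have "(\<Sum>\<tau>\<in>V. syn \<tau> (fc T \<tau>)) = (\<Sum>\<tau>\<in>V. syn \<tau> (\<lambda>x. \<Sum>i<14. H \<tau> i x))"
        using H(2) by (intro sum.cong refl syn_cong) simp
      then show ?thesis using sum_syn_fc[OF T] by simp
    qed
    also have "\<dots> = (\<Sum>\<tau>\<in>V. \<Sum>i<14. syn \<tau> (H \<tau> i))" by (simp only: syn_sum)
    also have "\<dots> = (\<Sum>i<14. y i)" unfolding y_def by (rule sum.swap)
    also have "\<dots> = (\<Sum>i<n. y (ks ! i))" using reindex[of y] y0 by simp
    finally have "T = (\<Sum>i<n. y (ks ! i))" .
    moreover have "ks ! i < 14" if "i < n" for i
    proof -
      have "ks ! i \<in> set ks" using that by (simp add: n_def)
      then show ?thesis using sub by blast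
    qed
    ultimately show ?thesis using yW
      by (intro exI[of _ "\<lambda>i. if i < n then y (ks ! i) else 0"]) auto
  qed
  moreover have "x = x'" if x: "\<forall>i<n. x i \<in> Wsp (part (ks ! i))" "\<forall>i\<ge>n. x i = 0" "T = (\<Sum>i<n. x i)"
    and x': "\<forall>i<n. x' i \<in> Wsp (part (ks ! i))" "\<forall>i\<ge>n. x' i = 0" "T = (\<Sum>i<n. x' i)" for x x'
  proof -
    define k where "k = inv_into {..<n} ((!) ks)"
    have k: "k (ks ! i) = i" if "i < n" for i
      using bij_betw_inv_into_left[OF bij] that by (simp add: k_def)
    have k': "k j < n" "ks ! k j = j" if "j \<in> set ks" for j
      using bij_betw_inv_into_right[OF bij that] bij_betw_apply[OF bij_betw_inv_into[OF bij] that] by (simp_all add: k_def)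
    \<comment> \<open>The difference of the two decompositions, moved back to the fourteen
      indices.\<close>
    define e where "e j = (if j \<in> set ks then x (k j) - x' (k j) else 0)" for j
    have eW: "e j \<in> Wsp (part j)" if "j < 14" for j
    proof (cases "j \<in> set ks")
      case True
      then have "x (k j) \<in> Wsp (part j)" "x' (k j) \<in> Wsp (part j)" using x(1) x'(1) k'[OF True] by metis+
      then show ?thesis using True csubspace_diff[OF csubspace_Wsp[OF admissible_part[OF that]]] by (simp add: e_def)
    next
      case False
      then show ?thesis using csubspace_Wsp[OF admissible_part[OF that]] by (simp add: e_def csubspace_def)
    qed
    have "(\<Sum>j<14. e j) = (\<Sum>i<n. e (ks ! i))" by (rule reindex[symmetric]) (simp add: e_def)
    also have "\<dots> = (\<Sum>i<n. x i - x' i)"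
      by (intro sum.cong refl) (simp add: e_def k n_def)
    also have "\<dots> = 0" using x(3) x'(3) by (simp add: sum_subtractf)
    finally have e0: "(\<Sum>j<14. e j) = 0" .
    have "e j = 0" if j: "j < 14" for j
    proof (rule fc_eqI)
      show "e j \<in> Tspace q" using eW[OF j] by (simp add: Wsp_def)
      show "0 \<in> Tspace q" using Tspace_csubspace by (simp add: csubspace_def)
      fix \<tau> a assume \<tau>: "\<tau> \<in> V" and a: "a \<in> V"
      have 1: "\<forall>i<14. part i \<tau> (fc (e i) \<tau>)" using eW \<tau> by (simp add: Wsp_def)
      have 2: "\<forall>x\<in>V. (\<Sum>i<14. fc (e i) \<tau> x) = 0" by (simp add: e0 fc_linear flip: fc_sum)
      show "fc (e j) \<tau> a = fc 0 \<tau> a"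
        using parts_indep[OF \<tau> 1 2 a] j by (simp add: fc_linear)
    qed
    then have "x i = x' i" if "i < n" for i
    proof -
      have i: "ks ! i \<in> set ks" using that by (simp add: n_def)
      then have "e (ks ! i) = 0" using \<open>\<And>j. j < 14 \<Longrightarrow> e j = 0\<close> sub by blast
      then show ?thesis using i k[OF that] by (simp add: e_def)
    qed
    then show ?thesis using x(2) x'(2) by (metis ext not_less)
  qed
  ultimately have "\<exists>!x. (\<forall>i<n. x i \<in> Wsp (part (ks ! i))) \<and> (\<forall>i\<ge>n. x i = 0) \<and> T = (\<Sum>i<n. x i)"
    by blast
  then show "\<exists>!x. (\<forall>i<length (map (\<lambda>i. Wsp (part i)) ks). x i \<in> map (\<lambda>i. Wsp (part i)) ks ! i) \<and>
      (\<forall>i\<ge>length (map (\<lambda>i. Wsp (part i)) ks). x i = 0) \<and>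
      T = (\<Sum>i<length (map (\<lambda>i. Wsp (part i)) ks). x i)"
    unfolding n_def by (simp cong: conj_cong)
qed

section \<open>The subspaces in coordinates\<close>

abbreviation "V0 \<equiv> pstrings q - {\<lambda>_. 0}"

lemma rs_nonzero: "complex_of_real (1 / sqrt (2 ^ q)) \<noteq> 0" "complex_of_real (1 / sqrt 2) \<noteq> 0" by simp_all

lemma sg_msc_inj:
  assumes "a \<in> V" "b \<in> V" "c \<noteq> 0" "msc c (sg q a) = msc c' (sg q b)"
  shows "a = b" "c = c'"
proof -
  have "msc (c * of_real (1 / sqrt (2 ^ q))) (pmat q a) = msc (c' * of_real (1 / sqrt (2 ^ q))) (pmat q b)"
    using assms(4) by (simp add: sg_def msc_simps)
  moreover have "c * of_real (1 / sqrt (2 ^ q)) \<noteq> 0" using assms(3) by simp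
  ultimately have "a = b" "c * of_real (1 / sqrt (2 ^ q)) = c' * of_real (1 / sqrt (2 ^ q))"
    using pmat_msc_inj[OF assms(1,2)] by blast+
  then show "a = b" "c = c'" using rs_nonzero(1) by simp_all
qed

lemma inj_sg: "inj_on (sg q) V"
  by (rule inj_onI) (use sg_msc_inj(1)[where c = 1 and c' = 1] in \<open>simp add: msc_simps\<close>)

lemma sigma0_eq: "sigma0 q = sg q (\<lambda>_. 0)"
  by (simp add: sigma0_def sg_def idm_def)

lemma sig_eq: "sig q = sg q ` V0"
proof -
  have "inj_on (pmat q) V"
    by (rule inj_onI) (use pmat_msc_inj(1)[where c = 1 and c' = 1] in \<open>simp add: msc_simps\<close>)
  then have "hatP q - {idm q} = pmat q ` V0"
    unfolding hatP_def idm_def by (subst inj_on_image_set_diff[where C = V]) (auto simp: pstrings_zero)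
  then show ?thesis by (simp add: sig_def sg_def image_image)
qed

lemma sum_sig: "sum F (sig q) = (\<Sum>a\<in>V0. F (sg q a))"
  unfolding sig_eq by (rule sum.reindex[unfolded o_def]) (rule inj_on_subset[OF inj_sg], auto)

lemma mmult_sg:
  "a \<in> V \<Longrightarrow> b \<in> V \<Longrightarrow> mmult q (sg q a) (sg q b) = msc (of_real (1 / sqrt (2 ^ q)) * phase q a b) (sg q (a \<boxplus> b))"
  by (simp add: sg_def mmult_linear mmult_pmat msc_simps mult_ac)

lemma phase_nonzero: "phase q a b \<noteq> 0"
  using phase_simps(5)[of q a b] by auto

lemma sg_commute_iff:
  assumes "a \<in> V" "b \<in> V"
  shows "mmult q (sg q a) (sg q b) = mmult q (sg q b) (sg q a) \<longleftrightarrow> comm_sign q a b = 1"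
proof
  assume "mmult q (sg q a) (sg q b) = mmult q (sg q b) (sg q a)"
  then have eq: "msc (of_real (1 / sqrt (2 ^ q)) * phase q a b) (sg q (a \<boxplus> b)) =
      msc (of_real (1 / sqrt (2 ^ q)) * phase q b a) (sg q (a \<boxplus> b))"
    using assms by (simp only: mmult_sg string_add_simps(2)[of b a])
  have "of_real (1 / sqrt (2 ^ q)) * phase q a b = of_real (1 / sqrt (2 ^ q)) * phase q b a"
    by (rule sg_msc_inj(2)[OF _ _ _ eq]) (use assms phase_nonzero[of a b] in simp_all)
  then have "phase q a b = comm_sign q a b * phase q a b"
    using phase_simps(2)[OF assms] by simp
  then show "comm_sign q a b = 1" using phase_nonzero[of a b] by simp
next
  assume "comm_sign q a b = 1"
  then show "mmult q (sg q a) (sg q b) = mmult q (sg q b) (sg q a)"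
    using phase_simps(2)[OF assms] assms by (simp add: mmult_sg string_add_simps(2)[of b a])
qed

lemma sg_anticommute_iff:
  assumes "a \<in> V" "b \<in> V"
  shows "(\<forall>i j. mmult q (sg q a) (sg q b) i j + mmult q (sg q b) (sg q a) i j = 0) \<longleftrightarrow> comm_sign q a b = -1"
proof -
  have eq: "mmult q (sg q a) (sg q b) i j + mmult q (sg q b) (sg q a) i j =
      msc (of_real (1 / sqrt (2 ^ q)) * phase q a b * (1 + comm_sign q a b)) (sg q (a \<boxplus> b)) i j" for i j
    using assms
    by (simp only: mmult_sg phase_simps(2)[OF assms] string_add_simps(2)[of b a] msc_def) algebra
  show ?thesis
  proof
    assume "\<forall>i j. mmult q (sg q a) (sg q b) i j + mmult q (sg q b) (sg q a) i j = 0"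
    then have z: "msc (of_real (1 / sqrt (2 ^ q)) * phase q a b * (1 + comm_sign q a b)) (sg q (a \<boxplus> b)) = msc 0 (sg q (a \<boxplus> b))"
      unfolding eq by (intro ext) (auto simp: msc_def)
    have "of_real (1 / sqrt (2 ^ q)) * phase q a b * (1 + comm_sign q a b) = 0"
    proof (rule ccontr)
      assume n: "of_real (1 / sqrt (2 ^ q)) * phase q a b * (1 + comm_sign q a b) \<noteq> 0"
      have "a \<boxplus> b \<in> V" using assms by simp
      from sg_msc_inj(2)[OF this this n z] n show False by contradiction
    qed
    then have "1 + comm_sign q a b = 0" using phase_nonzero[of a b] by simp
    then show "comm_sign q a b = -1" using eps_cases[of a b] by auto
  next
    assume "comm_sign q a b = -1"
    then show "\<forall>i j. mmult q (sg q a) (sg q b) i j + mmult q (sg q b) (sg q a) i j = 0"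
      unfolding eq by (simp add: msc_def)
  qed
qed

lemma anti_set_sub: "anti_set \<tau> \<subseteq> V0" "comm_set \<tau> \<subseteq> V0" "anti_set \<tau> \<subseteq> V" "comm_set \<tau> \<subseteq> V"
  using anti_setD[of _ \<tau>] comm_setD[of _ \<tau>] by auto

lemma Nset_eq: "\<tau> \<in> V \<Longrightarrow> Nset q (sg q \<tau>) = sg q ` anti_set \<tau>"
proof -
  assume \<tau>: "\<tau> \<in> V"
  have "Nset q (sg q \<tau>) = sg q ` {a \<in> V0. \<forall>i j. mmult q (sg q a) (sg q \<tau>) i j + mmult q (sg q \<tau>) (sg q a) i j = 0}"
    unfolding Nset_def sig_eq by blast
  also have "{a \<in> V0. \<forall>i j. mmult q (sg q a) (sg q \<tau>) i j + mmult q (sg q \<tau>) (sg q a) i j = 0} = anti_set \<tau>"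
  proof -
    have "{a \<in> V0. \<forall>i j. mmult q (sg q a) (sg q \<tau>) i j + mmult q (sg q \<tau>) (sg q a) i j = 0} =
        {a \<in> V0. comm_sign q a \<tau> = -1}"
      using \<tau> by (intro Collect_cong conj_cong refl sg_anticommute_iff) auto
    then show ?thesis using anti_set_sub(1)[of \<tau>] by (auto simp: anti_set_def)
  qed
  finally show ?thesis .
qed

lemma Cset_eq: "\<tau> \<in> V \<Longrightarrow> Cset q (sg q \<tau>) = sg q ` comm_set \<tau>"
proof -
  assume \<tau>: "\<tau> \<in> V"
  have "Cset q (sg q \<tau>) = sg q ` {a \<in> V0. sg q a \<noteq> sg q \<tau> \<and> mmult q (sg q a) (sg q \<tau>) = mmult q (sg q \<tau>) (sg q a)}"
    unfolding Cset_def sig_eq by auto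
  also have "{a \<in> V0. sg q a \<noteq> sg q \<tau> \<and> mmult q (sg q a) (sg q \<tau>) = mmult q (sg q \<tau>) (sg q a)} = comm_set \<tau>"
    using \<tau> inj_on_eq_iff[OF inj_sg] by (auto simp: sg_commute_iff comm_set_def)
  finally show ?thesis .
qed

lemma sum_image_sg: "A \<subseteq> V \<Longrightarrow> (\<Sum>\<sigma>\<in>sg q ` A. F \<sigma>) = (\<Sum>a\<in>A. F (sg q a))"
  by (rule sum.reindex[unfolded o_def]) (rule inj_on_subset[OF inj_sg])

lemma nprod_sg: "a \<in> V \<Longrightarrow> b \<in> V \<Longrightarrow> nprod q (sg q a) (sg q b) = msc (phase q a b) (sg q (a \<boxplus> b))"
proof -
  have "complex_of_real (sqrt (2 ^ q)) * of_real (1 / sqrt (2 ^ q)) = 1"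
    unfolding of_real_mult[symmetric] by simp
  then show "a \<in> V \<Longrightarrow> b \<in> V \<Longrightarrow> ?thesis"
    by (simp only: nprod_def mmult_sg msc_simps mult.assoc[symmetric] mult_1_left)
qed

lemma syn_single: "b \<in> V \<Longrightarrow> syn \<tau> (\<lambda>x. k * of_bool (x = b)) = tsc (k * phase q b \<tau>) (tens (sg q b) (sg q (b \<boxplus> \<tau>)))"
proof -
  assume b: "b \<in> V"
  have "syn \<tau> (\<lambda>x. k * of_bool (x = b)) =
      (\<Sum>a\<in>V. if a = b then tsc (k * phase q b \<tau>) (tens (sg q b) (sg q (b \<boxplus> \<tau>))) else 0)"
    unfolding syn_def by (intro sum.cong refl) (auto simp: tsc_simps)
  then show ?thesis using b by (simp add: finite_V)
qed

lemma phase_shift: "a \<in> V \<Longrightarrow> \<tau> \<in> V \<Longrightarrow> phase q a \<tau> = comm_sign q a \<tau> * phase q (a \<boxplus> \<tau>) \<tau>"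
  using phase_simps(1,3)[of a q \<tau>] by (metis mult.assoc mult.right_neutral mult.commute)

text \<open>Exchanging the tensor factors replaces \<open>a\<close> by
  \<open>a \<boxplus> \<tau>\<close>, and \<open>phase_shift\<close> contributes
  \<open>comm_sign q a \<tau>\<close>. Hence symmetrization (\<open>\<delta> = 1\<close>) is
  skew-periodic when \<open>a\<close> anticommutes with \<tau>.\<close>

lemma tens_pair:
  assumes "a \<in> V" "\<tau> \<in> V"
  shows "tens (sg q a) (msc k (nprod q (sg q a) (sg q \<tau>))) + tsc \<delta> (tens (msc k (nprod q (sg q a) (sg q \<tau>))) (sg q a))
    = syn \<tau> (\<lambda>x. k * pair (\<delta> * comm_sign q a \<tau>) \<tau> a x)"
proof -
  have "syn \<tau> (\<lambda>x. k * pair (\<delta> * comm_sign q a \<tau>) \<tau> a x) =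
    syn \<tau> (\<lambda>x. k * of_bool (x = a)) + syn \<tau> (\<lambda>x. (k * \<delta> * comm_sign q a \<tau>) * of_bool (x = a \<boxplus> \<tau>))"
    unfolding syn_add[symmetric] by (simp add: pair_def distrib_left mult.assoc)
  also have "\<dots> = tsc (k * phase q a \<tau>) (tens (sg q a) (sg q (a \<boxplus> \<tau>)))
     + tsc (k * \<delta> * phase q a \<tau>) (tens (sg q (a \<boxplus> \<tau>)) (sg q a))"
    using assms phase_shift[OF assms] by (simp only: syn_single add_V) (simp add: mult.assoc)
  also have "\<dots> = tens (sg q a) (msc k (nprod q (sg q a) (sg q \<tau>))) + tsc \<delta> (tens (msc k (nprod q (sg q a) (sg q \<tau>))) (sg q a))"
    using assms tens_msc[of 1 "sg q a"] tens_msc[of _ _ 1 "sg q a"] by (simp add: nprod_sg msc_simps tsc_simps mult_ac)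
  finally show ?thesis ..
qed

lemma Ssym_nprod:
  assumes "a \<in> V" "\<tau> \<in> V"
  shows "Ssym (sg q a) (msc k (nprod q (sg q a) (sg q \<tau>))) =
    syn \<tau> (\<lambda>x. of_real (1 / sqrt 2) * k * pair (comm_sign q a \<tau>) \<tau> a x)"
  using tens_pair[OF assms, of k 1] by (simp only: Ssym_def tsc_simps(4) mult_1_left syn_scale[symmetric] mult.assoc)

lemma Aasym_nprod:
  assumes "a \<in> V" "\<tau> \<in> V"
  shows "Aasym (sg q a) (msc k (nprod q (sg q a) (sg q \<tau>))) =
    syn \<tau> (\<lambda>x. of_real (1 / sqrt 2) * k * pair (- comm_sign q a \<tau>) \<tau> a x)"
  using tens_pair[OF assms, of k "-1"]
  by (simp only: Aasym_def tsc_simps(8) mult_minus1 add_uminus_conv_diff syn_scale[symmetric] mult.assoc)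

lemma cspan_eq_Wsp:
  assumes "admissible \<Phi>" "\<And>x. x \<in> G \<Longrightarrow> \<exists>\<tau> f. \<tau> \<in> V \<and> x = syn \<tau> f \<and> \<Phi> \<tau> f"
    and "\<And>\<tau> f. \<tau> \<in> V \<Longrightarrow> \<Phi> \<tau> f \<Longrightarrow> syn \<tau> f \<in> cspan G"
  shows "cspan G = Wsp \<Phi>"
proof
  show "cspan G \<subseteq> Wsp \<Phi>"
  proof (rule cspan_least[OF csubspace_Wsp[OF assms(1)]], rule subsetI)
    fix x assume "x \<in> G"
    then obtain \<tau> f where "\<tau> \<in> V" "x = syn \<tau> f" "\<Phi> \<tau> f" using assms(2) by blast
    then show "x \<in> Wsp \<Phi>" using syn_Wsp[OF assms(1)] by simp
  qed
  show "Wsp \<Phi> \<subseteq> cspan G"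
  proof
    fix T assume T: "T \<in> Wsp \<Phi>"
    then have "(\<Sum>\<tau>\<in>V. syn \<tau> (fc T \<tau>)) \<in> cspan G"
      by (intro csubspace_sum[OF csubspace_cspan] assms(3)) (auto simp: Wsp_def)
    then show "T \<in> cspan G" using T sum_syn_fc[of T] by (simp add: Wsp_def)
  qed
qed

lemma zero_in_cspan: "0 \<in> cspan G" using csubspace_cspan by (simp add: csubspace_def)

lemma syn_trivial: "(\<And>x. x \<in> V \<Longrightarrow> f x = 0) \<Longrightarrow> syn \<tau> f = 0"
  using syn_cong[of f "\<lambda>_. 0" \<tau>] by (simp add: syn_zero)

lemma cspan_scale: "x \<in> cspan G \<Longrightarrow> tsc k x \<in> cspan G"
  using csubspace_cspan by (simp add: csubspace_def)

text \<open>Serves all spaces spanned by one vector per weight; \<open>k\<close> absorbs the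
  normalization of that vector.\<close>

lemma cspan_const_part:
  assumes R: "natural R" and k: "k \<noteq> 0"
    and gen: "\<And>\<tau>. \<tau> \<in> V \<Longrightarrow> (\<tau> = (\<lambda>_. 0)) = z \<Longrightarrow> gen \<tau> = syn \<tau> (\<lambda>x. k * of_bool (x \<in> R \<tau>))"
  shows "cspan (gen ` {\<tau> \<in> V. (\<tau> = (\<lambda>_. 0)) = z}) = Wsp (const_part z R)"
proof (rule cspan_eq_Wsp)
  show "admissible (const_part z R)" by (rule admissible_parts(1)[OF R])
  fix x assume "x \<in> gen ` {\<tau> \<in> V. (\<tau> = (\<lambda>_. 0)) = z}"
  then obtain \<tau> where "\<tau> \<in> V" "(\<tau> = (\<lambda>_. 0)) = z" "x = gen \<tau>" by blast
  moreover from this have "const_part z R \<tau> (\<lambda>x. k * of_bool (x \<in> R \<tau>))"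
    by (simp add: const_part_def orbit_type_def supp_in_def const_on_def)
  ultimately show "\<exists>\<tau> f. \<tau> \<in> V \<and> x = syn \<tau> f \<and> const_part z R \<tau> f" using gen by blast
next
  fix \<tau> f assume \<tau>: "\<tau> \<in> V" and f: "const_part z R \<tau> f"
  show "syn \<tau> f \<in> cspan (gen ` {\<tau> \<in> V. (\<tau> = (\<lambda>_. 0)) = z})"
  proof (cases "\<exists>a\<in>V. f a \<noteq> 0")
    case False
    then show ?thesis using syn_trivial[of f \<tau>] zero_in_cspan by simp
  next
    case True
    then obtain a where a: "a \<in> V" "f a \<noteq> 0" by blast
    then have z: "(\<tau> = (\<lambda>_. 0)) = z" and aR: "a \<in> R \<tau>"
      using f by (auto simp: const_part_def orbit_type_def supp_in_def)
    have "f x = f a / k * (k * of_bool (x \<in> R \<tau>))" if x: "x \<in> V" for x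
    proof (cases "x \<in> R \<tau>")
      case True
      then have "f x = f a" using f aR unfolding const_part_def const_on_def by blast
      then show ?thesis using True k by simp
    next
      case False
      then show ?thesis using supp_inD[of R \<tau> f x] f x by (simp add: const_part_def)
    qed
    then have "syn \<tau> f = tsc (f a / k) (gen \<tau>)"
      unfolding gen[OF \<tau> z] syn_scale[symmetric] by (rule syn_cong)
    moreover have "gen \<tau> \<in> gen ` {\<tau> \<in> V. (\<tau> = (\<lambda>_. 0)) = z}" using \<tau> z by (intro imageI CollectI conjI)
    ultimately show ?thesis by (simp only: cspan_scale cspan_base)
  qed
qed

lemma V0_eq: "{\<tau> \<in> V. (\<tau> = (\<lambda>_. 0)) = False} = V0" "{\<tau> \<in> V. (\<tau> = (\<lambda>_. 0)) = True} = {\<lambda>_. 0}"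
  by (auto simp: pstrings_zero)

lemma phase_zero: "phase q a (\<lambda>_. 0) = 1"
  by (simp add: phase_def phase1_def)

lemma V_id_eq: "V_id q = Wsp (part 0)"
proof -
  have "V_id q = cspan ((\<lambda>\<tau>. tens (sigma0 q) (sg q \<tau>)) ` {\<tau> \<in> V. (\<tau> = (\<lambda>_. 0)) = True})"
    unfolding V0_eq by (simp add: V_id_def sigma0_eq)
  also have "\<dots> = Wsp (part 0)"
    unfolding part_simps
    by (rule cspan_const_part[OF natural_sets(3), of 1])
      (use syn_single[of "\<lambda>_. 0" _ 1] in \<open>simp_all add: sigma0_eq phase_simps tsc_simps\<close>)
  finally show ?thesis .
qed

lemma V_r_eq: "V_r q = Wsp (part 1)"
proof -
  have "V_r q = cspan ((\<lambda>\<tau>. tens (sigma0 q) (sg q \<tau>)) ` {\<tau> \<in> V. (\<tau> = (\<lambda>_. 0)) = False})"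
    unfolding V0_eq by (simp add: V_r_def sig_eq image_image)
  also have "\<dots> = Wsp (part 1)"
    unfolding part_simps
    by (rule cspan_const_part[OF natural_sets(3), of 1])
      (use syn_single[of "\<lambda>_. 0" _ 1] in \<open>simp_all add: sigma0_eq phase_simps tsc_simps\<close>)
  finally show ?thesis .
qed

lemma V_l_eq: "V_l q = Wsp (part 2)"
proof -
  have "V_l q = cspan ((\<lambda>\<tau>. tens (sg q \<tau>) (sigma0 q)) ` {\<tau> \<in> V. (\<tau> = (\<lambda>_. 0)) = False})"
    unfolding V0_eq by (simp add: V_l_def sig_eq image_image)
  also have "\<dots> = Wsp (part 2)"
    unfolding part_simps
    by (rule cspan_const_part[OF natural_sets(4), of 1])
      (use syn_single[of _ _ 1] in \<open>simp_all add: sigma0_eq phase_simps tsc_simps\<close>)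
  finally show ?thesis .
qed

lemma V_0_eq: "V_0 q = Wsp (part 3)"
proof -
  define gen where "gen = (\<lambda>\<tau> :: nat \<Rightarrow> nat. \<Sum>\<sigma>\<in>sig q. tens \<sigma> \<sigma>)"
  have "V_0 q = cspan (gen ` {\<tau> \<in> V. (\<tau> = (\<lambda>_. 0)) = True})"
    unfolding V0_eq by (simp add: V_0_def gen_def)
  also have "\<dots> = Wsp (part 3)"
    unfolding part_simps
  proof (rule cspan_const_part[OF natural_sets(1), of 1])
    fix \<tau> :: "nat \<Rightarrow> nat" assume "(\<tau> = (\<lambda>_. 0)) = True"
    then have \<tau>: "\<tau> = (\<lambda>_. 0)" by simp
    have "gen \<tau> = (\<Sum>a\<in>V0. tens (sg q a) (sg q a))" by (simp add: gen_def sum_sig)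
    also have "\<dots> = (\<Sum>a\<in>V. tsc (1 * of_bool (a \<in> comm_set \<tau>) * phase q a \<tau>) (tens (sg q a) (sg q (a \<boxplus> \<tau>))))"
      by (intro sum.mono_neutral_cong_left finite_V) (auto simp: \<tau> comm_set_def phase_zero tsc_simps)
    finally show "gen \<tau> = syn \<tau> (\<lambda>x. 1 * of_bool (x \<in> comm_set \<tau>))" by (simp add: syn_def)
  qed simp
  finally show ?thesis .
qed

text \<open>A point \<open>x\<close> of \<open>R\<close> is met by the pairs based at
  \<open>x\<close> and at \<open>x \<boxplus> \<tau>\<close>; if these coincide, the single pair has
  the value 2.\<close>

lemma sum_pair_indicator:
  assumes "R \<subseteq> V" "\<And>x. x \<in> V \<Longrightarrow> x \<boxplus> \<tau> \<in> R \<longleftrightarrow> x \<in> R" "\<tau> \<in> V" "x \<in> V"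
  shows "(\<Sum>b\<in>R. pair 1 \<tau> b x) = 2 * of_bool (x \<in> R)"
proof -
  have "(\<Sum>b\<in>R. pair 1 \<tau> b x) = (\<Sum>b\<in>V. of_bool (b \<in> R) * pair 1 \<tau> b x)"
    using assms(1) by (intro sum.mono_neutral_cong_left finite_V) auto
  also have "\<dots> = 2 * of_bool (x \<in> R)"
    using assms by (intro sum_pair) (auto simp: periodic_def)
  finally show ?thesis .
qed

lemma V_adj_br_eq: "V_adj_br q = Wsp (part 6)"
proof -
  define gen where "gen = (\<lambda>\<tau>. \<Sum>\<sigma>\<in>Cset q (sg q \<tau>). Ssym \<sigma> (nprod q \<sigma> (sg q \<tau>)))"
  have "V_adj_br q = cspan (gen ` {\<tau> \<in> V. (\<tau> = (\<lambda>_. 0)) = False})"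
    unfolding V0_eq by (simp add: V_adj_br_def gen_def sig_eq image_image)
  also have "\<dots> = Wsp (part 6)"
    unfolding part_simps
  proof (rule cspan_const_part[OF natural_sets(1), of "of_real (1 / sqrt 2) * 2"])
    fix \<tau> assume \<tau>: "\<tau> \<in> V"
    have "gen \<tau> = (\<Sum>a\<in>comm_set \<tau>. syn \<tau> (\<lambda>x. of_real (1 / sqrt 2) * 1 * pair 1 \<tau> a x))"
      unfolding gen_def Cset_eq[OF \<tau>] sum_image_sg[OF anti_set_sub(4)]
    proof (intro sum.cong refl)
      fix a assume "a \<in> comm_set \<tau>"
      then show "Ssym (sg q a) (nprod q (sg q a) (sg q \<tau>)) = syn \<tau> (\<lambda>x. of_real (1 / sqrt 2) * 1 * pair 1 \<tau> a x)"
        using Ssym_nprod[of a \<tau> 1] \<tau> comm_setD[of a \<tau>] by (simp only: msc_simps)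
    qed
    also have "\<dots> = syn \<tau> (\<lambda>x. \<Sum>a\<in>comm_set \<tau>. of_real (1 / sqrt 2) * 1 * pair 1 \<tau> a x)"
      by (rule syn_sum[symmetric])
    also have "\<dots> = syn \<tau> (\<lambda>x. of_real (1 / sqrt 2) * 2 * of_bool (x \<in> comm_set \<tau>))"
      using \<tau> by (intro syn_cong)
        (simp only: sum_distrib_left[symmetric] sum_pair_indicator anti_set_sub comm_set_shift_iff mult.assoc mult_1_left mult_1_right)
    finally show "gen \<tau> = \<dots>" .
  qed simp
  finally show ?thesis .
qed

lemma V_adj_cu_eq: "V_adj_cu q = Wsp (part 9)"
proof -
  define gen where "gen = (\<lambda>\<tau>. \<Sum>\<sigma>\<in>Nset q (sg q \<tau>). Aasym \<sigma> (msc \<i> (nprod q \<sigma> (sg q \<tau>))))"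
  have "V_adj_cu q = cspan (gen ` {\<tau> \<in> V. (\<tau> = (\<lambda>_. 0)) = False})"
    unfolding V0_eq by (simp add: V_adj_cu_def gen_def sig_eq image_image)
  also have "\<dots> = Wsp (part 9)"
    unfolding part_simps
  proof (rule cspan_const_part[OF natural_sets(2), of "of_real (1 / sqrt 2) * \<i> * 2"])
    fix \<tau> assume \<tau>: "\<tau> \<in> V"
    have "gen \<tau> = (\<Sum>a\<in>anti_set \<tau>. syn \<tau> (\<lambda>x. of_real (1 / sqrt 2) * \<i> * pair 1 \<tau> a x))"
      unfolding gen_def Nset_eq[OF \<tau>] sum_image_sg[OF anti_set_sub(3)]
    proof (intro sum.cong refl)
      fix a assume "a \<in> anti_set \<tau>"
      then show "Aasym (sg q a) (msc \<i> (nprod q (sg q a) (sg q \<tau>))) = syn \<tau> (\<lambda>x. of_real (1 / sqrt 2) * \<i> * pair 1 \<tau> a x)"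
        using Aasym_nprod[of a \<tau> \<i>] \<tau> anti_setD[of a \<tau>] by (simp only: minus_minus)
    qed
    also have "\<dots> = syn \<tau> (\<lambda>x. \<Sum>a\<in>anti_set \<tau>. of_real (1 / sqrt 2) * \<i> * pair 1 \<tau> a x)"
      by (rule syn_sum[symmetric])
    also have "\<dots> = syn \<tau> (\<lambda>x. of_real (1 / sqrt 2) * \<i> * 2 * of_bool (x \<in> anti_set \<tau>))"
      using \<tau> by (intro syn_cong)
        (simp only: sum_distrib_left[symmetric] sum_pair_indicator anti_set_sub anti_set_shift_iff mult.assoc)
    finally show "gen \<tau> = \<dots>" .
  qed simp
  finally show ?thesis .
qed

text \<open>A generator built from \<open>sg q a\<close> and \<open>sg q b\<close> has weight
  \<open>a \<boxplus> b\<close>; the assumptions \<open>R\<close> translate between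
  \<open>(a, b)\<close> and \<open>(a, \<tau>)\<close>. As no generator has weight zero, the
  assumption \<open>zero\<close> excludes nonzero functions there.\<close>

lemma cspan_pairs:
  assumes nat: "natural R" and \<eta>: "\<eta> * \<eta> = 1"
    and R: "\<And>a \<tau>. a \<in> V \<Longrightarrow> \<tau> \<in> V0 \<Longrightarrow> a \<in> R \<tau> \<Longrightarrow> a \<in> R (a \<boxplus> \<tau>) \<and> a \<boxplus> \<tau> \<noteq> (\<lambda>_. 0)"
      "\<And>a b. a \<in> V \<Longrightarrow> b \<in> V0 \<Longrightarrow> a \<in> R b \<Longrightarrow> a \<boxplus> b \<in> V0 \<and> a \<in> R (a \<boxplus> b)"
      "\<And>a \<tau>. a \<in> R \<tau> \<Longrightarrow> \<tau> \<in> V \<Longrightarrow> a \<boxplus> \<tau> \<in> R \<tau>"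
    and zero: "\<And>f x. supp_in R (\<lambda>_. 0) f \<Longrightarrow> periodic \<eta> (\<lambda>_. 0) f \<Longrightarrow> x \<in> V \<Longrightarrow> f x = 0"
    and B: "\<And>a \<tau>. a \<in> R \<tau> \<Longrightarrow> a \<in> V \<Longrightarrow> \<tau> \<in> V \<Longrightarrow>
      \<exists>k. k \<noteq> 0 \<and> B (sg q a) (sg q (a \<boxplus> \<tau>)) = syn \<tau> (\<lambda>x. k * pair \<eta> \<tau> a x)"
  shows "cspan {B (sg q a) (sg q b) | a b. b \<in> V0 \<and> a \<in> R b} = Wsp (\<lambda>\<tau> f. supp_in R \<tau> f \<and> periodic \<eta> \<tau> f)"
proof (rule cspan_eq_Wsp)
  have RV: "a \<in> V" if "a \<in> R \<tau>" "\<tau> \<in> V" for a \<tau> using nat that unfolding natural_def by blast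
  show "admissible (\<lambda>\<tau> f. supp_in R \<tau> f \<and> periodic \<eta> \<tau> f)"
    by (intro admissible_intros nat)
  fix x assume "x \<in> {B (sg q a) (sg q b) | a b. b \<in> V0 \<and> a \<in> R b}"
  then obtain a b where b: "b \<in> V0" and a: "a \<in> R b" and x: "x = B (sg q a) (sg q b)" by blast
  have aV: "a \<in> V" using RV a b by blast
  define \<tau> where "\<tau> = a \<boxplus> b"
  have \<tau>: "\<tau> \<in> V0" "a \<in> R \<tau>" using R(2)[OF aV b a] by (auto simp: \<tau>_def)
  obtain k where k: "B (sg q a) (sg q (a \<boxplus> \<tau>)) = syn \<tau> (\<lambda>x. k * pair \<eta> \<tau> a x)"
    using B[of a \<tau>] \<tau> aV by blast
  have "supp_in R \<tau> (\<lambda>x. k * pair \<eta> \<tau> a x)"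
    using \<tau> R(3)[of a \<tau>] by (auto simp: supp_in_def pair_def)
  moreover have "periodic \<eta> \<tau> (\<lambda>x. k * pair \<eta> \<tau> a x)"
    using \<eta> by (simp add: periodic_def pair_def add_move distrib_left flip: mult.assoc)
  ultimately show "\<exists>\<tau> f. \<tau> \<in> V \<and> x = syn \<tau> f \<and> supp_in R \<tau> f \<and> periodic \<eta> \<tau> f"
    using k x \<tau> by (intro exI[of _ \<tau>] exI[of _ "\<lambda>x. k * pair \<eta> \<tau> a x"]) (simp add: \<tau>_def)
next
  have RV: "a \<in> V" if "a \<in> R \<tau>" "\<tau> \<in> V" for a \<tau> using nat that unfolding natural_def by blast
  fix \<tau> f assume \<tau>: "\<tau> \<in> V" and f: "supp_in R \<tau> f \<and> periodic \<eta> \<tau> f"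
  show "syn \<tau> f \<in> cspan {B (sg q a) (sg q b) | a b. b \<in> V0 \<and> a \<in> R b}"
  proof (cases "\<tau> = (\<lambda>_. 0)")
    case True
    then have "f x = 0" if "x \<in> V" for x using zero[of f x] f that by simp
    then have "syn \<tau> f = 0" by (rule syn_trivial)
    then show ?thesis by (simp only: zero_in_cspan)
  next
    case False
    have "syn \<tau> f = syn \<tau> (\<lambda>x. \<Sum>b\<in>V. (f b / 2) * pair \<eta> \<tau> b x)"
    proof (rule syn_cong)
      fix x assume "x \<in> V"
      then have "(\<Sum>b\<in>V. f b * pair \<eta> \<tau> b x) = 2 * f x" using sum_pair[of \<eta> \<tau> f x] f \<eta> \<tau> by blast
      moreover have "(\<Sum>b\<in>V. (f b / 2) * pair \<eta> \<tau> b x) = (\<Sum>b\<in>V. f b * pair \<eta> \<tau> b x) / 2"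
        by (simp add: sum_divide_distrib)
      ultimately show "f x = (\<Sum>b\<in>V. (f b / 2) * pair \<eta> \<tau> b x)" by simp
    qed
    also have "\<dots> = (\<Sum>b\<in>V. syn \<tau> (\<lambda>x. (f b / 2) * pair \<eta> \<tau> b x))" by (rule syn_sum)
    also have "\<dots> \<in> cspan {B (sg q a) (sg q b) | a b. b \<in> V0 \<and> a \<in> R b}"
    proof (rule csubspace_sum[OF csubspace_cspan])
      fix a assume a: "a \<in> V"
      show "syn \<tau> (\<lambda>x. (f a / 2) * pair \<eta> \<tau> a x) \<in> cspan {B (sg q a) (sg q b) | a b. b \<in> V0 \<and> a \<in> R b}"
      proof (cases "a \<in> R \<tau>")
        case True
        then obtain k where k: "k \<noteq> 0" "B (sg q a) (sg q (a \<boxplus> \<tau>)) = syn \<tau> (\<lambda>x. k * pair \<eta> \<tau> a x)"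
          using B a \<tau> by blast
        have "syn \<tau> (\<lambda>x. (f a / 2) * pair \<eta> \<tau> a x) = tsc (f a / 2 / k) (B (sg q a) (sg q (a \<boxplus> \<tau>)))"
          unfolding k(2) syn_scale[symmetric] by (rule syn_cong) (simp add: k(1))
        moreover have "a \<boxplus> \<tau> \<in> V0" "a \<in> R (a \<boxplus> \<tau>)" using R(1)[OF a _ True] \<tau> False a by auto
        then have "B (sg q a) (sg q (a \<boxplus> \<tau>)) \<in> {B (sg q a) (sg q b) | a b. b \<in> V0 \<and> a \<in> R b}"
          by (intro CollectI exI[of _ a] exI[of _ "a \<boxplus> \<tau>"]) (simp only: simp_thms)
        ultimately show ?thesis by (simp only: cspan_scale cspan_base)
      next
        case F: False
        then have "f a = 0" using f a supp_inD by blast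
        then show ?thesis using zero_in_cspan by (simp add: syn_zero)
      qed
    qed
    finally show ?thesis .
  qed
qed

lemma generators_eq:
  assumes S: "\<And>b. b \<in> V0 \<Longrightarrow> S (sg q b) = sg q ` R b"
  shows "{B \<sigma> \<tau> | \<sigma> \<tau>. \<tau> \<in> sig q \<and> \<sigma> \<in> S \<tau>} = {B (sg q a) (sg q b) | a b. b \<in> V0 \<and> a \<in> R b}"
proof (intro equalityI subsetI)
  fix x assume "x \<in> {B \<sigma> \<tau> | \<sigma> \<tau>. \<tau> \<in> sig q \<and> \<sigma> \<in> S \<tau>}"
  then obtain \<sigma> b where "x = B \<sigma> (sg q b)" "b \<in> V0" "\<sigma> \<in> S (sg q b)" unfolding sig_eq by auto
  moreover from this obtain a where "\<sigma> = sg q a" "a \<in> R b" using S by auto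
  ultimately show "x \<in> {B (sg q a) (sg q b) | a b. b \<in> V0 \<and> a \<in> R b}" by blast
next
  fix x assume "x \<in> {B (sg q a) (sg q b) | a b. b \<in> V0 \<and> a \<in> R b}"
  then obtain a b where ab: "x = B (sg q a) (sg q b)" "b \<in> V0" "a \<in> R b" by blast
  then have "sg q b \<in> sig q" "sg q a \<in> S (sg q b)" using S[OF ab(2)] unfolding sig_eq by auto
  then show "x \<in> {B \<sigma> \<tau> | \<sigma> \<tau>. \<tau> \<in> sig q \<and> \<sigma> \<in> S \<tau>}" using ab(1) by blast
qed

lemma Sset_eq: "{B \<sigma> \<tau> | \<sigma> \<tau>. \<tau> \<in> sig q \<and> \<sigma> \<in> Nset q \<tau>} = {B (sg q a) (sg q b) | a b. b \<in> V0 \<and> a \<in> anti_set b}"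
  "{B \<sigma> \<tau> | \<sigma> \<tau>. \<tau> \<in> sig q \<and> \<sigma> \<in> Cset q \<tau>} = {B (sg q a) (sg q b) | a b. b \<in> V0 \<and> a \<in> comm_set b}"
  by (rule generators_eq, simp add: Nset_eq) (rule generators_eq, simp add: Cset_eq)

lemma sg_as_nprod: "a \<in> V \<Longrightarrow> \<tau> \<in> V \<Longrightarrow> sg q (a \<boxplus> \<tau>) = msc (cnj (phase q a \<tau>)) (nprod q (sg q a) (sg q \<tau>))"
  by (simp add: nprod_sg msc_simps phase_simps(5))

lemma anti_zero: "supp_in anti_set (\<lambda>_. 0) f \<Longrightarrow> x \<in> V \<Longrightarrow> f x = 0"
  using supp_inD[of anti_set "\<lambda>_. 0" f x] by (auto simp: anti_set_def)

lemma V_A_br_eq: "V_A_br q = Wsp (part 12)"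
  unfolding V_A_br_def Sset_eq part_simps comm_skew_def[abs_def]
proof (rule cspan_pairs[OF natural_sets(1)])
  fix a \<tau> assume a: "a \<in> comm_set \<tau>" "a \<in> V" "\<tau> \<in> V"
  show "\<exists>k. k \<noteq> 0 \<and> Aasym (sg q a) (sg q (a \<boxplus> \<tau>)) = syn \<tau> (\<lambda>x. k * pair (-1) \<tau> a x)"
    unfolding sg_as_nprod[OF a(2,3)] Aasym_nprod[OF a(2,3)]
    using comm_setD[OF a(1)] phase_nonzero[of a \<tau>]
    by (intro exI[of _ "of_real (1 / sqrt 2) * cnj (phase q a \<tau>)"]) simp
next
  show "f x = 0" if "supp_in comm_set (\<lambda>_. 0) f" "periodic (-1) (\<lambda>_. 0) f" "x \<in> V" for f x
    using that by (simp add: periodic_def)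
qed (auto simp: comm_set_def eps_add eps_add2 add_move)

lemma V_S_cu_eq: "V_S_cu q = Wsp (\<lambda>\<tau> f. supp_in anti_set \<tau> f \<and> periodic (-1) \<tau> f)"
  unfolding V_S_cu_def Sset_eq
proof (rule cspan_pairs[OF natural_sets(2)])
  fix a \<tau> assume a: "a \<in> anti_set \<tau>" "a \<in> V" "\<tau> \<in> V"
  show "\<exists>k. k \<noteq> 0 \<and> Ssym (sg q a) (sg q (a \<boxplus> \<tau>)) = syn \<tau> (\<lambda>x. k * pair (-1) \<tau> a x)"
    unfolding sg_as_nprod[OF a(2,3)] Ssym_nprod[OF a(2,3)]
    using anti_setD[OF a(1)] phase_nonzero[of a \<tau>]
    by (intro exI[of _ "of_real (1 / sqrt 2) * cnj (phase q a \<tau>)"]) simp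
qed (auto simp: anti_set_def eps_add eps_add2 add_move anti_zero)

lemma V_A_cu_eq: "V_A_cu q = Wsp (\<lambda>\<tau> f. supp_in anti_set \<tau> f \<and> periodic 1 \<tau> f)"
  unfolding V_A_cu_def Sset_eq
proof (rule cspan_pairs[OF natural_sets(2)])
  fix a \<tau> assume a: "a \<in> anti_set \<tau>" "a \<in> V" "\<tau> \<in> V"
  show "\<exists>k. k \<noteq> 0 \<and> Aasym (sg q a) (sg q (a \<boxplus> \<tau>)) = syn \<tau> (\<lambda>x. k * pair 1 \<tau> a x)"
    unfolding sg_as_nprod[OF a(2,3)] Aasym_nprod[OF a(2,3)]
    using anti_setD[OF a(1)] phase_nonzero[of a \<tau>]
    by (intro exI[of _ "of_real (1 / sqrt 2) * cnj (phase q a \<tau>)"]) simp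
qed (auto simp: anti_set_def eps_add eps_add2 add_move anti_zero)

lemma tinner_syn: "tinner q (syn \<tau> f) T = (\<Sum>a\<in>V. cnj (f a) * fc T \<tau> a)"
  unfolding syn_def tinner_sum tinner_linear by (intro sum.cong refl) (simp add: fc_def)

text \<open>At each weight, orthogonality to the constants on \<open>anti_set \<tau>\<close> is the
  vanishing of the sum.\<close>

lemma V_adj_perp_eq: "V_adj_perp q = Wsp (part 13)"
  unfolding part_simps
proof (intro equalityI subsetI)
  fix T assume "T \<in> V_adj_perp q"
  then have T: "T \<in> Wsp (\<lambda>\<tau> f. supp_in anti_set \<tau> f \<and> periodic 1 \<tau> f)"
    and orth: "\<And>U. U \<in> Wsp (const_part False anti_set) \<Longrightarrow> tinner q U T = 0"
    unfolding V_adj_perp_def V_A_cu_eq V_adj_cu_eq part_simps by auto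
  have "zero_sum \<tau> (fc T \<tau>)" if \<tau>: "\<tau> \<in> V" for \<tau>
  proof -
    have "const_part False anti_set \<tau> (\<lambda>x. of_bool (x \<in> anti_set \<tau>))"
      by (simp add: const_part_def const_on_def supp_in_def orbit_type_anti)
    then have "tinner q (syn \<tau> (\<lambda>x. of_bool (x \<in> anti_set \<tau>))) T = 0"
      by (intro orth syn_Wsp[OF admissible_parts(1)[OF natural_sets(2)] \<tau>])
    moreover have "(\<Sum>a\<in>V. cnj (of_bool (a \<in> anti_set \<tau>)) * fc T \<tau> a) = sum (fc T \<tau>) V"
      using T \<tau> by (intro sum.cong refl) (auto simp: Wsp_def supp_in_def of_bool_def)
    ultimately show ?thesis by (simp add: tinner_syn zero_sum_def)
  qed
  then show "T \<in> Wsp anti_mean_zero" using T by (simp add: Wsp_def anti_mean_zero_def)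
next
  fix T assume T: "T \<in> Wsp anti_mean_zero"
  have "tinner q U T = 0" if U: "U \<in> Wsp (const_part False anti_set)" for U
  proof -
    have "tinner q (syn \<tau> (fc U \<tau>)) T = 0" if \<tau>: "\<tau> \<in> V" for \<tau>
    proof -
      have U\<tau>: "const_on anti_set \<tau> (fc U \<tau>)" and T\<tau>: "supp_in anti_set \<tau> (fc T \<tau>)" "sum (fc T \<tau>) V = 0"
        using U T \<tau> by (simp_all add: Wsp_def const_part_def anti_mean_zero_def zero_sum_def)
      obtain c where c: "\<forall>x. x \<in> anti_set \<tau> \<longrightarrow> fc U \<tau> x = c"
        using ex_common_value[of "\<lambda>x. x \<in> anti_set \<tau>" "fc U \<tau>"] U\<tau> unfolding const_on_def by blast
      have "tinner q (syn \<tau> (fc U \<tau>)) T = (\<Sum>a\<in>V. cnj c * fc T \<tau> a)"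
        unfolding tinner_syn using T\<tau>(1) c by (intro sum.cong refl) (auto simp: supp_in_def)
      then show ?thesis using T\<tau>(2) by (simp flip: sum_distrib_left)
    qed
    then have "tinner q (\<Sum>\<tau>\<in>V. syn \<tau> (fc U \<tau>)) T = 0" by (simp add: tinner_sum)
    then show ?thesis using sum_syn_fc[of U] U by (simp add: Wsp_def)
  qed
  then show "T \<in> V_adj_perp q"
    using T unfolding V_adj_perp_def V_A_cu_eq V_adj_cu_eq part_simps by (simp add: Wsp_def anti_mean_zero_def)
qed


text \<open>The indicator of the anticommuting points is \<open>(1 - comm_sign) / 2\<close>; its
  minus sign is the reason that \<open>V_lam q (- s)\<close> belongs to the eigenvalue
  \<open>s * D\<close>.\<close>

lemma sum_anti: "x \<in> V \<Longrightarrow> (\<Sum>b\<in>anti_set x. f b) = (sum f V - fourier f x) / 2"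
proof -
  assume x: "x \<in> V"
  have "2 * (\<Sum>b\<in>anti_set x. f b) = (\<Sum>b\<in>anti_set x. 2 * f b)" by (rule sum_distrib_left)
  also have "\<dots> = (\<Sum>b\<in>V. f b - comm_sign q x b * f b)"
    using anti_set_sub(3)[of x] eps_cases[of x] by (intro sum.mono_neutral_cong_left finite_V)
      (auto simp: anti_set_def eps_sym[of x])
  also have "\<dots> = sum f V - fourier f x" by (simp add: sum_subtractf fourier_def)
  finally show ?thesis by (simp add: mult.commute)
qed

lemma Wsp_orbit_zero:
  assumes adm: "admissible \<Phi>" and orb: "\<And>\<tau> f. \<Phi> \<tau> f \<Longrightarrow> orbit_type True \<tau> f"
  shows "Wsp \<Phi> = {syn (\<lambda>_. 0) f | f. \<Phi> (\<lambda>_. 0) f}"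
proof (intro equalityI subsetI)
  fix T assume T: "T \<in> Wsp \<Phi>"
  have "syn \<tau> (fc T \<tau>) = 0" if \<tau>: "\<tau> \<in> V - {\<lambda>_. 0}" for \<tau>
  proof (rule syn_trivial)
    have "\<Phi> \<tau> (fc T \<tau>)" using T \<tau> by (simp add: Wsp_def)
    then show "fc T \<tau> x = 0" if "x \<in> V" for x using orb[of \<tau> "fc T \<tau>"] that \<tau> by (auto simp: orbit_type_def)
  qed
  then have "(\<Sum>\<tau>\<in>V. syn \<tau> (fc T \<tau>)) = (\<Sum>\<tau>\<in>{\<lambda>_. 0}. syn \<tau> (fc T \<tau>))"
    by (intro sum.mono_neutral_right finite_V) (auto simp: pstrings_zero)
  then have "T = syn (\<lambda>_. 0) (fc T (\<lambda>_. 0))" using sum_syn_fc[of T] T by (simp add: Wsp_def)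
  moreover have "\<Phi> (\<lambda>_. 0) (fc T (\<lambda>_. 0))" using T zero_V by (simp only: Wsp_def mem_Collect_eq)
  ultimately show "T \<in> {syn (\<lambda>_. 0) f | f. \<Phi> (\<lambda>_. 0) f}" by blast
next
  fix T assume "T \<in> {syn (\<lambda>_. 0) f | f. \<Phi> (\<lambda>_. 0) f}"
  then obtain f where "T = syn (\<lambda>_. 0) f" "\<Phi> (\<lambda>_. 0) f" by blast
  then show "T \<in> Wsp \<Phi>" using syn_Wsp[OF adm zero_V] by simp
qed

text \<open>With \<open>f\<close> extended by 0 to the zero string, the condition on the total sum
  is the eigenvalue equation at that string, and the conditions on the sets \<open>Nset\<close> are
  the equations at the others.\<close>

lemma V_lam_eq:
  assumes s: "s = 1 \<or> s = -1"
  shows "V_lam q (- s) = Wsp (comm_eig True s)"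
proof -
  let ?z = "\<lambda>_. 0 :: nat"
  have cz: "comm_set ?z = V0" by (auto simp: comm_set_def)
  have eq: "(\<Sum>\<sigma>\<in>sig q. tsc (lam \<sigma>) (tens \<sigma> \<sigma>)) = syn ?z f"
    if "\<And>a. a \<in> V0 \<Longrightarrow> f a = lam (sg q a)" "f ?z = 0" for lam f
    unfolding sum_sig syn_def using that
    by (intro sum.mono_neutral_cong_left finite_V) (auto simp: phase_zero tsc_simps)
  have cond: "(\<Sum>\<sigma>\<in>sig q. lam \<sigma>) = 0 \<and>
      (\<forall>\<tau>\<in>sig q. (\<Sum>\<sigma>\<in>Nset q \<tau>. lam \<sigma>) = - s * (of_nat (2 ^ q) / 2) * lam \<tau>) \<longleftrightarrow> comm_eig True s ?z f"
    if f: "\<And>a. a \<in> V0 \<Longrightarrow> f a = lam (sg q a)" "f ?z = 0" for lam f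
  proof -
    have "sum f V = sum f V0" using f(2) by (intro sum.mono_neutral_right finite_V) auto
    also have "\<dots> = (\<Sum>\<sigma>\<in>sig q. lam \<sigma>)" using f(1) by (simp add: sum_sig)
    finally have sum: "(\<Sum>\<sigma>\<in>sig q. lam \<sigma>) = sum f V" ..
    have N: "(\<Sum>\<sigma>\<in>Nset q (sg q a). lam \<sigma>) = (sum f V - fourier f a) / 2" if a: "a \<in> V0" for a
    proof -
      have "(\<Sum>\<sigma>\<in>Nset q (sg q a). lam \<sigma>) = (\<Sum>b\<in>anti_set a. lam (sg q b))"
        using a Nset_eq[of a] sum_image_sg[OF anti_set_sub(3)[of a]] by simp
      also have "\<dots> = (\<Sum>b\<in>anti_set a. f b)" 
        by (rule sum.cong[OF refl], rule f(1)[symmetric], rule subsetD[OF anti_set_sub(1)])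
      finally show ?thesis using sum_anti a by simp
    qed
    have "comm_eig True s ?z f \<longleftrightarrow> (\<forall>a\<in>V. fourier f a = s * of_nat (2 ^ q) * f a)"
      using f(2) by (auto simp: comm_eig_def orbit_type_def supp_in_def cz periodic_def fourier_eig_def)
    also have "\<dots> \<longleftrightarrow> sum f V = 0 \<and> (\<forall>a\<in>V0. fourier f a = s * of_nat (2 ^ q) * f a)"
      using f(2) fourier_zero[of f] zero_V by (metis DiffD1 DiffI mult_zero_right singletonD)
    also have "\<dots> \<longleftrightarrow> sum f V = 0 \<and> (\<forall>a\<in>V0. (sum f V - fourier f a) / 2 = - s * (of_nat (2 ^ q) / 2) * f a)"
      by (intro conj_cong refl ball_cong) (auto simp: field_simps)
    also have "\<dots> \<longleftrightarrow> (\<Sum>\<sigma>\<in>sig q. lam \<sigma>) = 0 \<and>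
      (\<forall>\<tau>\<in>sig q. (\<Sum>\<sigma>\<in>Nset q \<tau>. lam \<sigma>) = - s * (of_nat (2 ^ q) / 2) * lam \<tau>)"
    proof -
      have "(\<forall>\<tau>\<in>sig q. P \<tau>) \<longleftrightarrow> (\<forall>a\<in>V0. P (sg q a))" for P unfolding sig_eq by blast
      then show ?thesis unfolding sum by (simp only: N f(1) cong: ball_cong)
    qed
    finally show ?thesis by blast
  qed
  have "V_lam q (- s) = {syn ?z f | f. comm_eig True s ?z f}"
  proof (intro equalityI subsetI)
    fix T assume "T \<in> V_lam q (- s)"
    then obtain lam where lam: "T = (\<Sum>\<sigma>\<in>sig q. tsc (lam \<sigma>) (tens \<sigma> \<sigma>))"
      "(\<Sum>\<sigma>\<in>sig q. lam \<sigma>) = 0 \<and> (\<forall>\<tau>\<in>sig q. (\<Sum>\<sigma>\<in>Nset q \<tau>. lam \<sigma>) = - s * (of_nat (2 ^ q) / 2) * lam \<tau>)"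
      unfolding V_lam_def by auto
    define f where "f a = (if a = ?z then 0 else lam (sg q a))" for a
    have f: "\<And>a. a \<in> V0 \<Longrightarrow> f a = lam (sg q a)" "f ?z = 0" by (auto simp: f_def)
    have "T = syn ?z f" unfolding lam(1) by (rule eq[of f lam, OF f])
    moreover have "comm_eig True s ?z f" using lam(2) cond[of f lam, OF f] by blast
    ultimately show "T \<in> {syn ?z f | f. comm_eig True s ?z f}" by blast
  next
    fix T assume "T \<in> {syn ?z f | f. comm_eig True s ?z f}"
    then obtain f where T: "T = syn ?z f" "comm_eig True s ?z f" by blast
    define lam where "lam \<sigma> = f (inv_into V (sg q) \<sigma>)" for \<sigma>
    have f: "f a = lam (sg q a)" if "a \<in> V0" for a using that inv_into_f_f[OF inj_sg] by (simp add: lam_def)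
    have f0: "f ?z = 0" using T(2) supp_inD[of comm_set ?z f ?z] by (simp add: comm_eig_def cz pstrings_zero)
    show "T \<in> V_lam q (- s)"
      unfolding V_lam_def mem_Collect_eq using T(1) eq[of f lam, OF f f0] cond[of f lam, OF f f0] T(2)
      by (intro exI[of _ lam]) auto
  qed
  also have "\<dots> = Wsp (comm_eig True s)"
    by (rule Wsp_orbit_zero[symmetric, OF admissible_parts(2)]) (simp add: comm_eig_def)
  finally show ?thesis .
qed

lemma V_1_eq: "V_1 q = Wsp (part 4)" and V_2_eq: "V_2 q = Wsp (part 5)"
  using V_lam_eq[of 1] V_lam_eq[of "-1"] by (simp_all add: V_1_def V_2_def part_simps)

lemma sum_tau_eq:
  assumes adm: "admissible \<Phi>" and K: "\<And>\<tau>. \<tau> \<in> V0 \<Longrightarrow> K (sg q \<tau>) = {syn \<tau> f | f. \<Phi> \<tau> f}"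
    and zero: "\<And>f x. \<Phi> (\<lambda>_. 0) f \<Longrightarrow> x \<in> V \<Longrightarrow> f x = 0"
  shows "sum_tau q K = Wsp \<Phi>"
proof (intro equalityI subsetI)
  fix T assume "T \<in> sum_tau q K"
  then obtain x where x: "\<forall>\<tau>\<in>sig q. x \<tau> \<in> K \<tau>" "T = (\<Sum>\<tau>\<in>sig q. x \<tau>)" unfolding sum_tau_def by auto
  have "x (sg q \<tau>) \<in> Wsp \<Phi>" if \<tau>: "\<tau> \<in> V0" for \<tau>
  proof -
    have "x (sg q \<tau>) \<in> K (sg q \<tau>)" using x(1) \<tau> unfolding sig_eq by blast
    then obtain f where f: "x (sg q \<tau>) = syn \<tau> f" "\<Phi> \<tau> f" unfolding K[OF \<tau>] by blast
    have "\<tau> \<in> V" using \<tau> by simp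
    then show ?thesis using syn_Wsp[of \<Phi> \<tau> f] adm f by (simp only:)
  qed
  then show "T \<in> Wsp \<Phi>" unfolding x(2) sum_sig by (rule csubspace_sum[OF csubspace_Wsp[OF adm]])
next
  fix T assume T: "T \<in> Wsp \<Phi>"
  then have \<Phi>T: "\<Phi> \<tau> (fc T \<tau>)" if "\<tau> \<in> V" for \<tau> using that by (simp add: Wsp_def)
  have "fc T (\<lambda>_. 0) x = 0" if "x \<in> V" for x
    using zero[of "fc T (\<lambda>_. 0)" x] \<Phi>T[OF zero_V] that by (simp only:)
  then have "syn (\<lambda>_. 0) (fc T (\<lambda>_. 0)) = 0" by (rule syn_trivial)
  then have "(\<Sum>\<tau>\<in>V. syn \<tau> (fc T \<tau>)) = (\<Sum>\<tau>\<in>V0. syn \<tau> (fc T \<tau>))"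
    by (intro sum.mono_neutral_right finite_V) auto
  also have "\<dots> = (\<Sum>\<tau>\<in>V0. (\<lambda>\<sigma>. syn (inv_into V (sg q) \<sigma>) (fc T (inv_into V (sg q) \<sigma>))) (sg q \<tau>))"
    by (intro sum.cong refl) (simp add: inv_into_f_f[OF inj_sg])
  finally have "T = (\<Sum>\<sigma>\<in>sig q. syn (inv_into V (sg q) \<sigma>) (fc T (inv_into V (sg q) \<sigma>)))"
    using sum_syn_fc[of T] T by (simp add: Wsp_def sum_sig)
  moreover have "syn (inv_into V (sg q) \<sigma>) (fc T (inv_into V (sg q) \<sigma>)) \<in> K \<sigma>" if \<sigma>: "\<sigma> \<in> sig q" for \<sigma>
  proof -
    obtain \<tau> where \<tau>: "\<tau> \<in> V0" "\<sigma> = sg q \<tau>" using \<sigma> unfolding sig_eq by blast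
    then have inv: "inv_into V (sg q) \<sigma> = \<tau>" by (simp add: inv_into_f_f[OF inj_sg])
    have "\<Phi> \<tau> (fc T \<tau>)" using \<Phi>T \<tau>(1) by simp
    then have "syn \<tau> (fc T \<tau>) \<in> K (sg q \<tau>)" unfolding K[OF \<tau>(1)] by blast
    then show ?thesis unfolding inv unfolding \<tau>(2) .
  qed
  ultimately show "T \<in> sum_tau q K" unfolding sum_tau_def by blast
qed

lemma sum_pair_general:
  assumes "\<tau> \<in> V" "x \<in> V"
  shows "(\<Sum>b\<in>V. g b * pair \<eta> \<tau> b x) = g x + \<eta> * g (x \<boxplus> \<tau>)"
proof -
  have "(\<Sum>b\<in>V. g b * pair \<eta> \<tau> b x) =
      (\<Sum>b\<in>V. g b * of_bool (b = x)) + \<eta> * (\<Sum>b\<in>V. g b * of_bool (b = x \<boxplus> \<tau>))"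
    unfolding pair_def sum_distrib_left sum.distrib[symmetric]
    by (intro sum.cong) (auto simp: algebra_simps of_bool_def add_move)
  then show ?thesis using assms by (simp add: sum_of_bool_mult)
qed

text \<open>Common form of \<open>K_br\<close> and \<open>K_cu\<close>: in the coordinates given by \<open>syn \<tau>\<close> the maps \<open>T_tau\<close> and
  \<open>A_tau\<close> have the kernel \<open>w\<close>.\<close>

lemma eigenspace_coordinates:
  fixes w :: "(nat \<Rightarrow> nat) \<Rightarrow> (nat \<Rightarrow> nat) \<Rightarrow> complex"
  assumes \<tau>: "\<tau> \<in> V" and R: "R \<subseteq> V" "\<And>x. x \<in> V \<Longrightarrow> x \<boxplus> \<tau> \<in> R \<longleftrightarrow> x \<in> R"
    and k: "k \<noteq> 0" and \<eta>: "\<eta> * \<eta> = 1"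
    and w: "\<And>a b. a \<in> R \<Longrightarrow> b \<in> R \<Longrightarrow> w a (b \<boxplus> \<tau>) = \<eta> * w a b \<and> w (a \<boxplus> \<tau>) b = \<eta> * w a b"
    and S: "\<And>a. a \<in> R \<Longrightarrow> S (sg q a) = syn \<tau> (\<lambda>x. k * pair \<eta> \<tau> a x)"
    and G: "\<And>a. a \<in> R \<Longrightarrow> G (sg q a) = (\<Sum>b\<in>R. tsc (w a b) (S (sg q b)))"
  shows "{\<Sum>\<sigma>\<in>sg q ` R. tsc (c \<sigma>) (S \<sigma>) | c.
      (\<Sum>\<sigma>\<in>sg q ` R. tsc (c \<sigma>) (G \<sigma>)) = tsc \<mu> (\<Sum>\<sigma>\<in>sg q ` R. tsc (c \<sigma>) (S \<sigma>))} =
    {syn \<tau> f | f. supp_in (\<lambda>_. R) \<tau> f \<and> periodic \<eta> \<tau> f \<and> (\<forall>x\<in>R. (\<Sum>a\<in>R. w a x * f a) = \<mu> * f x)}"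
    (is "{?A c | c. ?P c} = ?B")
proof -
  \<comment> \<open>The tensors \<open>S\<close> at \<open>a\<close> and
    \<open>a \<boxplus> \<tau>\<close> agree up to \<eta>, so the coefficients \<open>c\<close> are
    not unique; \<open>F c\<close> is the function of the resulting tensor.\<close>
  define F where "F c x = k * (of_bool (x \<in> R) * (c (sg q x) + \<eta> * c (sg q (x \<boxplus> \<tau>))))"
    for c :: "cmat \<Rightarrow> complex" and x
  have comb: "(\<Sum>b\<in>R. d b * (k * pair \<eta> \<tau> b x)) = k * (of_bool (x \<in> R) * (d x + \<eta> * d (x \<boxplus> \<tau>)))"
    if x: "x \<in> V" for d x
  proof -
    have "(\<Sum>b\<in>R. d b * (k * pair \<eta> \<tau> b x)) = (\<Sum>b\<in>V. (k * (of_bool (b \<in> R) * d b)) * pair \<eta> \<tau> b x)"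
      using R(1) by (intro sum.mono_neutral_cong_left finite_V) auto
    also have "\<dots> = k * (of_bool (x \<in> R) * d x) + \<eta> * (k * (of_bool (x \<boxplus> \<tau> \<in> R) * d (x \<boxplus> \<tau>)))"
      by (rule sum_pair_general[OF \<tau> x])
    finally show ?thesis using R(2)[OF x] by (simp add: algebra_simps)
  qed
  have A: "?A c = syn \<tau> (F c)" for c
  proof -
    have "?A c = (\<Sum>b\<in>R. syn \<tau> (\<lambda>x. c (sg q b) * (k * pair \<eta> \<tau> b x)))"
      unfolding sum_image_sg[OF R(1)] syn_scale[of \<tau> "c (sg q b)" for b] using S by (intro sum.cong refl) simp
    also have "\<dots> = syn \<tau> (F c)"
      unfolding syn_sum[symmetric] by (intro syn_cong) (simp only: comb F_def)
    finally show ?thesis .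
  qed
  have Lw: "(\<Sum>b\<in>R. w a b * (k * pair \<eta> \<tau> b x)) = k * (of_bool (x \<in> R) * (2 * w a x))"
    if a: "a \<in> R" and x: "x \<in> V" for a x
  proof -
    have "\<eta> * w a (x \<boxplus> \<tau>) = w a x" if "x \<in> R"
      using w[OF a that] \<eta> by (simp flip: mult.assoc)
    then show ?thesis unfolding comb[OF x] by (cases "x \<in> R") simp_all
  qed
  have Gs: "G (sg q a) = syn \<tau> (\<lambda>x. k * (of_bool (x \<in> R) * (2 * w a x)))" if a: "a \<in> R" for a
  proof -
    have "G (sg q a) = (\<Sum>b\<in>R. syn \<tau> (\<lambda>x. w a b * (k * pair \<eta> \<tau> b x)))"
      unfolding G[OF a] syn_scale[of \<tau> "w a b" for b] using S by (intro sum.cong refl) simp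
    also have "\<dots> = syn \<tau> (\<lambda>x. k * (of_bool (x \<in> R) * (2 * w a x)))"
      unfolding syn_sum[symmetric] using Lw[OF a] by (intro syn_cong)
    finally show ?thesis .
  qed
  \<comment> \<open>The two terms of \<open>F c\<close> contribute equally because \<open>w\<close>
    has the same periodicity; this produces the factor 2 that also occurs in
    \<open>Gs\<close>.\<close>
  have half_sum: "(\<Sum>a\<in>R. w a x * F c a) = k * (\<Sum>a\<in>R. 2 * (c (sg q a) * w a x))" if x: "x \<in> R" for x c
  proof -
    have sh: "(\<Sum>a\<in>R. h (a \<boxplus> \<tau>)) = sum h R" for h :: "(nat \<Rightarrow> nat) \<Rightarrow> complex"
      using R by (intro sum.reindex_bij_witness[of _ "\<lambda>a. a \<boxplus> \<tau>" "\<lambda>a. a \<boxplus> \<tau>"]) auto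
    have "(\<Sum>a\<in>R. w a x * F c a) = (\<Sum>a\<in>R. k * (c (sg q a) * w a x) + k * (c (sg q (a \<boxplus> \<tau>)) * w (a \<boxplus> \<tau>) x))"
      by (intro sum.cong refl) (simp add: F_def w x algebra_simps)
    also have "\<dots> = (\<Sum>a\<in>R. k * (c (sg q a) * w a x)) + (\<Sum>a\<in>R. k * (c (sg q a) * w a x))"
      unfolding sum.distrib using sh[of "\<lambda>a. k * (c (sg q a) * w a x)"] by simp
    finally show ?thesis by (simp add: sum_distrib_left algebra_simps flip: sum.distrib)
  qed
  have GA: "(\<Sum>\<sigma>\<in>sg q ` R. tsc (c \<sigma>) (G \<sigma>)) = syn \<tau> (\<lambda>x. of_bool (x \<in> R) * (\<Sum>a\<in>R. w a x * F c a))" for c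
  proof -
    have "(\<Sum>\<sigma>\<in>sg q ` R. tsc (c \<sigma>) (G \<sigma>)) =
        (\<Sum>a\<in>R. syn \<tau> (\<lambda>x. c (sg q a) * (k * (of_bool (x \<in> R) * (2 * w a x)))))"
      unfolding sum_image_sg[OF R(1)] syn_scale[of \<tau> "c (sg q b)" for b] using Gs by (intro sum.cong refl) simp
    also have "\<dots> = syn \<tau> (\<lambda>x. of_bool (x \<in> R) * (\<Sum>a\<in>R. w a x * F c a))"
      unfolding syn_sum[symmetric]
    proof (rule syn_cong)
      fix x
      show "(\<Sum>a\<in>R. c (sg q a) * (k * (of_bool (x \<in> R) * (2 * w a x)))) = of_bool (x \<in> R) * (\<Sum>a\<in>R. w a x * F c a)"
      proof (cases "x \<in> R")
        case True
        have "(\<Sum>a\<in>R. c (sg q a) * (k * (of_bool (x \<in> R) * (2 * w a x)))) = k * (\<Sum>a\<in>R. 2 * (c (sg q a) * w a x))"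
          using True by (simp add: sum_distrib_left mult_ac)
        then show ?thesis using half_sum[OF True, of c] True by simp
      qed simp
    qed
    finally show ?thesis .
  qed
  have P: "?P c \<longleftrightarrow> (\<forall>x\<in>R. (\<Sum>a\<in>R. w a x * F c a) = \<mu> * F c x)" for c
    unfolding GA A syn_scale[symmetric] syn_eq_iff[OF \<tau>] using R(1) by (auto simp: F_def)
  have FR: "supp_in (\<lambda>_. R) \<tau> (F c) \<and> periodic \<eta> \<tau> (F c)" for c
  proof -
    have "\<eta> * (\<eta> * y) = y" for y using \<eta> by (simp flip: mult.assoc)
    then show ?thesis using R(2) by (auto simp: supp_in_def periodic_def F_def algebra_simps)
  qed
  have surj: "\<exists>c. \<forall>x\<in>V. F c x = f x" if f: "supp_in (\<lambda>_. R) \<tau> f" "periodic \<eta> \<tau> f" for f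
  proof -
    \<comment> \<open>The 2 compensates for the equal contributions of \<open>x\<close> and
      \<open>x \<boxplus> \<tau>\<close>.\<close>
    define c where "c \<sigma> = f (inv_into V (sg q) \<sigma>) / (2 * k)" for \<sigma>
    have c: "c (sg q x) = f x / (2 * k)" if "x \<in> V" for x using that by (simp add: c_def inv_into_f_f[OF inj_sg])
    have "F c x = f x" if x: "x \<in> V" for x
    proof (cases "x \<in> R")
      case True
      have "\<eta> * f (x \<boxplus> \<tau>) = f x" using f(2) x \<eta> by (simp add: periodic_def flip: mult.assoc)
      then have "c (sg q x) + \<eta> * c (sg q (x \<boxplus> \<tau>)) = f x / k"
        using x \<tau> k by (simp add: c field_simps)
      then show ?thesis using True k by (simp add: F_def)
    next
      case False
      then show ?thesis using f(1) x by (auto simp: F_def supp_in_def)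
    qed
    then show ?thesis by blast
  qed
  show ?thesis
  proof (intro equalityI subsetI)
    fix T assume "T \<in> {?A c | c. ?P c}"
    then obtain c where "T = syn \<tau> (F c)" "\<forall>x\<in>R. (\<Sum>a\<in>R. w a x * F c a) = \<mu> * F c x"
      unfolding P unfolding A by blast
    then show "T \<in> ?B" using FR[of c] by blast
  next
    fix T assume "T \<in> ?B"
    then obtain f where f: "T = syn \<tau> f" "supp_in (\<lambda>_. R) \<tau> f" "periodic \<eta> \<tau> f"
      "\<forall>x\<in>R. (\<Sum>a\<in>R. w a x * f a) = \<mu> * f x" by blast
    obtain c where c: "\<forall>x\<in>V. F c x = f x" using surj[OF f(2,3)] by blast
    have "T = ?A c" unfolding A f(1) using c by (intro syn_cong) simp
    moreover have "?P c" unfolding P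
    proof
      fix x assume x: "x \<in> R"
      have "(\<Sum>a\<in>R. w a x * F c a) = (\<Sum>a\<in>R. w a x * f a)" using c R(1) by (intro sum.cong refl) auto
      then show "(\<Sum>a\<in>R. w a x * F c a) = \<mu> * F c x" using f(4) x c R(1) by auto
    qed
    ultimately show "T \<in> {?A c | c. ?P c}" by blast
  qed
qed

lemma sum_eps_anti:
  assumes "supp_in R \<tau> f" "R \<tau> \<subseteq> V"
  shows "(\<Sum>a\<in>R \<tau>. comm_sign q a x * f a) = fourier f x"
  unfolding fourier_def using assms
  by (intro sum.mono_neutral_cong_left finite_V) (auto simp: supp_in_def eps_sym[of x])

text \<open>The two sums of \<open>Agen\<close> merge into the Fourier kernel restricted to
  \<open>anti_set \<tau>\<close>. Elsewhere both sides of the eigenvalue equation vanish, so the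
  restriction loses nothing.\<close>

lemma K_cu_eq:
  assumes \<tau>: "\<tau> \<in> V0"
  shows "K_cu q (sg q \<tau>) (s * of_nat (2 ^ q)) = {syn \<tau> f | f. anti_eig s \<tau> f}"
proof -
  have \<tau>V: "\<tau> \<in> V" using \<tau> by simp
  define S where "S \<sigma> = Ssym \<sigma> (msc \<i> (nprod q \<sigma> (sg q \<tau>)))" for \<sigma>
  have G: "Agen q (sg q \<tau>) (sg q a) = (\<Sum>b\<in>anti_set \<tau>. tsc (comm_sign q a b) (S (sg q b)))"
    if a: "a \<in> anti_set \<tau>" for a
  proof -
    have aV: "a \<in> V" using a anti_setD by blast
    have c: "{\<rho> \<in> Nset q (sg q \<tau>). mmult q \<rho> (sg q a) = mmult q (sg q a) \<rho>} = sg q ` {b \<in> anti_set \<tau>. comm_sign q b a = 1}"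
      unfolding Nset_eq[OF \<tau>V] using sg_commute_iff[OF _ aV] anti_set_sub(3)[of \<tau>] by auto
    have n: "Nset q (sg q \<tau>) \<inter> Nset q (sg q a) = sg q ` {b \<in> anti_set \<tau>. comm_sign q b a = -1}"
      unfolding Nset_eq[OF \<tau>V] Nset_eq[OF aV] inj_on_image_Int[OF inj_sg anti_set_sub(3) anti_set_sub(3), symmetric]
      by (rule arg_cong[where f = "image (sg q)"]) (auto simp: anti_set_def)
    have fin: "finite (anti_set \<tau>)" using finite_subset[OF anti_set_sub(3) finite_V] .
    have "Agen q (sg q \<tau>) (sg q a) = (\<Sum>b\<in>{b \<in> anti_set \<tau>. comm_sign q b a = 1}. S (sg q b))
        - (\<Sum>b\<in>{b \<in> anti_set \<tau>. comm_sign q b a = -1}. S (sg q b))"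
    proof -
      have "{b \<in> anti_set \<tau>. comm_sign q b a = 1} \<subseteq> V" "{b \<in> anti_set \<tau>. comm_sign q b a = -1} \<subseteq> V"
        using anti_set_sub(3)[of \<tau>] by auto
      then show ?thesis unfolding Agen_def c n S_def by (simp only: sum_image_sg)
    qed
    also have "\<dots> = (\<Sum>b\<in>anti_set \<tau>. (if comm_sign q b a = 1 then S (sg q b) else 0)
        - (if comm_sign q b a = -1 then S (sg q b) else 0))"
      unfolding sum_subtractf using fin by (simp only: sum.inter_filter)
    also have "\<dots> = (\<Sum>b\<in>anti_set \<tau>. tsc (comm_sign q a b) (S (sg q b)))"
    proof (intro sum.cong refl)
      fix b
      show "(if comm_sign q b a = 1 then S (sg q b) else 0) - (if comm_sign q b a = -1 then S (sg q b) else 0)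
          = tsc (comm_sign q a b) (S (sg q b))"
        using eps_cases[of b a] by (auto simp: eps_sym[of a] tsc_simps)
    qed
    finally show ?thesis .
  qed
  have "K_cu q (sg q \<tau>) (s * of_nat (2 ^ q)) = {\<Sum>\<sigma>\<in>sg q ` anti_set \<tau>. tsc (c \<sigma>) (S \<sigma>) | c.
      (\<Sum>\<sigma>\<in>sg q ` anti_set \<tau>. tsc (c \<sigma>) (Agen q (sg q \<tau>) \<sigma>)) = tsc (s * of_nat (2 ^ q)) (\<Sum>\<sigma>\<in>sg q ` anti_set \<tau>. tsc (c \<sigma>) (S \<sigma>))}"
    unfolding K_cu_def Nset_eq[OF \<tau>V] S_def ..
  also have "\<dots> = {syn \<tau> f | f. supp_in (\<lambda>_. anti_set \<tau>) \<tau> f \<and> periodic (-1) \<tau> f \<and>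
      (\<forall>x\<in>anti_set \<tau>. (\<Sum>a\<in>anti_set \<tau>. comm_sign q a x * f a) = s * of_nat (2 ^ q) * f x)}"
  proof (rule eigenspace_coordinates[OF \<tau>V anti_set_sub(3), where k = "of_real (1 / sqrt 2) * \<i>"])
    show "x \<in> V \<Longrightarrow> (x \<boxplus> \<tau> \<in> anti_set \<tau>) = (x \<in> anti_set \<tau>)" for x by (rule anti_set_shift_iff[OF _ \<tau>V])
    show "comm_sign q a (b \<boxplus> \<tau>) = - 1 * comm_sign q a b \<and> comm_sign q (a \<boxplus> \<tau>) b = - 1 * comm_sign q a b"
      if "a \<in> anti_set \<tau>" "b \<in> anti_set \<tau>" for a b
      using anti_setD[OF that(1)] anti_setD[OF that(2)] by (simp add: eps_add eps_add2)
    show "S (sg q a) = syn \<tau> (\<lambda>x. of_real (1 / sqrt 2) * \<i> * pair (-1) \<tau> a x)" if "a \<in> anti_set \<tau>" for a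
      using Ssym_nprod[of a \<tau> \<i>] anti_setD[OF that] \<tau>V by (simp only: S_def)
    show "a \<in> anti_set \<tau> \<Longrightarrow> Agen q (sg q \<tau>) (sg q a) = (\<Sum>b\<in>anti_set \<tau>. tsc (comm_sign q a b) (S (sg q b)))" for a
      by (rule G)
  qed simp_all
  also have "\<dots> = {syn \<tau> f | f. anti_eig s \<tau> f}"
  proof -
    have "(supp_in (\<lambda>_. anti_set \<tau>) \<tau> f \<and> periodic (-1) \<tau> f \<and>
      (\<forall>x\<in>anti_set \<tau>. (\<Sum>a\<in>anti_set \<tau>. comm_sign q a x * f a) = s * of_nat (2 ^ q) * f x)) \<longleftrightarrow> anti_eig s \<tau> f" for f
    proof (cases "supp_in anti_set \<tau> f \<and> periodic (-1) \<tau> f")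
      case True
      have "fourier f x = s * of_nat (2 ^ q) * f x" if "x \<in> V" "x \<notin> anti_set \<tau>" for x
        using that True fourier_periodic_zero[of "-1" \<tau> f x] \<tau>V by (auto simp: supp_in_def anti_set_def)
      then have "(\<forall>x\<in>anti_set \<tau>. fourier f x = s * of_nat (2 ^ q) * f x) \<longleftrightarrow> fourier_eig s \<tau> f"
        unfolding fourier_eig_def using anti_set_sub(3)[of \<tau>] by blast
      then show ?thesis
        using True sum_eps_anti[of anti_set \<tau> f] anti_set_sub(3)[of \<tau>] by (simp add: anti_eig_def supp_in_def)
    next
      case False
      then show ?thesis by (auto simp: anti_eig_def supp_in_def)
    qed
    then show ?thesis by simp
  qed
  finally show ?thesis .
qed

text \<open>The obstacle is that the sum of \<open>f\<close> appears in the equation and must be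
  shown to vanish. Testing against \<open>1 + comm_sign q \<tau> x\<close> gives
  \<open>sum f V * (D * (D + 2 * s)) = 0\<close> with \<open>D = 2^q\<close>, and
  \<open>q \<ge> 2\<close> makes \<open>D + 2 * s\<close> nonzero.\<close>

lemma fourier_eig_comm_iff:
  assumes \<tau>: "\<tau> \<in> V0" and s: "s = 1 \<or> s = -1" and q: "q \<ge> 2"
    and f: "supp_in comm_set \<tau> f" "periodic 1 \<tau> f"
  shows "(\<forall>x\<in>comm_set \<tau>. sum f V - fourier f x = - (s * of_nat (2 ^ q) * f x)) \<longleftrightarrow> fourier_eig s \<tau> f"
proof
  have \<tau>V: "\<tau> \<in> V" using \<tau> by simp
  have f0: "f (\<lambda>_. 0) = 0" "f \<tau> = 0" using f(1) \<tau>V by (auto simp: supp_in_def comm_set_def)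
  have ft: "fourier f \<tau> = sum f V"
    using fourier_shift[OF f(1), of 1 "\<lambda>_. 0"] comm_setD by (simp add: fourier_zero)
  {
    assume "fourier_eig s \<tau> f"
    then show "\<forall>x\<in>comm_set \<tau>. sum f V - fourier f x = - (s * of_nat (2 ^ q) * f x)"
      using fourier_eig_sum[of s \<tau> f] f0 anti_set_sub(4)[of \<tau>] by (auto simp: fourier_eig_def)
  next
    assume eq: "\<forall>x\<in>comm_set \<tau>. sum f V - fourier f x = - (s * of_nat (2 ^ q) * f x)"
    let ?d = "of_nat (2 ^ q) :: complex"
    \<comment> \<open>The defect of the equation: zero at the zero string, at \<tau> and on
      \<open>comm_set \<tau>\<close>. The factor \<open>1 + comm_sign q \<tau> x\<close> removes the
      remaining points.\<close>
    define h where "h x = sum f V - fourier f x + s * ?d * f x" for x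
    have "(\<Sum>x\<in>V. (1 + comm_sign q \<tau> x) * h x) = 0"
    proof (rule sum.neutral, rule ballI)
      fix x assume x: "x \<in> V"
      consider "x = (\<lambda>_. 0)" | "x = \<tau>" | "x \<in> comm_set \<tau>" | "comm_sign q \<tau> x = -1"
        using x eps_cases[of \<tau> x] by (auto simp: comm_set_def eps_sym[of \<tau>])
      then show "(1 + comm_sign q \<tau> x) * h x = 0"
      proof cases
        case 1 then show ?thesis using f0 by (simp add: h_def fourier_zero)
      next
        case 2 then show ?thesis using f0 ft by (simp add: h_def)
      next
        case 3
        then have "h x = 0" using eq by (simp add: h_def)
        then show ?thesis by simp
      qed simp
    qed
    also have "(\<Sum>x\<in>V. (1 + comm_sign q \<tau> x) * h x) = sum f V * (\<Sum>x\<in>V. 1 + comm_sign q \<tau> x)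
        - (\<Sum>x\<in>V. (1 + comm_sign q \<tau> x) * fourier f x) + s * ?d * (\<Sum>x\<in>V. (1 + comm_sign q \<tau> x) * f x)"
      unfolding h_def sum_distrib_left sum.distrib[symmetric] sum_subtractf[symmetric]
      by (intro sum.cong refl) (simp add: algebra_simps)
    also have "(\<Sum>x\<in>V. 1 + comm_sign q \<tau> x) = ?d ^ 2"
      using sum_eps2[OF \<tau>V] \<tau> card_V by (simp add: sum.distrib)
    also have "(\<Sum>x\<in>V. (1 + comm_sign q \<tau> x) * fourier f x) = fourier (fourier f) (\<lambda>_. 0) + fourier (fourier f) \<tau>"
      by (simp add: fourier_def[of "fourier f"] distrib_right sum.distrib)
    \<comment> \<open>A double transform is a multiple of \<open>f\<close>, which vanishes at both
      points.\<close>
    also have "\<dots> = 0" using f0 \<tau>V by (simp add: fourier_fourier)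
    also have "(\<Sum>x\<in>V. (1 + comm_sign q \<tau> x) * f x) = fourier f (\<lambda>_. 0) + fourier f \<tau>"
      by (simp add: fourier_def distrib_right sum.distrib)
    also have "\<dots> = 2 * sum f V" by (simp add: ft fourier_zero)
    finally have "sum f V * (?d * (?d + 2 * s)) = 0" by (simp add: algebra_simps power2_eq_square)
    moreover have "?d + 2 * s \<noteq> 0"
    proof -
      have "2 ^ 2 \<le> (2 :: real) ^ q" using q by (intro power_increasing) auto
      then have "Re (?d + 2 * s) \<noteq> 0" using s by auto
      then show ?thesis by (metis zero_complex.simps(1))
    qed
    ultimately have S0: "sum f V = 0" by simp
    show "fourier_eig s \<tau> f"
      unfolding fourier_eig_def
    proof
      fix x assume x: "x \<in> V"
      consider "x = (\<lambda>_. 0)" | "x = \<tau>" | "x \<in> comm_set \<tau>" | "comm_sign q x \<tau> = -1"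
        using x eps_cases[of x \<tau>] by (auto simp: comm_set_def)
      then show "fourier f x = s * ?d * f x"
      proof cases
        case 1 then show ?thesis using f0 S0 by (simp add: fourier_zero)
      next
        case 2 then show ?thesis using f0 S0 ft by simp
      next
        case 3 then show ?thesis using eq S0 by simp
      next
        case 4
        then have "f x = 0" using f(1) x by (auto simp: supp_in_def comm_set_def)
        then show ?thesis using fourier_periodic_zero[OF f(2) \<tau>V] 4 by simp
      qed
    qed
  }
qed

text \<open>The factor 1/2 in \<open>Tgen\<close> times the indicator
  \<open>(1 - comm_sign) / 2\<close> is the kernel \<open>w\<close>. Once the sum of
  \<open>f\<close> vanishes, its eigenvalue \<open>- s * D / 4\<close> is the eigenvalue
  \<open>s * D\<close> of the transform.\<close>

lemma K_br_eq:
  assumes \<tau>: "\<tau> \<in> V0" and s: "s = 1 \<or> s = -1" and q: "q \<ge> 2"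
  shows "K_br q (sg q \<tau>) (- (s * of_nat (2 ^ q)) / 4) = {syn \<tau> f | f. comm_eig False s \<tau> f}"
proof -
  have \<tau>V: "\<tau> \<in> V" using \<tau> by simp
  define S where "S \<sigma> = Ssym \<sigma> (nprod q \<sigma> (sg q \<tau>))" for \<sigma>
  define w where "w a b = (1 - comm_sign q a b) / 4" for a b
  have G: "Tgen q (sg q \<tau>) (sg q a) = (\<Sum>b\<in>comm_set \<tau>. tsc (w a b) (S (sg q b)))"
    if a: "a \<in> comm_set \<tau>" for a
  proof -
    have aV: "a \<in> V" using a comm_setD by blast
    have n: "Cset q (sg q \<tau>) \<inter> Nset q (sg q a) = sg q ` {b \<in> comm_set \<tau>. comm_sign q b a = -1}"
      unfolding Cset_eq[OF \<tau>V] Nset_eq[OF aV] inj_on_image_Int[OF inj_sg anti_set_sub(4) anti_set_sub(3), symmetric]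
      by (rule arg_cong[where f = "image (sg q)"]) (auto simp: anti_set_def comm_set_def)
    have fin: "finite (comm_set \<tau>)" using finite_subset[OF anti_set_sub(4) finite_V] .
    have "Tgen q (sg q \<tau>) (sg q a) = tsc (1 / 2) (\<Sum>b\<in>{b \<in> comm_set \<tau>. comm_sign q b a = -1}. S (sg q b))"
    proof -
      have "{b \<in> comm_set \<tau>. comm_sign q b a = -1} \<subseteq> V" using anti_set_sub(4)[of \<tau>] by auto
      then show ?thesis unfolding Tgen_def n S_def by (simp only: sum_image_sg)
    qed
    also have "\<dots> = (\<Sum>b\<in>comm_set \<tau>. tsc (1 / 2) (if comm_sign q b a = -1 then S (sg q b) else 0))"
      unfolding tsc_sum[symmetric] using fin by (simp only: sum.inter_filter)
    also have "\<dots> = (\<Sum>b\<in>comm_set \<tau>. tsc (w a b) (S (sg q b)))"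
    proof (intro sum.cong refl)
      fix b
      show "tsc (1 / 2) (if comm_sign q b a = -1 then S (sg q b) else 0) = tsc (w a b) (S (sg q b))"
        using eps_cases[of b a] by (auto simp: eps_sym[of a] tsc_simps w_def)
    qed
    finally show ?thesis .
  qed
  have wf: "(\<Sum>a\<in>comm_set \<tau>. w a x * f a) = (sum f V - fourier f x) / 4" if "supp_in comm_set \<tau> f" for f x
  proof -
    have "sum f (comm_set \<tau>) = sum f V"
      using that anti_set_sub(4)[of \<tau>] by (intro sum.mono_neutral_left finite_V) (auto simp: supp_in_def)
    moreover have "(\<Sum>a\<in>comm_set \<tau>. w a x * f a) = (sum f (comm_set \<tau>) - (\<Sum>a\<in>comm_set \<tau>. comm_sign q a x * f a)) / 4"
      by (simp add: w_def left_diff_distrib diff_divide_distrib sum_subtractf sum_divide_distrib)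
    ultimately show ?thesis using sum_eps_anti[of comm_set \<tau> f x] that anti_set_sub(4)[of \<tau>] by simp
  qed
  have "K_br q (sg q \<tau>) (- (s * of_nat (2 ^ q)) / 4) = {\<Sum>\<sigma>\<in>sg q ` comm_set \<tau>. tsc (c \<sigma>) (S \<sigma>) | c.
      (\<Sum>\<sigma>\<in>sg q ` comm_set \<tau>. tsc (c \<sigma>) (Tgen q (sg q \<tau>) \<sigma>)) = tsc (- (s * of_nat (2 ^ q)) / 4) (\<Sum>\<sigma>\<in>sg q ` comm_set \<tau>. tsc (c \<sigma>) (S \<sigma>))}"
    unfolding K_br_def Cset_eq[OF \<tau>V] S_def ..
  also have "\<dots> = {syn \<tau> f | f. supp_in (\<lambda>_. comm_set \<tau>) \<tau> f \<and> periodic 1 \<tau> f \<and>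
      (\<forall>x\<in>comm_set \<tau>. (\<Sum>a\<in>comm_set \<tau>. w a x * f a) = - (s * of_nat (2 ^ q)) / 4 * f x)}"
  proof (rule eigenspace_coordinates[OF \<tau>V anti_set_sub(4), where k = "of_real (1 / sqrt 2)"])
    show "x \<in> V \<Longrightarrow> (x \<boxplus> \<tau> \<in> comm_set \<tau>) = (x \<in> comm_set \<tau>)" for x by (rule comm_set_shift_iff[OF _ \<tau>V])
    show "w a (b \<boxplus> \<tau>) = 1 * w a b \<and> w (a \<boxplus> \<tau>) b = 1 * w a b"
      if "a \<in> comm_set \<tau>" "b \<in> comm_set \<tau>" for a b
      using comm_setD[OF that(1)] comm_setD[OF that(2)] by (simp add: w_def eps_add eps_add2)
    show "S (sg q a) = syn \<tau> (\<lambda>x. of_real (1 / sqrt 2) * pair 1 \<tau> a x)" if "a \<in> comm_set \<tau>" for a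
      using Ssym_nprod[of a \<tau> 1] comm_setD[OF that] \<tau>V by (simp only: S_def msc_simps mult_1_right)
    show "a \<in> comm_set \<tau> \<Longrightarrow> Tgen q (sg q \<tau>) (sg q a) = (\<Sum>b\<in>comm_set \<tau>. tsc (w a b) (S (sg q b)))" for a
      by (rule G)
  qed simp_all
  also have "\<dots> = {syn \<tau> f | f. comm_eig False s \<tau> f}"
  proof -
    have "(supp_in (\<lambda>_. comm_set \<tau>) \<tau> f \<and> periodic 1 \<tau> f \<and>
      (\<forall>x\<in>comm_set \<tau>. (\<Sum>a\<in>comm_set \<tau>. w a x * f a) = - (s * of_nat (2 ^ q)) / 4 * f x)) \<longleftrightarrow> comm_eig False s \<tau> f" for f
    proof (cases "supp_in comm_set \<tau> f \<and> periodic 1 \<tau> f")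
      case True
      have "(\<forall>x\<in>comm_set \<tau>. (\<Sum>a\<in>comm_set \<tau>. w a x * f a) = - (s * of_nat (2 ^ q)) / 4 * f x) \<longleftrightarrow>
          (\<forall>x\<in>comm_set \<tau>. sum f V - fourier f x = - (s * of_nat (2 ^ q) * f x))"
      proof (intro ball_cong refl)
        fix x
        have "A / 4 = - B / 4 * y \<longleftrightarrow> A = - (B * y)" for A B y :: complex by auto
        then show "(\<Sum>a\<in>comm_set \<tau>. w a x * f a) = - (s * of_nat (2 ^ q)) / 4 * f x \<longleftrightarrow>
            sum f V - fourier f x = - (s * of_nat (2 ^ q) * f x)"
          using wf[of f x] True by (simp only: simp_thms)
      qed
      also have "\<dots> \<longleftrightarrow> fourier_eig s \<tau> f" using fourier_eig_comm_iff[OF \<tau> s q] True by blast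
      finally show ?thesis using True \<tau> by (simp add: comm_eig_def supp_in_def orbit_type_def)
    next
      case False
      then show ?thesis by (auto simp: comm_eig_def supp_in_def)
    qed
    then show ?thesis by simp
  qed
  finally show ?thesis .
qed

lemma V_br_eq: "q \<ge> 2 \<Longrightarrow> V_br1 q = Wsp (part 7)" "q \<ge> 2 \<Longrightarrow> V_br2 q = Wsp (part 8)"
proof -
  assume q: "q \<ge> 2"
  have zero: "f x = 0" if "comm_eig False s (\<lambda>_. 0) f" "x \<in> V" for s f x
    using that by (auto simp: comm_eig_def orbit_type_def)
  show "V_br1 q = Wsp (part 7)"
    unfolding V_br1_def part_simps
  proof (rule sum_tau_eq[where \<Phi> = "comm_eig False 1"])
    show "admissible (comm_eig False 1)" by (rule admissible_parts(2))
    show "f x = 0" if "comm_eig False 1 (\<lambda>_. 0) f" "x \<in> V" for f x by (rule zero[OF that])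
    show "K_br q (sg q \<tau>) (- of_nat (2 ^ q) / 4) = {syn \<tau> f | f. comm_eig False 1 \<tau> f}" if "\<tau> \<in> V0" for \<tau>
      using K_br_eq[OF that _ q, of 1] by (simp only: mult_1_left simp_thms)
  qed
  show "V_br2 q = Wsp (part 8)"
    unfolding V_br2_def part_simps
  proof (rule sum_tau_eq[where \<Phi> = "comm_eig False (-1)"])
    show "admissible (comm_eig False (-1))" by (rule admissible_parts(2))
    show "f x = 0" if "comm_eig False (-1) (\<lambda>_. 0) f" "x \<in> V" for f x by (rule zero[OF that])
    show "K_br q (sg q \<tau>) (of_nat (2 ^ q) / 4) = {syn \<tau> f | f. comm_eig False (-1) \<tau> f}" if "\<tau> \<in> V0" for \<tau>
      using K_br_eq[OF that _ q, of "-1"] by (simp only: mult_minus1 minus_minus simp_thms)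
  qed
qed

lemma V_cu_eq: "V_cu1 q = Wsp (part 10)" "V_cu2 q = Wsp (part 11)"
proof -
  have zero: "f x = 0" if "anti_eig s (\<lambda>_. 0) f" "x \<in> V" for s f x
    using that anti_zero by (simp add: anti_eig_def)
  show "V_cu1 q = Wsp (part 10)"
    unfolding V_cu1_def part_simps
  proof (rule sum_tau_eq[where \<Phi> = "anti_eig 1"])
    show "admissible (anti_eig 1)" by (rule admissible_parts(5))
    show "f x = 0" if "anti_eig 1 (\<lambda>_. 0) f" "x \<in> V" for f x by (rule zero[OF that])
    show "K_cu q (sg q \<tau>) (of_nat (2 ^ q)) = {syn \<tau> f | f. anti_eig 1 \<tau> f}" if "\<tau> \<in> V0" for \<tau>
      using K_cu_eq[OF that, of 1] by (simp only: mult_1_left)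
  qed
  show "V_cu2 q = Wsp (part 11)"
    unfolding V_cu2_def part_simps
  proof (rule sum_tau_eq[where \<Phi> = "anti_eig (-1)"])
    show "admissible (anti_eig (-1))" by (rule admissible_parts(5))
    show "f x = 0" if "anti_eig (-1) (\<lambda>_. 0) f" "x \<in> V" for f x by (rule zero[OF that])
    show "K_cu q (sg q \<tau>) (- of_nat (2 ^ q)) = {syn \<tau> f | f. anti_eig (-1) \<tau> f}" if "\<tau> \<in> V0" for \<tau>
      using K_cu_eq[OF that, of "-1"] by (simp only: mult_minus1)
  qed
qed

section \<open>Coincidences for few qubits and assembly of the decomposition\<close>

lemma anti_skew_eig:
  assumes q: "q = 1" and \<tau>: "\<tau> \<in> V" and f: "supp_in anti_set \<tau> f" "periodic (-1) \<tau> f"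
  shows "fourier_eig 1 \<tau> f"
  unfolding fourier_eig_def
proof
  fix x assume x: "x \<in> V"
  show "fourier f x = 1 * of_nat (2 ^ q) * f x"
  proof (cases "x \<in> anti_set \<tau>")
    case False
    then show ?thesis using fourier_periodic_zero[OF f(2) \<tau>, of x] f(1) x by (auto simp: supp_in_def anti_set_def)
  next
    case True
    have "2 ^ q = (2 :: nat)" using q by simp
    note Y = anti_set_small[OF True \<tau> this]
    have "f b = 0" if "b \<in> V - {x, x \<boxplus> \<tau>}" for b
      using supp_inD[OF f(1), of b] that by (simp only: Y Diff_iff simp_thms)
    then have "fourier f x = (\<Sum>b\<in>{x, x \<boxplus> \<tau>}. comm_sign q x b * f b)"
      unfolding fourier_def using x \<tau> by (intro sum.mono_neutral_right finite_V) simp_all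
    \<comment> \<open>The point \<open>x \<boxplus> \<tau>\<close> enters with two minus signs, one
      from \<open>comm_sign\<close> and one from skew-periodicity.\<close>
    also have "\<dots> = 2 * f x"
      using anti_setD[OF True] f(2) x by (simp add: periodic_def eps_add)
    finally show ?thesis using q by simp
  qed
qed

text \<open>For one qubit a nonempty \<open>anti_set \<tau>\<close> is a single pair: a periodic
  function on it is constant, and a skew-periodic one is an eigenvector for
  \<open>D\<close>.\<close>

lemma q1_eq:
  assumes q: "q = 1"
  shows "V_S_cu q = Wsp (part 10)" "V_A_cu q = Wsp (part 9)"
proof -
  have "(supp_in anti_set \<tau> f \<and> periodic (-1) \<tau> f) = anti_eig 1 \<tau> f" if "\<tau> \<in> V" for \<tau> f
    using anti_skew_eig[OF q that] by (auto simp: anti_eig_def)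
  then show "V_S_cu q = Wsp (part 10)" unfolding V_S_cu_eq part_simps by (simp add: Wsp_def cong: conj_cong)
  have "(supp_in anti_set \<tau> f \<and> periodic 1 \<tau> f) = const_part False anti_set \<tau> f" if \<tau>: "\<tau> \<in> V" for \<tau> f
  proof (cases "supp_in anti_set \<tau> f")
    case True
    have "periodic 1 \<tau> f \<longleftrightarrow> const_on anti_set \<tau> f"
    proof
      assume p: "periodic 1 \<tau> f"
      show "const_on anti_set \<tau> f"
        unfolding const_on_def
      proof (intro ballI)
        fix a b assume a: "a \<in> anti_set \<tau>" "b \<in> anti_set \<tau>"
        then have "b = a \<or> b = a \<boxplus> \<tau>" using anti_set_small[OF a(1) \<tau>] q by auto
        then show "f a = f b" using p anti_setD[OF a(1)] by (auto simp: periodic_def)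
      qed
    next
      assume c: "const_on anti_set \<tau> f"
      have "f (a \<boxplus> \<tau>) = f a" if a: "a \<in> V" for a
      proof (cases "a \<in> anti_set \<tau>")
        case T: True
        then show ?thesis using c anti_set_shift[OF T \<tau>] unfolding const_on_def by blast
      next
        case F: False
        then have "a \<boxplus> \<tau> \<notin> anti_set \<tau>" using anti_set_shift_iff[OF a \<tau>] by simp
        then show ?thesis using F True a \<tau> supp_inD[OF True] by simp
      qed
      then show "periodic 1 \<tau> f" by (simp add: periodic_def)
    qed
    then show ?thesis using True orbit_type_anti by (simp add: const_part_def)
  qed (simp add: const_part_def)
  then show "V_A_cu q = Wsp (part 9)" unfolding V_A_cu_eq part_simps by (simp add: Wsp_def cong: conj_cong)
qed

lemma D_gt: "q \<ge> 2 \<Longrightarrow> (2::nat) < 2 ^ q" "q \<ge> 3 \<Longrightarrow> (4::nat) < 2 ^ q"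
  using power_increasing[of 2 q "2::nat"] power_increasing[of 3 q "2::nat"] by auto

text \<open>Grouped by the number of qubits from which on the family is nonzero: one, two or
  three.\<close>

lemma irrep_part:
  "i \<in> {0, 1, 2, 3, 4, 9, 10} \<Longrightarrow> irrep_sub q (Wsp (part i))"
  "i \<in> {5, 6, 7, 11, 12, 13} \<Longrightarrow> q \<ge> 2 \<Longrightarrow> irrep_sub q (Wsp (part i))"
  "q \<ge> 3 \<Longrightarrow> irrep_sub q (Wsp (part 8))"
proof -
  obtain \<tau> where \<tau>: "\<tau> \<in> V" "\<tau> \<noteq> (\<lambda>_. 0)" using ex_nonzero by blast
  obtain y where y: "y \<in> anti_set \<tau>" using ex_anti[OF \<tau>] by blast
  have const: "irrep_sub q (Wsp (const_part z R))" if "natural R" "nontrivial (const_part z R)" for z R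
    by (rule irrep_Wsp[OF admissible_parts(1)[OF that(1)] cyclic_const_part that(2), where z = z]) (simp add: const_part_def)
  have nt: "nontrivial (const_part True (\<lambda>_. {\<lambda>_. 0}))" "nontrivial (const_part False (\<lambda>_. {\<lambda>_. 0}))"
    "nontrivial (const_part False (\<lambda>\<tau>. {\<tau>}))" "nontrivial (const_part True comm_set)"
    "nontrivial (const_part False anti_set)"
    using \<tau> y anti_setD[OF y]
    by (auto intro: nontrivial_const_part[of "\<lambda>_. 0" _ "\<lambda>_. 0"] nontrivial_const_part[of \<tau> _ "\<lambda>_. 0"]
        nontrivial_const_part[of \<tau> _ \<tau>] nontrivial_const_part[of "\<lambda>_. 0" _ \<tau>] nontrivial_const_part[of \<tau> _ y]
        simp: pstrings_zero comm_set_def)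
  have ce: "irrep_sub q (Wsp (comm_eig z s))"
    if "s = 1 \<or> s = -1" "z \<or> 2 ^ q > (2::nat)" "nontrivial (comm_eig z s)" for z s
    by (rule irrep_Wsp[OF admissible_parts(2) cyclic_comm_eig[OF that(1,2)] that(3), where z = z]) (simp add: comm_eig_def)
  have ae: "irrep_sub q (Wsp (anti_eig s))" if "s * s = 1" "nontrivial (anti_eig s)" for s
    by (rule irrep_Wsp[OF admissible_parts(5) cyclic_anti_eig[OF that(1)] that(2), where z = False])
      (simp add: anti_eig_def orbit_type_anti)
  have D1: "(1::nat) < 2 ^ q" using D_ge by simp
  show "i \<in> {0, 1, 2, 3, 4, 9, 10} \<Longrightarrow> irrep_sub q (Wsp (part i))"
    using const[OF natural_sets(3) nt(1)] const[OF natural_sets(3) nt(2)] const[OF natural_sets(4) nt(3)]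
      const[OF natural_sets(1) nt(4)] const[OF natural_sets(2) nt(5)]
      ce[OF _ _ nontrivial_comm_eig, of 1 True] ae[OF _ nontrivial_anti_eig, of 1] D1
    by (elim insertE; simp add: part_simps part_simps(2)[unfolded One_nat_def])
  show "irrep_sub q (Wsp (part i))" if i: "i \<in> {5, 6, 7, 11, 12, 13}" and q: "q \<ge> 2"
  proof -
    note D = D_gt(1)[OF q]
    obtain x where x: "x \<in> comm_set \<tau>" using ex_comm \<tau> D by blast
    have nt6: "nontrivial (const_part False comm_set)"
      using nontrivial_const_part[of \<tau> False x comm_set] \<tau> x comm_setD[OF x] by simp
    have 12: "irrep_sub q (Wsp comm_skew)"
      by (rule irrep_Wsp[OF admissible_parts(3) cyclic_comm_skew nontrivial_comm_skew[OF D], where z = False])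
        (auto simp: comm_skew_def orbit_type_def periodic_def)
    have 13: "irrep_sub q (Wsp anti_mean_zero)"
      by (rule irrep_Wsp[OF admissible_parts(4) cyclic_anti_mean_zero nontrivial_anti_mean_zero[OF D], where z = False])
        (simp add: anti_mean_zero_def orbit_type_anti)
    show ?thesis
      using i const[OF natural_sets(1) nt6] 12 13 D
        ce[OF _ _ nontrivial_comm_eig, of "-1" True] ce[OF _ _ nontrivial_comm_eig, of 1 False]
        ae[OF _ nontrivial_anti_eig, of "-1"]
      by (elim insertE; simp add: part_simps)
  qed
  show "irrep_sub q (Wsp (part 8))" if q: "q \<ge> 3"
    using ce[OF _ _ nontrivial_comm_eig, of "-1" False] D_gt[of] q by (simp add: part_simps)
qed

lemma trivial_q2:
  assumes q: "q = 2" and i: "part 8 \<tau> f" and \<tau>: "\<tau> \<in> V" and a: "a \<in> V"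
  shows "f a = 0"
proof (cases "\<tau> = (\<lambda>_. 0)")
  case True
  then show ?thesis using i a by (auto simp: part_simps comm_eig_def orbit_type_def)
next
  case False
  then have D: "2 ^ q = (if \<tau> = (\<lambda>_. 0) then 2 else 4 :: nat)" using q by simp
  have "comm_eig False (-1) \<tau> f" using i by (simp add: part_simps)
  then show ?thesis by (rule comm_eig_trivial[OF \<tau> D _ a])
qed

text \<open>At nonzero weights \<open>comm_set \<tau>\<close> is empty, and at weight zero
  \<open>comm_eig_trivial\<close> excludes index 5. On the single pair in
  \<open>anti_set \<tau>\<close>, a skew-periodic function already has the eigenvalue
  \<open>D\<close>, and a periodic one with sum zero vanishes.\<close>

lemma trivial_q1:
  assumes q: "q = 1" and i: "i \<in> {5, 6, 7, 8, 11, 12, 13}" "part i \<tau> f" and \<tau>: "\<tau> \<in> V" and a: "a \<in> V"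
  shows "f a = 0"
proof -
  have comm: "f a = 0" if "supp_in comm_set \<tau> f" "\<tau> \<noteq> (\<lambda>_. 0)"
    using supp_inD[OF that(1) a] comm_set_empty[OF \<tau> that(2)] q by simp
  have anti: "f a = 0 \<or> a \<in> anti_set \<tau>" if "supp_in anti_set \<tau> f"
    using that a by (auto simp: supp_in_def)
  from i(1) consider "i = 5" | "i \<in> {6, 7, 8}" | "i = 11" | "i = 12" | "i = 13" by blast
  then show ?thesis
  proof cases
    case 1
    then have f: "comm_eig True (-1) \<tau> f" using i(2) by (simp add: part_simps)
    show ?thesis
    proof (cases "\<tau> = (\<lambda>_. 0)")
      case True then show ?thesis using comm_eig_trivial[OF \<tau> _ f a] q by simp
    next
      case False then show ?thesis using f a by (auto simp: comm_eig_def orbit_type_def)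
    qed
  next
    case 2
    then have "supp_in comm_set \<tau> f" "orbit_type False \<tau> f"
      using i(2) by (auto simp: part_simps comm_eig_def const_part_def)
    then show ?thesis using comm a by (auto simp: orbit_type_def)
  next
    case 3
    then have f: "anti_eig (-1) \<tau> f" using i(2) by (simp add: part_simps)
    then have "fourier_eig 1 \<tau> f" using anti_skew_eig[OF q \<tau>] by (simp add: anti_eig_def)
    then have "of_nat (2 ^ q) * f a = - (of_nat (2 ^ q) * f a)"
      using f a by (auto simp: anti_eig_def fourier_eig_def)
    then show ?thesis by simp
  next
    case 4
    then have f: "comm_skew \<tau> f" using i(2) by (simp add: part_simps)
    show ?thesis
    proof (cases "\<tau> = (\<lambda>_. 0)")
      case True then show ?thesis using f a by (simp add: comm_skew_def periodic_def)
    next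
      case False then show ?thesis using comm f by (simp add: comm_skew_def)
    qed
  next
    case 5
    then have f: "anti_mean_zero \<tau> f" using i(2) by (simp add: part_simps)
    have "f a = 0" if aY: "a \<in> anti_set \<tau>"
    proof -
      have "2 ^ q = (2 :: nat)" using q by simp
      note Y = anti_set_small[OF aY \<tau> this]
      have "supp_in anti_set \<tau> f" using f by (simp add: anti_mean_zero_def)
      then have "f b = 0" if "b \<in> V - {a, a \<boxplus> \<tau>}" for b
        using supp_inD[of anti_set \<tau> f b] that by (simp only: Y Diff_iff simp_thms)
      then have "sum f V = (\<Sum>b\<in>{a, a \<boxplus> \<tau>}. f b)"
        using a \<tau> by (intro sum.mono_neutral_right finite_V) simp_all
      also have "\<dots> = 2 * f a" using anti_setD[OF aY] f a by (simp add: anti_mean_zero_def periodic_def)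
      finally show ?thesis using f by (simp add: anti_mean_zero_def zero_sum_def)
    qed
    then show ?thesis using anti f by (auto simp: anti_mean_zero_def)
  qed
qed

lemma irrep_decompositionI:
  assumes "Vs = map (\<lambda>i. Wsp (part i)) ks" "distinct ks" "set ks \<subseteq> {..<14}"
    and "\<And>i \<tau> f a. i < 14 \<Longrightarrow> i \<notin> set ks \<Longrightarrow> \<tau> \<in> V \<Longrightarrow> part i \<tau> f \<Longrightarrow> a \<in> V \<Longrightarrow> f a = 0"
    and "\<And>i. i \<in> set ks \<Longrightarrow> irrep_sub q (Wsp (part i))"
  shows "irrep_decomposition q Vs"
proof -
  have "direct_sum q (map (\<lambda>i. Wsp (part i)) ks)" 
    by (rule direct_sum_parts[OF assms(2,3)]) (fact assms(4))
  then show ?thesis using assms(1,5) by (auto simp: irrep_decomposition_def)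
qed

lemmas V_part_eqs = V_id_eq V_r_eq V_l_eq V_0_eq V_1_eq V_2_eq V_adj_br_eq V_adj_cu_eq
  V_A_br_eq V_adj_perp_eq V_cu_eq

lemma less_14_iff: "i < 14 \<longleftrightarrow> i \<in> {0, 1, 2, 3, 4, 5, 6, 7, 8, 9, 10, 11, 12, 13 :: nat}"
proof
  have "\<forall>i<14. i \<in> {0, 1, 2, 3, 4, 5, 6, 7, 8, 9, 10, 11, 12, 13 :: nat}"
    unfolding all_less_14 by simp
  then show "i < 14 \<Longrightarrow> i \<in> {0, 1, 2, 3, 4, 5, 6, 7, 8, 9, 10, 11, 12, 13}" by blast
qed auto

lemma decomposition_q1:
  assumes "q = 1"
  shows "irrep_decomposition q [V_id q, V_r q, V_l q, V_0 q, V_1 q, V_S_cu q, V_A_cu q]"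
\<comment> \<open>Index 10 precedes 9 because the symmetric space is listed before the antisymmetric
  one.\<close>
proof (rule irrep_decompositionI[where ks = "[0, 1, 2, 3, 4, 10, 9]"])
  fix i \<tau> f a assume i: "i < 14" "i \<notin> set [0, 1, 2, 3, 4, 10, 9]" and *: "\<tau> \<in> V" "part i \<tau> f" "a \<in> V"
  have "i \<in> {5, 6, 7, 8, 11, 12, 13}" using i unfolding less_14_iff by simp
  then show "f a = 0" using trivial_q1[of i \<tau> f a] assms * by (simp only: simp_thms)
next
  fix i :: nat assume "i \<in> set [0, 1, 2, 3, 4, 10, 9]"
  then have "i \<in> {0, 1, 2, 3, 4, 9, 10}" by auto
  then show "irrep_sub q (Wsp (part i))" by (rule irrep_part(1))
qed (simp_all add: V_part_eqs q1_eq[OF assms])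

lemma decomposition_q2:
  assumes q: "q = 2"
  shows "irrep_decomposition q
            [V_id q, V_r q, V_l q, V_0 q, V_1 q, V_2 q, V_adj_br q, V_br1 q,
             V_adj_cu q, V_cu1 q, V_cu2 q, V_A_br q, V_adj_perp q]"
proof (rule irrep_decompositionI[where ks = "[0, 1, 2, 3, 4, 5, 6, 7, 9, 10, 11, 12, 13]"])
  fix i \<tau> f a assume i: "i < 14" "i \<notin> set [0, 1, 2, 3, 4, 5, 6, 7, 9, 10, 11, 12, 13]"
    and *: "\<tau> \<in> V" "part i \<tau> f" "a \<in> V"
  have "i = 8" using i unfolding less_14_iff by simp
  then show "f a = 0" using trivial_q2[of \<tau> f a] q * by (simp only:)
next
  fix i :: nat assume "i \<in> set [0, 1, 2, 3, 4, 5, 6, 7, 9, 10, 11, 12, 13]"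
  then consider "i \<in> {0, 1, 2, 3, 4, 9, 10}" | "i \<in> {5, 6, 7, 11, 12, 13}" by auto
  then show "irrep_sub q (Wsp (part i))" using irrep_part(1,2) q by cases simp_all
qed (simp_all add: V_part_eqs V_br_eq[OF eq_imp_le[OF q[symmetric]]])

lemma decomposition_q3:
  assumes q: "q \<ge> 3"
  shows "irrep_decomposition q
            [V_id q, V_r q, V_l q, V_0 q, V_1 q, V_2 q, V_adj_br q, V_br1 q, V_br2 q,
             V_adj_cu q, V_cu1 q, V_cu2 q, V_A_br q, V_adj_perp q]"
proof (rule irrep_decompositionI[where ks = "[0, 1, 2, 3, 4, 5, 6, 7, 8, 9, 10, 11, 12, 13]"])
  fix i \<tau> f a assume "i < 14" "i \<notin> set [0, 1, 2, 3, 4, 5, 6, 7, 8, 9, 10, 11, 12, 13 :: nat]"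
  then have False unfolding less_14_iff by simp
  then show "f a = 0" ..
next
  fix i :: nat assume "i \<in> set [0, 1, 2, 3, 4, 5, 6, 7, 8, 9, 10, 11, 12, 13]"
  then consider "i \<in> {0, 1, 2, 3, 4, 9, 10}" | "i \<in> {5, 6, 7, 11, 12, 13}" | "i = 8" by auto
  then show "irrep_sub q (Wsp (part i))"
  proof cases
    case 1 then show ?thesis by (rule irrep_part(1))
  next
    case 2 then show ?thesis using q by (intro irrep_part(2)) simp_all
  next
    case 3 then show ?thesis using irrep_part(3)[OF q] by simp
  qed
qed (use q in \<open>simp_all add: V_part_eqs V_br_eq\<close>)

end

theorem theorem1:
  fixes q :: nat
  assumes "q \<ge> 1"
  shows "(q = 1 \<longrightarrow> irrep_decomposition q
            [V_id q, V_r q, V_l q, V_0 q, V_1 q, V_S_cu q, V_A_cu q])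
       \<and> (q = 2 \<longrightarrow> irrep_decomposition q
            [V_id q, V_r q, V_l q, V_0 q, V_1 q, V_2 q, V_adj_br q, V_br1 q,
             V_adj_cu q, V_cu1 q, V_cu2 q, V_A_br q, V_adj_perp q])
       \<and> (q \<ge> 3 \<longrightarrow> irrep_decomposition q
            [V_id q, V_r q, V_l q, V_0 q, V_1 q, V_2 q, V_adj_br q, V_br1 q, V_br2 q,
             V_adj_cu q, V_cu1 q, V_cu2 q, V_A_br q, V_adj_perp q])"
proof -
  interpret qubits q by unfold_locales (rule assms)
  show ?thesis using decomposition_q1 decomposition_q2 decomposition_q3 by blast
qed

end
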